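(* Suppose $1\leq p<\infty$, $\omega$ is a Dini weight for which there is a constant $C>0$ with $\frac{\omega(t)}{t}\geq C$ for all $0<t<1$, and $f\in H^p$. Then the following are equivalent: (b) $M_p(r,f')=O\left(\frac{\omega(1-r)}{1-r}\right)$ as $r\to 1^{-}$; (c) $\|f_r-f\|_p=O(\omega(1-r))$ as $r\to 1^{-}$. In particular, if $\omega$ is an admissible weight, $1\le p<\infty$ and $f\in H^p$, then (b), (c) and the following condition are all equivalent: (a) $f\in\Lambda(p,\omega)$.
   Context: $\mathbb{D}$ is the open unit disc in $\mathbb{C}$. For $g$ analytic on $\mathbb{D}$, $1\leq p<\infty$ and $0\leq r<1$, $M_p(r,g)=\left(\frac{1}{2\pi}\int_{-\pi}^{\pi}|g(re^{i\theta})|^p\,d\theta\right)^{1/p}$. The Hardy space $H^p$ consists of all analytic $g:\mathbb{D}\to\mathbb{C}$ with $\|g\|_p=\sup_{0\leq r<1}M_p(r,g)<\infty$. Each $f\in H^p$ has radial limits $f^{*}(\theta)=\lim_{r\to1^-}f(re^{i\theta})$ for almost every $\theta\in[-\pi,\pi]$; $f^{*}$ is extended $2\pi$-periodically to $\mathbb{R}$, and for $t\in\mathbb{R}$ one writes $\tau_t(f^{*})(\theta)=f^{*}(\theta+t)$. For a function $h\in L^p(-\pi,\pi)$, $\|h\|_p=\left(\frac{1}{2\pi}\int_{-\pi}^{\pi}|h(\theta)|^p\,d\theta\right)^{1/p}$. The dilations of $f$ are $f_r(z)=f(rz)$, $0\leq r<1$. A weight is a continuous nondecreasing function $\omega:[0,1)\to[0,\infty)$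 with $\omega(0)=0$. The weighted mean Lipschitz space $\Lambda(p,\omega)$ consists of all $f\in H^p$ such that $\|\tau_t(f^{*})-f^{*}\|_p=O(\omega(|t|))$ as $t\to0$. A weight $\omega$ is a Dini weight if $\omega(t)/t$ is integrable on $[0,1)$ and there is a constant $C$ such that $\int_0^t\frac{\omega(s)}{s}\,ds\leq C\,\omega(t)$ for all $0<t<1$. A weight $\omega$ is an admissible weight if it is a Dini weight and in addition there is a constant $C$ such that $\int_t^1\frac{\omega(s)}{s^2}\,ds\leq C\,\frac{\omega(t)}{t}$ for all $0<t<1$. *)

theory Defs
  imports "HOL-Complex_Analysis.Complex_Analysis" "HOL-Library.Landau_Symbols"
begin

definition Lp_norm :: "real \<Rightarrow> (real \<Rightarrow> complex) \<Rightarrow> real" where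
  "Lp_norm p h =
    (1 / (2 * pi) * (LINT \<theta>:{-pi..pi}|lebesgue. norm (h \<theta>) powr p)) powr (1 / p)"

definition integral_mean :: "real \<Rightarrow> real \<Rightarrow> (complex \<Rightarrow> complex) \<Rightarrow> real" where
  "integral_mean p r g = Lp_norm p (\<lambda>\<theta>. g (of_real r * cis \<theta>))"

text \<open>Functions on the open unit disc are total functions on the complex plane; values outside
  the disc are irrelevant.\<close>

definition hardy_space :: "real \<Rightarrow> (complex \<Rightarrow> complex) set" where
  "hardy_space p =
    {g. g holomorphic_on ball 0 1 \<and> bdd_above ((\<lambda>r. integral_mean p r g) ` {0..<1})}"

text \<open>The supremum is taken in the reals, so this is meaningful only on the Hardy space.\<close>

definition hardy_norm :: "real \<Rightarrow> (complex \<Rightarrow> complex) \<Rightarrow> real" where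
  "hardy_norm p g = (SUP r\<in>{0..<1}. integral_mean p r g)"

text \<open>The radial limit is taken at every real angle, so the function below already is the
  periodic extension of the boundary function; it is set to zero on the (null, for functions in
  a Hardy space) set of angles where the limit does not exist.\<close>

definition boundary_fun :: "(complex \<Rightarrow> complex) \<Rightarrow> real \<Rightarrow> complex" where
  "boundary_fun f \<theta> =
    (if \<exists>l. ((\<lambda>r. f (of_real r * cis \<theta>)) \<longlongrightarrow> l) (at_left 1)
     then Lim (at_left 1) (\<lambda>r. f (of_real r * cis \<theta>)) else 0)"

definition translate :: "real \<Rightarrow> (real \<Rightarrow> complex) \<Rightarrow> real \<Rightarrow> complex" where
  "translate t h \<theta> = h (\<theta> + t)"

definition dilation :: "real \<Rightarrow> (complex \<Rightarrow> complex) \<Rightarrow> complex \<Rightarrow> complex" where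
  "dilation r f z = f (of_real r * z)"

definition weight :: "(real \<Rightarrow> real) \<Rightarrow> bool" where
  "weight \<omega> \<longleftrightarrow> continuous_on {0..<1} \<omega> \<and> mono_on {0..<1} \<omega> \<and>
    (\<forall>t\<in>{0..<1}. 0 \<le> \<omega> t) \<and> \<omega> 0 = 0"

definition mean_lipschitz_space :: "real \<Rightarrow> (real \<Rightarrow> real) \<Rightarrow> (complex \<Rightarrow> complex) set" where
  "mean_lipschitz_space p \<omega> =
    {f \<in> hardy_space p.
      (\<lambda>t. Lp_norm p (\<lambda>\<theta>. translate t (boundary_fun f) \<theta> - boundary_fun f \<theta>))
        \<in> O[at 0](\<lambda>t. \<omega> \<bar>t\<bar>)}"

definition dini_weight :: "(real \<Rightarrow> real) \<Rightarrow> bool" where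
  "dini_weight \<omega> \<longleftrightarrow> weight \<omega> \<and> set_integrable lborel {0<..<1} (\<lambda>t. \<omega> t / t) \<and>
    (\<exists>C. \<forall>t\<in>{0<..<1}. (LBINT s:{0<..<t}. \<omega> s / s) \<le> C * \<omega> t)"

text \<open>The integrals below converge: a Dini weight makes \<open>\<omega> s / s\<close> integrable on the unit interval,
  and \<open>1 / s\<close> is bounded away from zero.\<close>

definition admissible_weight :: "(real \<Rightarrow> real) \<Rightarrow> bool" where
  "admissible_weight \<omega> \<longleftrightarrow> dini_weight \<omega> \<and>
    (\<exists>C. \<forall>t\<in>{0<..<1}. (LBINT s:{t<..<1}. \<omega> s / s\<^sup>2) \<le> C * (\<omega> t / t))"

end

theory Submission
  imports Defs
begin

text \<open>Write \<open>M r g\<close> for the integral mean of order \<open>p\<close> of \<open>g\<close> on the circle of radius \<open>r\<close>, \<open>f\<^sub>r\<close>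
  for the dilation of \<open>f\<close>, and \<open>f*\<close> for the function of radial limits.

  The passage from the growth of \<open>f'\<close> to the dilations is an integration along radii: \<open>f z - f (r z)\<close>
  is an integral of \<open>f'\<close>, Minkowski's inequality bounds its mean by the integral of \<open>M s f'\<close> over
  \<open>r < s < 1\<close>, and the Dini condition says that this is at most a multiple of \<open>\<omega> (1 - r)\<close>
  (\<open>derivative_growth_imp_dilation_bound\<close>). For the converse put \<open>\<phi> t = t * M (1 - t) f'\<close>. On the circle
  of radius \<open>1 - t\<close>, Taylor's formula with a radial step \<open>t / 16\<close> expresses \<open>f'\<close> by a difference of \<open>f\<close>
  and a dilation, up to a remainder governed by \<open>f''\<close>, and Cauchy's estimate bounds \<open>f''\<close> by
  \<open>M (1 - t / 2) f'\<close>. The result is \<open>\<phi> t \<le> 32 * K * \<omega> t + \<phi> (t / 2) / 2\<close>. As \<open>\<phi>\<close> is bounded for every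
  function in the Hardy space, iterating this inequality gives \<open>\<phi> t \<le> 64 * K * \<omega> t\<close>
  (\<open>dilation_bound_imp_derivative_growth\<close>).

  If \<open>f'\<close> has the stated growth and \<open>r = 1 - \<bar>t\<bar>\<close>, then \<open>f* (\<theta> + t) - f* \<theta>\<close> is compared with the same
  difference on the circle of radius \<open>r\<close>: the two errors are controlled by the dilation estimate and the
  middle term by integrating \<open>f'\<close> along an arc of length at most \<open>\<bar>t\<bar>\<close>
  (\<open>derivative_growth_imp_mean_lipschitz\<close>). Conversely \<open>f' (r e\<^sup>i\<^sup>\<theta>)\<close> is an average of the increments
  \<open>f* (\<theta> + t) - f* \<theta>\<close> against a kernel of size at most a constant times the minimum of \<open>1 / (1 - r)\<^sup>2\<close> and
  \<open>1 / t\<^sup>2\<close>. Minkowski's inequality and the second integral condition on an admissible weight bound its mean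
  (\<open>mean_lipschitz_imp_derivative_growth\<close>).

  This last step needs \<open>f\<close> to be recovered from its radial limits, also for \<open>p = 1\<close>. A function in \<open>H\<^sup>1\<close>
  is a product of two functions in \<open>H\<^sup>2\<close> (\<open>Riesz_factorization\<close>): on smaller circles zeros are exchanged for
  factors without zeros in the disc but of the same modulus on the circle, a square root is taken, and
  Montel's theorem allows the radius to tend to \<open>1\<close>. In \<open>H\<^sup>2\<close> Parseval's identity makes the functions \<open>f\<^sub>r\<close>
  Cauchy in the mean; the Cauchy-Schwarz inequality transfers this to \<open>H\<^sup>1\<close>, so that \<open>f\<^sub>r\<close> converges in \<open>L\<^sup>1\<close>
  to a function \<open>h\<close> on the circle (\<open>L1_boundary_function\<close>). Finally \<open>f\<close> is the Poisson integral of \<open>h\<close> and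
  therefore has the radial limit \<open>h \<theta>\<close> at every point where the indefinite integral of \<open>h\<close> has derivative
  \<open>h \<theta>\<close> from both sides, which is almost everywhere (\<open>AE_radial_limit\<close>).\<close>

section \<open>Bounds in the mean on the circle\<close>

text \<open>Normalized arc length. A function on the circle is represented by a function of the angle with
  period \<open>2 * pi\<close> on the whole line, so that translations need no reduction modulo the period.\<close>

definition circ :: "real measure" where
  "circ = density lborel (\<lambda>\<theta>. ennreal (indicator {-pi..pi} \<theta> / (2 * pi)))"

lemma sets_circ [simp, measurable_cong]: "sets circ = sets borel"
  by (simp add: circ_def)

lemma space_circ [simp]: "space circ = UNIV"
  by (simp add: circ_def)

lemma nn_integral_circ:
  assumes [measurable]: "f \<in> borel_measurable borel"
  shows "(\<integral>\<^sup>+x. f x \<partial>circ) = (\<integral>\<^sup>+x. ennreal (indicator {-pi..pi} x / (2 * pi)) * f x \<partial>lborel)"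
  unfolding circ_def by (subst nn_integral_density) auto

lemma integral_circ:
  fixes f :: "real \<Rightarrow> 'a::{banach,second_countable_topology}"
  assumes [measurable]: "f \<in> borel_measurable borel"
  shows "integral\<^sup>L circ f = (1 / (2 * pi)) *\<^sub>R (LBINT x:{-pi..pi}. f x)"
proof -
  have "integral\<^sup>L circ f = (LBINT x. (indicator {-pi..pi} x / (2 * pi)) *\<^sub>R f x)"
    unfolding circ_def by (subst integral_density) auto
  also have "(\<lambda>x. (indicator {-pi..pi} x / (2 * pi)) *\<^sub>R f x)
      = (\<lambda>x. (1 / (2 * pi)) *\<^sub>R (indicator {-pi..pi} x *\<^sub>R f x))"
    by (auto simp: fun_eq_iff)
  finally show ?thesis
    by (simp only: set_lebesgue_integral_def integral_scaleR_right)
qed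

lemma integrable_scaleR_cancel:
  fixes g :: "'a \<Rightarrow> 'b::{banach,second_countable_topology}"
  assumes "c \<noteq> 0"
  shows "integrable M (\<lambda>x. c *\<^sub>R g x) \<longleftrightarrow> integrable M g"
  using integrable_scaleR_right[of c M g] integrable_scaleR_right[of "1 / c" M "\<lambda>x. c *\<^sub>R g x"] assms
  by auto

lemma integrable_circ_iff:
  fixes f :: "real \<Rightarrow> 'a::{banach,second_countable_topology}"
  assumes [measurable]: "f \<in> borel_measurable borel"
  shows "integrable circ f \<longleftrightarrow> set_integrable lborel {-pi..pi} f"
proof -
  have "integrable circ f \<longleftrightarrow> integrable lborel (\<lambda>x. (indicator {-pi..pi} x / (2 * pi)) *\<^sub>R f x)"
    unfolding circ_def by (subst integrable_density) auto
  also have "(\<lambda>x. (indicator {-pi..pi} x / (2 * pi)) *\<^sub>R f x)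
      = (\<lambda>x. (1 / (2 * pi)) *\<^sub>R (indicator {-pi..pi} x *\<^sub>R f x))"
    by (auto simp: fun_eq_iff)
  also have "integrable lborel \<dots> \<longleftrightarrow> integrable lborel (\<lambda>x. indicator {-pi..pi} x *\<^sub>R f x)"
    by (rule integrable_scaleR_cancel) simp
  finally show ?thesis
    by (simp only: set_integrable_def)
qed

lemma emeasure_circ_UNIV: "emeasure circ UNIV = 1"
proof -
  have "emeasure circ UNIV = (\<integral>\<^sup>+x. 1 \<partial>circ)" by simp
  also have "\<dots> = (\<integral>\<^sup>+x. ennreal (1/(2*pi)) * indicator {-pi..pi} x \<partial>lborel)"
    by (subst nn_integral_circ) (auto intro!: nn_integral_cong split: split_indicator)
  also have "\<dots> = ennreal (1/(2*pi)) * ennreal (2 * pi)"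
    by (subst nn_integral_cmult) auto
  also have "\<dots> = 1" by (simp flip: ennreal_mult)
  finally show ?thesis .
qed

lemma measure_circ_UNIV [simp]: "measure circ UNIV = 1"
  by (simp add: measure_def emeasure_circ_UNIV)

interpretation circ: finite_measure circ
  by standard (simp add: emeasure_circ_UNIV)

lemma AE_circ_iff: "(AE x in circ. P x) \<longleftrightarrow> (AE x in lborel. x \<in> {-pi..pi} \<longrightarrow> P x)"
proof -
  have "(AE x in circ. P x) \<longleftrightarrow> (AE x in lborel. 0 < ennreal (indicator {-pi..pi} x / (2 * pi)) \<longrightarrow> P x)"
    unfolding circ_def by (subst AE_density) auto
  also have "\<dots> \<longleftrightarrow> (AE x in lborel. x \<in> {-pi..pi} \<longrightarrow> P x)"
    by (intro AE_cong) (auto split: split_indicator)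
  finally show ?thesis .
qed

text \<open>The weighted inequality of the means for \<open>c powr (1 - p) * u powr p\<close> and \<open>c\<close>. Since the bound is affine
  in \<open>u powr p\<close> it can be integrated termwise, and \<open>c\<close> can be chosen after the integration.\<close>

lemma Young_affine_bound:
  fixes u c p :: real
  assumes "1 \<le> p" "0 \<le> u" "0 < c"
  shows "u \<le> (c powr (1 - p) * u powr p + (p - 1) * c) / p"
proof (cases "u = 0")
  case False
  have "(c powr (1 - p) * u powr p) powr (1 / p) * c powr (1 - 1 / p)
      = c powr ((1 - p) / p) * c powr (1 - 1 / p) * u"
    using assms False by (simp add: powr_mult powr_powr)
  also have "c powr ((1 - p) / p) * c powr (1 - 1 / p) = 1"
    using assms by (simp add: diff_divide_distrib flip: powr_add)
  finally have "u \<le> 1 / p * (c powr (1 - p) * u powr p) + (1 - 1 / p) * c"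
    using Youngs_inequality_0[of "1 / p" "1 - 1 / p" "c powr (1 - p) * u powr p" c] assms False by simp
  also have "\<dots> = (c powr (1 - p) * u powr p + (p - 1) * c) / p"
    using assms by (simp add: field_simps)
  finally show ?thesis .
qed (use assms in auto)

text \<open>The affine bound is integrated and the best constant, \<open>c = (T / W) powr (1 / p)\<close>, is inserted. For
  \<open>T = 0\<close> there is no best constant, and \<open>c\<close> tends to \<open>0\<close> instead.\<close>

lemma weighted_Jensen:
  fixes u w :: "'a \<Rightarrow> real"
  assumes p: "1 \<le> p" and [measurable]: "u \<in> borel_measurable M" "w \<in> borel_measurable M"
    and nonneg: "\<And>x. 0 \<le> u x" "\<And>x. 0 \<le> w x"
    and W: "(\<integral>\<^sup>+x. w x \<partial>M) \<le> ennreal W" "0 < W"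
    and T: "(\<integral>\<^sup>+x. (u x powr p * w x) \<partial>M) \<le> ennreal T" "0 \<le> T"
  shows "(\<integral>\<^sup>+x. (u x * w x) \<partial>M) \<le> ennreal (T powr (1 / p) * W powr (1 - 1 / p))"
proof -
  have bound: "(\<integral>\<^sup>+x. (u x * w x) \<partial>M) \<le> ennreal ((c powr (1 - p) * T + (p - 1) * c * W) / p)"
    if c: "0 < c" for c
  proof -
    have "(\<integral>\<^sup>+x. (u x * w x) \<partial>M)
       \<le> (\<integral>\<^sup>+x. (ennreal (c powr (1 - p) / p) * ennreal (u x powr p * w x)
              + ennreal ((p - 1) * c / p) * ennreal (w x)) \<partial>M)"
    proof (intro nn_integral_mono)
      fix x
      have "u x * w x \<le> (c powr (1 - p) * u x powr p + (p - 1) * c) / p * w x"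
        using Young_affine_bound[OF p _ c, of "u x"] nonneg by (intro mult_right_mono) auto
      also have "\<dots> = c powr (1 - p) / p * (u x powr p * w x) + (p - 1) * c / p * w x"
        using p by (simp add: field_simps)
      finally show "ennreal (u x * w x) \<le> ennreal (c powr (1 - p) / p) * ennreal (u x powr p * w x)
              + ennreal ((p - 1) * c / p) * ennreal (w x)"
        using p c nonneg by (simp add: ennreal_leI flip: ennreal_mult ennreal_plus)
    qed
    also have "\<dots> = ennreal (c powr (1 - p) / p) * (\<integral>\<^sup>+x. (u x powr p * w x) \<partial>M)
              + ennreal ((p - 1) * c / p) * (\<integral>\<^sup>+x. w x \<partial>M)"
      by (simp add: nn_integral_add nn_integral_cmult)
    also have "\<dots> \<le> ennreal (c powr (1 - p) / p) * ennreal T + ennreal ((p - 1) * c / p) * ennreal W"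
      using W T by (intro add_mono mult_left_mono) auto
    also have "\<dots> = ennreal ((c powr (1 - p) * T + (p - 1) * c * W) / p)"
      using p c W T by (simp add: add_divide_distrib flip: ennreal_mult ennreal_plus)
    finally show ?thesis .
  qed
  show ?thesis
  proof (cases "T = 0")
    case True
    have "(\<integral>\<^sup>+x. (u x * w x) \<partial>M) \<le> ennreal e" if "0 < e" for e
    proof -
      have "(\<integral>\<^sup>+x. (u x * w x) \<partial>M) \<le> ennreal ((p - 1) * (e / W) * W / p)"
        using bound[of "e / W"] True that W by simp
      also have "\<dots> \<le> ennreal e"
        using p W that by (intro ennreal_leI) (simp add: field_simps)
      finally show ?thesis .
    qed
    then have "(\<integral>\<^sup>+x. (u x * w x) \<partial>M) \<le> 0"
      by (intro ennreal_le_epsilon[where y = 0]) (auto simp del: le_zero_eq)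
    then show ?thesis by simp
  next
    case False
    define c where "c = (T / W) powr (1 / p)"
    have c: "0 < c" using False W by (simp add: c_def)
    have "c powr (1 - p) * T = c * W"
    proof -
      have "c powr (1 - p) * T = c * (c powr (- p) * T)"
        using c by (simp add: powr_diff powr_minus field_simps)
      also have "c powr (-p) = W / T"
        using False W T p by (simp add: c_def powr_powr powr_minus)
      finally show ?thesis using False by simp
    qed
    then have "(c powr (1 - p) * T + (p - 1) * c * W) / p = c * W"
      using p by (simp add: field_simps)
    also have "\<dots> = T powr (1 / p) * W powr (1 - 1 / p)"
      using W T by (simp add: c_def powr_divide powr_diff)
    finally show ?thesis using bound[OF c] by simp
  qed
qed

text \<open>Jensen's inequality for the weight \<open>w\<close>, applied to \<open>norm (F x y) / w y\<close>, replaces the power of the inner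
  integral by an integral of powers; exchanging the integrals then leaves \<open>W powr (p - 1)\<close> times the integral
  of \<open>w\<close>. A majorant \<open>w\<close> in place of the norms of the functions \<open>F _ y\<close> makes it possible to use explicit weights later.\<close>

lemma integral_Minkowski:
  fixes F :: "'a \<Rightarrow> 'b \<Rightarrow> 'c::{banach,second_countable_topology}" and w :: "'b \<Rightarrow> real"
  assumes p: "1 \<le> p" and M: "sigma_finite_measure M" and N: "sigma_finite_measure N"
    and F: "(\<lambda>(x, y). F x y) \<in> borel_measurable (M \<Otimes>\<^sub>M N)"
    and w[measurable]: "w \<in> borel_measurable N" and nonneg: "\<And>y. 0 \<le> w y"
    and W: "(\<integral>\<^sup>+y. w y \<partial>N) \<le> ennreal W" "0 < W"
    and zero: "\<And>x y. w y = 0 \<Longrightarrow> F x y = 0"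
    and bound: "\<And>y. (\<integral>\<^sup>+x. norm (F x y) powr p \<partial>M) \<le> ennreal (w y powr p)"
  shows "(\<integral>\<^sup>+x. norm (LINT y|N. F x y) powr p \<partial>M) \<le> ennreal (W powr p)"
proof -
  interpret M: sigma_finite_measure M by fact
  interpret N: sigma_finite_measure N by fact
  interpret pair_sigma_finite M N by standard
  note F[measurable]
  define u where "u x y = norm (F x y) / w y" for x y
  have uw: "u x y * w y = norm (F x y)" for x y
    using zero[of y x] by (auto simp: u_def)
  have u0: "0 \<le> u x y" for x y using nonneg[of y] by (simp add: u_def)
  have [measurable]: "(\<lambda>(x, y). u x y) \<in> borel_measurable (M \<Otimes>\<^sub>M N)"
    unfolding u_def by measurable
  have pointwise: "ennreal (norm (LINT y|N. F x y) powr p)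
      \<le> ennreal (W powr (p - 1)) * (\<integral>\<^sup>+y. (u x y powr p * w y) \<partial>N)" if x: "x \<in> space M" for x
  proof (cases "(\<integral>\<^sup>+y. (u x y powr p * w y) \<partial>N)")
    case (real T)
    have [measurable]: "(\<lambda>y. F x y) \<in> borel_measurable N" "(\<lambda>y. u x y) \<in> borel_measurable N"
      using x by measurable
    have "norm (LINT y|N. F x y) \<le> T powr (1 / p) * W powr (1 - 1 / p)"
    proof (cases "integrable N (F x)")
      case True
      have "ennreal (norm (LINT y|N. F x y)) \<le> ennreal (LINT y|N. norm (F x y))"
        by (intro ennreal_leI) simp
      also have "\<dots> = (\<integral>\<^sup>+y. u x y * w y \<partial>N)"
        using True by (simp add: nn_integral_eq_integral uw)
      also have "\<dots> \<le> ennreal (T powr (1 / p) * W powr (1 - 1 / p))"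
        using real W nonneg u0 by (intro weighted_Jensen[OF p]) auto
      finally show ?thesis by simp
    qed (use real in \<open>auto simp: not_integrable_integral_eq\<close>)
    then have "norm (LINT y|N. F x y) powr p \<le> (T powr (1 / p) * W powr (1 - 1 / p)) powr p"
      using p by (intro powr_mono2) auto
    also have "\<dots> = W powr (p - 1) * T"
      using p real W by (simp add: powr_mult powr_powr algebra_simps)
    finally show ?thesis
      using real by (simp add: ennreal_leI flip: ennreal_mult)
  next
    case top
    then show ?thesis using W by (simp add: ennreal_mult_top)
  qed
  have "(\<integral>\<^sup>+x. norm (LINT y|N. F x y) powr p \<partial>M)
      \<le> (\<integral>\<^sup>+x. ennreal (W powr (p - 1)) * (\<integral>\<^sup>+y. (u x y powr p * w y) \<partial>N) \<partial>M)"
    by (intro nn_integral_mono pointwise)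
  also have "\<dots> = ennreal (W powr (p - 1)) * (\<integral>\<^sup>+x. (\<integral>\<^sup>+y. (u x y powr p * w y) \<partial>N) \<partial>M)"
    by (intro nn_integral_cmult) measurable
  also have "(\<integral>\<^sup>+x. (\<integral>\<^sup>+y. (u x y powr p * w y) \<partial>N) \<partial>M) = (\<integral>\<^sup>+y. (\<integral>\<^sup>+x. (u x y powr p * w y) \<partial>M) \<partial>N)"
    by (rule Fubini'[symmetric]) measurable
  also have "\<dots> \<le> (\<integral>\<^sup>+y. w y \<partial>N)"
  proof (intro nn_integral_mono)
    fix y assume y: "y \<in> space N"
    have [measurable]: "(\<lambda>x. F x y) \<in> borel_measurable M" using y by measurable
    show "(\<integral>\<^sup>+x. (u x y powr p * w y) \<partial>M) \<le> ennreal (w y)"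
    proof (cases "w y = 0")
      case False
      with nonneg[of y] have wy: "0 < w y" by simp
      have "(\<integral>\<^sup>+x. (u x y powr p * w y) \<partial>M)
          = (\<integral>\<^sup>+x. ennreal (w y powr (1 - p)) * ennreal (norm (F x y) powr p) \<partial>M)"
        using wy by (intro nn_integral_cong)
          (simp add: u_def powr_divide powr_diff mult.commute flip: ennreal_mult)
      also have "\<dots> = ennreal (w y powr (1 - p)) * (\<integral>\<^sup>+x. norm (F x y) powr p \<partial>M)"
        by (intro nn_integral_cmult) measurable
      also have "\<dots> \<le> ennreal (w y powr (1 - p)) * ennreal (w y powr p)"
        by (intro mult_left_mono bound) auto
      also have "\<dots> = ennreal (w y)"
        using wy by (simp flip: ennreal_mult powr_add)
      finally show ?thesis .
    qed simp
  qed
  also have "\<dots> \<le> ennreal W" by fact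
  finally have "(\<integral>\<^sup>+x. norm (LINT y|N. F x y) powr p \<partial>M) \<le> ennreal (W powr (p - 1)) * ennreal W"
    by (simp add: mult_left_mono)
  also have "\<dots> = ennreal (W powr p)"
    using W by (simp add: powr_diff flip: ennreal_mult)
  finally show ?thesis .
qed

lemma periodic_int_shift:
  fixes f :: "real \<Rightarrow> 'a"
  assumes "\<And>\<theta>. f (\<theta> + 2 * pi) = f \<theta>"
  shows "f (\<theta> + 2 * pi * of_int k) = f \<theta>"
proof -
  have nat: "f (\<theta> + 2 * pi * real n) = f \<theta>" for n \<theta>
  proof (induction n)
    case (Suc n)
    show ?case using assms[of "\<theta> + 2 * pi * real n"] Suc by (simp add: algebra_simps)
  qed simp
  show ?thesis
  proof (cases "0 \<le> k")
    case True
    then show ?thesis using nat[of \<theta> "nat k"] by simp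
  next
    case False
    then show ?thesis using nat[of "\<theta> + 2 * pi * of_int k" "nat (- k)"] by (simp add: algebra_simps)
  qed
qed

text \<open>The part of the shifted interval that lies beyond \<open>pi\<close> is moved back by one period.\<close>

lemma nn_integral_circ_translate:
  fixes f :: "real \<Rightarrow> ennreal"
  assumes [measurable]: "f \<in> borel_measurable borel" and per: "\<And>\<theta>. f (\<theta> + 2 * pi) = f \<theta>"
  shows "(\<integral>\<^sup>+\<theta>. f (\<theta> + t) \<partial>circ) = (\<integral>\<^sup>+\<theta>. f \<theta> \<partial>circ)"
proof -
  have circ: "(\<integral>\<^sup>+\<theta>. g \<theta> \<partial>circ) = ennreal (1 / (2 * pi)) * (\<integral>\<^sup>+\<theta>. indicator {-pi..pi} \<theta> * g \<theta> \<partial>lborel)"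
    if [measurable]: "g \<in> borel_measurable borel" for g :: "real \<Rightarrow> ennreal"
  proof -
    have "(\<integral>\<^sup>+\<theta>. g \<theta> \<partial>circ)
        = (\<integral>\<^sup>+\<theta>. ennreal (1 / (2 * pi)) * (indicator {-pi..pi} \<theta> * g \<theta>) \<partial>lborel)"
      by (subst nn_integral_circ) (auto intro!: nn_integral_cong split: split_indicator)
    then show ?thesis by (simp add: nn_integral_cmult)
  qed
  have shift: "(\<integral>\<^sup>+\<theta>. indicator {-pi..pi} \<theta> * f (\<theta> + s) \<partial>lborel)
      = (\<integral>\<^sup>+\<theta>. indicator {-pi..pi} \<theta> * f \<theta> \<partial>lborel)" if s: "0 \<le> s" "s < 2 * pi" for s
  proof -
    have "(\<integral>\<^sup>+\<theta>. indicator {-pi..pi} \<theta> * f (\<theta> + s) \<partial>lborel)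
        = (\<integral>\<^sup>+\<theta>. indicator {-pi..pi} (-s + 1 * \<theta>) * f (-s + 1 * \<theta> + s) \<partial>lborel)"
      by (subst nn_integral_real_affine[of _ 1 "-s"]) auto
    also have "\<dots> = (\<integral>\<^sup>+\<theta>. indicator {-pi+s..<pi} \<theta> * f \<theta> + indicator {pi..pi+s} \<theta> * f \<theta> \<partial>lborel)"
      using s by (intro nn_integral_cong) (auto split: split_indicator)
    also have "\<dots> = (\<integral>\<^sup>+\<theta>. indicator {-pi+s..<pi} \<theta> * f \<theta> \<partial>lborel)
        + (\<integral>\<^sup>+\<theta>. indicator {pi..pi+s} \<theta> * f \<theta> \<partial>lborel)"
      by (subst nn_integral_add) auto
    also have "(\<integral>\<^sup>+\<theta>. indicator {pi..pi+s} \<theta> * f \<theta> \<partial>lborel)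
        = (\<integral>\<^sup>+\<theta>. indicator {pi..pi+s} (2 * pi + 1 * \<theta>) * f (2 * pi + 1 * \<theta>) \<partial>lborel)"
      by (subst nn_integral_real_affine[of _ 1 "2 * pi"]) auto
    also have "\<dots> = (\<integral>\<^sup>+\<theta>. indicator {-pi..-pi+s} \<theta> * f \<theta> \<partial>lborel)"
      using per by (intro nn_integral_cong) (auto simp: add.commute split: split_indicator)
    also have "(\<integral>\<^sup>+\<theta>. indicator {-pi+s..<pi} \<theta> * f \<theta> \<partial>lborel)
        + (\<integral>\<^sup>+\<theta>. indicator {-pi..-pi+s} \<theta> * f \<theta> \<partial>lborel)
        = (\<integral>\<^sup>+\<theta>. indicator {-pi+s..<pi} \<theta> * f \<theta> + indicator {-pi..-pi+s} \<theta> * f \<theta> \<partial>lborel)"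
      by (subst nn_integral_add) auto
    also have "\<dots> = (\<integral>\<^sup>+\<theta>. indicator {-pi..pi} \<theta> * f \<theta> \<partial>lborel)"
    proof (rule nn_integral_cong_AE)
      have "AE \<theta> in lborel. \<theta> \<noteq> -pi + s" "AE \<theta> in lborel. \<theta> \<noteq> pi"
        by (rule AE_lborel_singleton)+
      then show "AE \<theta> in lborel. indicator {-pi+s..<pi} \<theta> * f \<theta> + indicator {-pi..-pi+s} \<theta> * f \<theta>
          = indicator {-pi..pi} \<theta> * f \<theta>"
        by eventually_elim (use s in \<open>auto split: split_indicator\<close>)
    qed
    finally show ?thesis .
  qed
  define k where "k = \<lfloor>t / (2 * pi)\<rfloor>"
  define s where "s = t - 2 * pi * of_int k"
  have "of_int k \<le> t / (2 * pi)" "t / (2 * pi) < of_int k + 1"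
    unfolding k_def by linarith+
  then have s: "0 \<le> s" "s < 2 * pi"
    by (auto simp: s_def field_simps)
  have "f (\<theta> + t) = f (\<theta> + s)" for \<theta>
    using periodic_int_shift[of f "\<theta> + s" k] per by (simp add: s_def algebra_simps)
  then have "(\<integral>\<^sup>+\<theta>. f (\<theta> + t) \<partial>circ) = (\<integral>\<^sup>+\<theta>. f (\<theta> + s) \<partial>circ)"
    by simp
  also have "\<dots> = (\<integral>\<^sup>+\<theta>. f \<theta> \<partial>circ)"
    by (subst (1 2) circ) (auto simp: shift[OF s])
  finally show ?thesis .
qed

text \<open>A mean bounded by \<open>A\<close>. In contrast to an inequality for \<open>Lp_norm\<close>, this asserts that the mean is finite:
  \<open>Lp_norm\<close> vanishes for a function whose \<open>p\<close>-th power is not integrable.\<close>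

definition Lp_le :: "real \<Rightarrow> (real \<Rightarrow> complex) \<Rightarrow> real \<Rightarrow> bool" where
  "Lp_le p h A \<longleftrightarrow> h \<in> borel_measurable borel \<and> 0 \<le> A \<and>
     (\<integral>\<^sup>+\<theta>. norm (h \<theta>) powr p \<partial>circ) \<le> ennreal (A powr p)"

abbreviation on_circle :: "(complex \<Rightarrow> complex) \<Rightarrow> real \<Rightarrow> real \<Rightarrow> complex" where
  "on_circle f r \<equiv> (\<lambda>\<theta>. f (of_real r * cis \<theta>))"

lemma Lp_leD:
  assumes "Lp_le p h A"
  shows "h \<in> borel_measurable borel" "0 \<le> A" "(\<integral>\<^sup>+\<theta>. norm (h \<theta>) powr p \<partial>circ) \<le> ennreal (A powr p)"
  using assms by (auto simp: Lp_le_def)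

lemma Lp_norm_eq:
  assumes [measurable]: "h \<in> borel_measurable borel"
  shows "Lp_norm p h = enn2real (\<integral>\<^sup>+\<theta>. norm (h \<theta>) powr p \<partial>circ) powr (1 / p)"
proof -
  have "(LINT \<theta>:{-pi..pi}|lebesgue. norm (h \<theta>) powr p) = (LBINT \<theta>:{-pi..pi}. norm (h \<theta>) powr p)"
    unfolding set_lebesgue_integral_def by (subst integral_completion) auto
  then have "1 / (2 * pi) * (LINT \<theta>:{-pi..pi}|lebesgue. norm (h \<theta>) powr p)
      = (LINT \<theta>|circ. norm (h \<theta>) powr p)"
    by (subst integral_circ) auto
  also have "\<dots> = enn2real (\<integral>\<^sup>+\<theta>. norm (h \<theta>) powr p \<partial>circ)"
    by (subst integral_eq_nn_integral) auto
  finally show ?thesis by (simp add: Lp_norm_def)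
qed

lemma Lp_norm_le:
  assumes "Lp_le p h A" "1 \<le> p"
  shows "Lp_norm p h \<le> A"
proof -
  note h = Lp_leD[OF assms(1)]
  have "enn2real (\<integral>\<^sup>+\<theta>. norm (h \<theta>) powr p \<partial>circ) \<le> A powr p"
    using h(3) by (intro enn2real_leI) auto
  then have "Lp_norm p h \<le> (A powr p) powr (1 / p)"
    using assms(2) h(1) by (subst Lp_norm_eq) (auto intro!: powr_mono2)
  then show ?thesis using h(2) assms(2) by (simp add: powr_powr)
qed

lemma Lp_le_Lp_norm:
  assumes "Lp_le p h A" "1 \<le> p"
  shows "Lp_le p h (Lp_norm p h)"
proof -
  note h = Lp_leD[OF assms(1)]
  have "(\<integral>\<^sup>+\<theta>. norm (h \<theta>) powr p \<partial>circ) < top"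
    using h(3) by (rule le_less_trans) simp
  then have "(\<integral>\<^sup>+\<theta>. norm (h \<theta>) powr p \<partial>circ) = ennreal (Lp_norm p h powr p)"
    using assms(2) h(1) by (subst Lp_norm_eq) (auto simp: powr_powr)
  then show ?thesis using h(1) by (auto simp: Lp_le_def Lp_norm_def)
qed

lemma Lp_le_mono: "Lp_le p h A \<Longrightarrow> A \<le> B \<Longrightarrow> 1 \<le> p \<Longrightarrow> Lp_le p h B"
  unfolding Lp_le_def by (auto elim!: order_trans intro!: ennreal_leI simp: powr_mono2)

lemma Lp_le_AE_norm_mono:
  assumes "Lp_le p g A" "h \<in> borel_measurable borel" "AE \<theta> in circ. norm (h \<theta>) \<le> norm (g \<theta>)" "1 \<le> p"
  shows "Lp_le p h A"
proof -
  have "(\<integral>\<^sup>+\<theta>. norm (h \<theta>) powr p \<partial>circ) \<le> (\<integral>\<^sup>+\<theta>. norm (g \<theta>) powr p \<partial>circ)"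
    using assms(3,4) by (intro nn_integral_mono_AE) (auto elim!: eventually_mono intro!: ennreal_leI powr_mono2)
  then show ?thesis using assms by (auto simp: Lp_le_def)
qed

lemma Lp_le_cong_AE:
  assumes "Lp_le p g A" "h \<in> borel_measurable borel" "AE \<theta> in circ. h \<theta> = g \<theta>" "1 \<le> p"
  shows "Lp_le p h A"
  using assms by (intro Lp_le_AE_norm_mono[OF assms(1,2)]) (auto elim!: eventually_mono)

lemma Lp_le_bounded:
  assumes [measurable]: "h \<in> borel_measurable borel" and "\<And>\<theta>. \<theta> \<in> {-pi..pi} \<Longrightarrow> norm (h \<theta>) \<le> B" "0 \<le> B" "1 \<le> p"
  shows "Lp_le p h B"
proof -
  have "(\<integral>\<^sup>+\<theta>. norm (h \<theta>) powr p \<partial>circ) \<le> (\<integral>\<^sup>+\<theta>. ennreal (B powr p) \<partial>circ)"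
    using assms(2-) by (intro nn_integral_mono_AE) (auto simp: AE_circ_iff intro!: ennreal_leI powr_mono2)
  then show ?thesis using assms by (auto simp: Lp_le_def emeasure_circ_UNIV)
qed

lemma Lp_le_continuous:
  assumes "continuous_on UNIV h" "1 \<le> p"
  shows "Lp_le p h (Lp_norm p h)"
proof -
  have h: "h \<in> borel_measurable borel" using assms by (simp add: borel_measurable_continuous_onI)
  have "compact (h ` {-pi..pi})"
    using assms by (intro compact_continuous_image continuous_on_subset[OF assms(1)]) auto
  then obtain B where "0 < B" "\<And>\<theta>. \<theta> \<in> {-pi..pi} \<Longrightarrow> norm (h \<theta>) \<le> B"
    by (metis bounded_pos compact_imp_bounded imageI)
  then have "Lp_le p h B" using h assms by (intro Lp_le_bounded) auto
  then show ?thesis using assms by (intro Lp_le_Lp_norm)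
qed

text \<open>Fatou's lemma.\<close>

lemma Lp_le_LIMSEQ:
  assumes h: "\<And>n. Lp_le p (h n) (A n)" and A: "A \<longlonglongrightarrow> B" and p: "1 \<le> p"
    and g[measurable]: "g \<in> borel_measurable borel" and lim: "AE \<theta> in circ. (\<lambda>n. h n \<theta>) \<longlonglongrightarrow> g \<theta>"
  shows "Lp_le p g B"
proof -
  note [measurable] = Lp_leD(1)[OF h]
  have "(\<integral>\<^sup>+\<theta>. norm (g \<theta>) powr p \<partial>circ) = (\<integral>\<^sup>+\<theta>. liminf (\<lambda>n. ennreal (norm (h n \<theta>) powr p)) \<partial>circ)"
  proof (intro nn_integral_cong_AE)
    show "AE \<theta> in circ. ennreal (norm (g \<theta>) powr p) = liminf (\<lambda>n. ennreal (norm (h n \<theta>) powr p))"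
      using lim
    proof eventually_elim
      case (elim \<theta>)
      then have "(\<lambda>n. ennreal (norm (h n \<theta>) powr p)) \<longlonglongrightarrow> ennreal (norm (g \<theta>) powr p)"
        using p by (intro tendsto_ennrealI tendsto_powr2 tendsto_norm tendsto_const) auto
      then show ?case by (intro lim_imp_Liminf[symmetric]) auto
    qed
  qed
  also have "\<dots> \<le> liminf (\<lambda>n. \<integral>\<^sup>+\<theta>. ennreal (norm (h n \<theta>) powr p) \<partial>circ)"
    by (intro nn_integral_liminf) auto
  also have "\<dots> \<le> liminf (\<lambda>n. ennreal (A n powr p))"
    using Lp_leD(3)[OF h] by (intro Liminf_mono) auto
  also have "\<dots> = ennreal (B powr p)"
    using p A Lp_leD(2)[OF h] by (intro lim_imp_Liminf tendsto_ennrealI tendsto_powr2 tendsto_const) auto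
  finally have "(\<integral>\<^sup>+\<theta>. norm (g \<theta>) powr p \<partial>circ) \<le> ennreal (B powr p)" .
  moreover have "0 \<le> B" using A Lp_leD(2)[OF h] by (intro LIMSEQ_le_const) auto
  ultimately show ?thesis by (auto simp: Lp_le_def)
qed

text \<open>Minkowski's inequality is used with strictly positive weights. They are obtained by adding a small
  constant, which is removed by this lemma.\<close>

lemma Lp_le_epsilon:
  assumes "\<And>e. 0 < e \<Longrightarrow> Lp_le p h (A + e * c)" "1 \<le> p"
  shows "Lp_le p h A"
proof (rule Lp_le_LIMSEQ)
  show "Lp_le p h (A + inverse (real (Suc n)) * c)" for n by (intro assms) auto
  show "(\<lambda>n. A + inverse (real (Suc n)) * c) \<longlonglongrightarrow> A"
    using tendsto_add[OF tendsto_const tendsto_mult[OF LIMSEQ_inverse_real_of_nat tendsto_const], of A c] by simp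
qed (use assms(2) Lp_leD(1)[OF assms(1)[of 1]] in auto)

lemma Lp_le_set_integral:
  fixes F :: "real \<Rightarrow> 'b \<Rightarrow> complex" and w :: "'b \<Rightarrow> real"
  assumes p: "1 \<le> p" and N: "sigma_finite_measure N" and S[measurable]: "S \<in> sets N"
    and F[measurable]: "(\<lambda>(x, y). indicator S y *\<^sub>R F x y) \<in> borel_measurable (borel \<Otimes>\<^sub>M N)"
    and w: "(\<lambda>y. indicator S y * w y) \<in> borel_measurable N" "\<And>y. y \<in> S \<Longrightarrow> 0 < w y"
    and W: "(\<integral>\<^sup>+y. ennreal (indicator S y * w y) \<partial>N) \<le> ennreal W" "0 < W"
    and bound: "\<And>y. y \<in> S \<Longrightarrow> Lp_le p (\<lambda>x. F x y) (w y)"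
  shows "Lp_le p (\<lambda>x. LINT y:S|N. F x y) W"
proof -
  interpret sigma_finite_measure N by fact
  have "(\<integral>\<^sup>+x. norm (LINT y|N. indicator S y *\<^sub>R F x y) powr p \<partial>circ) \<le> ennreal (W powr p)"
  proof (rule integral_Minkowski[OF p _ N _ w(1)])
    show "sigma_finite_measure circ" by unfold_locales
    show "(\<integral>\<^sup>+x. norm (indicator S y *\<^sub>R F x y) powr p \<partial>circ) \<le> ennreal ((indicator S y * w y) powr p)" for y
      using bound[of y] p by (cases "y \<in> S") (auto simp: Lp_le_def)
    show "(\<integral>\<^sup>+y. ennreal (indicator S y * w y) \<partial>N) \<le> ennreal W" using W by simp
    show "indicator S y *\<^sub>R F x y = 0" if "indicator S y * w y = 0" for x y
      using that w(2)[of y] by (auto split: split_indicator)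
    show "0 \<le> indicator S y * w y" for y
      using w(2)[of y] by (auto split: split_indicator)
    show "(\<lambda>(x, y). indicator S y *\<^sub>R F x y) \<in> borel_measurable (circ \<Otimes>\<^sub>M N)"
      using F by (simp cong: measurable_cong_sets sets_pair_measure_cong)
  qed (use W in auto)
  moreover have "(\<lambda>x. LINT y|N. indicator S y *\<^sub>R F x y) \<in> borel_measurable borel"
    by measurable
  ultimately show ?thesis
    using W by (auto simp: Lp_le_def set_lebesgue_integral_def)
qed

text \<open>Minkowski's inequality for two functions is the one for integrals over a space with two points.\<close>

lemma Lp_le_add:
  assumes "Lp_le p f A" "Lp_le p g B" and p: "1 \<le> p"
  shows "Lp_le p (\<lambda>x. f x + g x) (A + B)"
proof (rule Lp_le_epsilon[where c = 2])
  fix e :: real assume e: "0 < e"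
  note [measurable] = Lp_leD(1)[OF assms(1)] Lp_leD(1)[OF assms(2)]
  define F where "F x y = (if y then f x else g x)" for x y
  \<comment> \<open>adding \<open>e\<close> keeps the weights positive when \<open>A\<close> or \<open>B\<close> vanishes\<close>
  define w where "w y = (if y then A + e else B + e)" for y
  have "Lp_le p (\<lambda>x. LINT y:UNIV|count_space UNIV. F x y) (A + B + e * 2)"
  proof (rule Lp_le_set_integral[OF p, where w = w])
    show "sigma_finite_measure (count_space (UNIV :: bool set))"
      by (intro sigma_finite_measure_count_space_finite) auto
    show "(\<lambda>(x, y). indicator UNIV y *\<^sub>R F x y) \<in> borel_measurable (borel \<Otimes>\<^sub>M count_space UNIV)"
      unfolding F_def by measurable
    show "Lp_le p (\<lambda>x. F x y) (w y)" for y
      using assms e by (cases y) (auto simp: F_def w_def elim!: Lp_le_mono)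
    show "0 < w y" for y
      using Lp_leD(2)[OF assms(1)] Lp_leD(2)[OF assms(2)] e by (auto simp: w_def)
    show "(\<integral>\<^sup>+y. ennreal (indicator UNIV y * w y) \<partial>count_space UNIV) \<le> ennreal (A + B + e * 2)"
      using Lp_leD(2)[OF assms(1)] Lp_leD(2)[OF assms(2)] e
      by (simp add: nn_integral_count_space_finite UNIV_bool w_def flip: ennreal_plus)
    show "0 < A + B + e * 2"
      using Lp_leD(2)[OF assms(1)] Lp_leD(2)[OF assms(2)] e by simp
  qed auto
  also have "(\<lambda>x. LINT y:UNIV|count_space UNIV. F x y) = (\<lambda>x. f x + g x)"
    by (auto simp: set_lebesgue_integral_def lebesgue_integral_count_space_finite UNIV_bool F_def)
  finally show "Lp_le p (\<lambda>x. f x + g x) (A + B + e * 2)" .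
qed fact

lemma Lp_le_cmult:
  assumes "Lp_le p f A" "1 \<le> p" "norm c \<le> C"
  shows "Lp_le p (\<lambda>x. c * f x) (C * A)"
proof -
  note [measurable] = Lp_leD(1)[OF assms(1)]
  have "(\<integral>\<^sup>+\<theta>. norm (c * f \<theta>) powr p \<partial>circ)
      = (\<integral>\<^sup>+\<theta>. ennreal (norm c powr p) * ennreal (norm (f \<theta>) powr p) \<partial>circ)"
    by (auto simp: norm_mult powr_mult ennreal_mult intro!: nn_integral_cong)
  also have "\<dots> = ennreal (norm c powr p) * (\<integral>\<^sup>+\<theta>. norm (f \<theta>) powr p \<partial>circ)"
    by (intro nn_integral_cmult) auto
  also have "\<dots> \<le> ennreal (C powr p) * ennreal (A powr p)"
    using assms by (intro mult_mono ennreal_leI powr_mono2 Lp_leD(3)[OF assms(1)]) auto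
  also have "\<dots> = ennreal ((C * A) powr p)"
    using Lp_leD(2)[OF assms(1)] order_trans[OF norm_ge_zero assms(3)] by (simp add: powr_mult ennreal_mult)
  finally show ?thesis
    using Lp_leD(2)[OF assms(1)] order_trans[OF norm_ge_zero assms(3)] by (auto simp: Lp_le_def)
qed

lemma Lp_le_diff:
  assumes "Lp_le p f A" "Lp_le p g B" and p: "1 \<le> p"
  shows "Lp_le p (\<lambda>x. f x - g x) (A + B)"
  using Lp_le_add[OF assms(1) Lp_le_cmult[OF assms(2) p, of "-1" 1] p] by simp

lemma Lp_le_translate:
  assumes h: "Lp_le p h A" and per: "\<And>\<theta>. h (\<theta> + 2 * pi) = h \<theta>"
  shows "Lp_le p (\<lambda>\<theta>. h (\<theta> + t)) A"
proof -
  note [measurable] = Lp_leD(1)[OF h]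
  have "(\<integral>\<^sup>+\<theta>. norm (h (\<theta> + t)) powr p \<partial>circ) = (\<integral>\<^sup>+\<theta>. norm (h \<theta>) powr p \<partial>circ)"
    by (rule nn_integral_circ_translate[of "\<lambda>\<theta>. ennreal (norm (h \<theta>) powr p)"]) (auto simp: per)
  then show ?thesis using h by (simp add: Lp_le_def)
qed

text \<open>Jensen's inequality for the constant weight \<open>1\<close>.\<close>

lemma Lp_le_imp_L1:
  assumes h: "Lp_le p h A" and p: "1 \<le> p"
  shows "Lp_le 1 h A"
proof -
  note [measurable] = Lp_leD(1)[OF h]
  have "(\<integral>\<^sup>+\<theta>. norm (h \<theta>) * 1 \<partial>circ) \<le> ennreal ((A powr p) powr (1 / p) * 1 powr (1 - 1 / p))"
    using Lp_leD[OF h] by (intro weighted_Jensen[OF p]) (auto simp: emeasure_circ_UNIV)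
  then show ?thesis
    using Lp_leD[OF h] p by (auto simp: Lp_le_def powr_powr)
qed

section \<open>Poisson and Cauchy formulas on circles\<close>

lemma integral_circ_continuous:
  fixes F :: "real \<Rightarrow> complex"
  assumes "continuous_on UNIV F"
  shows "integral\<^sup>L circ F = integral {-pi..pi} F / (2 * pi)" and "integrable circ F"
proof -
  have F: "F \<in> borel_measurable borel" using assms by (simp add: borel_measurable_continuous_onI)
  have int: "set_integrable lborel {-pi..pi} F"
    using assms by (intro borel_integrable_atLeastAtMost') (auto intro: continuous_on_subset)
  then show "integral\<^sup>L circ F = integral {-pi..pi} F / (2 * pi)"
    using F by (simp add: integral_circ set_borel_integral_eq_integral scaleR_conv_of_real)
  show "integrable circ F" using int F by (simp add: integrable_circ_iff)
qed

text \<open>The circle path runs over \<open>{0..2 * pi}\<close> and \<open>circ\<close> over \<open>{-pi..pi}\<close>; the half \<open>{pi..2 * pi}\<close> is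
  moved by a period.\<close>

lemma integral_circ_circlepath:
  assumes f: "(f has_contour_integral I) (circlepath 0 1)" and cont: "continuous_on UNIV (\<lambda>t. f (cis t))"
  shows "(LINT t|circ. f (cis t) * cis t) = I / (2 * pi * \<i>)"
proof -
  define F where "F t = f (cis t) * cis t" for t
  have F: "continuous_on UNIV F" unfolding F_def by (intro continuous_intros cont)
  have F_int: "F integrable_on {a..b}" for a b
    by (intro integrable_continuous_interval continuous_on_subset[OF F]) auto
  have per: "F (t + 2 * pi) = F t" for t
    by (simp add: F_def cis_mult[symmetric])
  have "((\<lambda>t. f (0 + of_real 1 * cis t) * of_real 1 * \<i> * cis t) has_integral I) {0..2*pi}"
    using f unfolding circlepath_def by (subst (asm) has_contour_integral_part_circlepath_iff) auto
  also have "(\<lambda>t. f (0 + of_real 1 * cis t) * of_real 1 * \<i> * cis t) = (\<lambda>t. \<i> * F t)"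
    by (auto simp: F_def)
  finally have I: "I = \<i> * integral {0..2*pi} F"
    using F_int[of 0 "2*pi"] by (metis has_integral_mult_right has_integral_unique integrable_integral)
  have "integral {0..2*pi} F = integral {0..pi} F + integral {pi..2*pi} F"
    using F_int by (intro Henstock_Kurzweil_Integration.integral_combine[symmetric]) auto
  also have "integral {pi..2*pi} F = integral {-pi..0} F"
  proof -
    have "(F has_integral integral {pi..2*pi} F) (cbox pi (2*pi))"
      using F_int by (simp add: integrable_integral)
    from has_integral_affinity[OF this, of 1 "2*pi"]
    have "((\<lambda>t. F (t + 2 * pi)) has_integral integral {pi..2*pi} F) ((\<lambda>x. x - 2*pi) ` {pi..2*pi})"
      by simp
    also have "(\<lambda>x. x - 2*pi) ` {pi..2*pi} = {-pi..0}"
    proof (intro equalityI subsetI)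
      fix t assume "t \<in> {-pi..0}"
      then show "t \<in> (\<lambda>x. x - 2*pi) ` {pi..2*pi}" by (intro image_eqI[of _ _ "t + 2 * pi"]) auto
    qed auto
    finally show ?thesis by (simp add: per integral_unique)
  qed
  also have "integral {0..pi} F + integral {-pi..0} F = integral {-pi..pi} F"
    using F_int Henstock_Kurzweil_Integration.integral_combine[of "-pi" 0 pi F] by (simp add: add.commute)
  finally have "integral {0..2*pi} F = integral {-pi..pi} F" .
  then have "integral\<^sup>L circ F = I / (2 * pi * \<i>)"
    using I integral_circ_continuous(1)[OF F] by simp
  then show ?thesis unfolding F_def .
qed

lemma continuous_on_circle:
  assumes "continuous_on (cball 0 1) g"
  shows "continuous_on UNIV (\<lambda>t. g (cis (c + t)))"
  by (intro continuous_on_compose2[OF assms] continuous_intros) auto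

lemma cis_neq_real:
  assumes "0 \<le> r" "r < 1"
  shows "cis t \<noteq> of_real r"
  using assms norm_cis[of t] by (metis abs_of_nonneg norm_of_real less_irrefl)

lemma Cauchy_formula_circ:
  assumes cont: "continuous_on (cball 0 1) g" and hol: "g holomorphic_on ball 0 1" and w: "norm w < 1"
  shows "(LINT t|circ. g (cis t) / (cis t - w) * cis t) = g w"
proof -
  have [simp]: "cis t \<noteq> w" for t using w by auto
  have "continuous_on UNIV (\<lambda>t. g (cis t) / (cis t - w))"
    using continuous_on_circle[OF cont, of 0] by (intro continuous_intros) auto
  then show ?thesis
    using integral_circ_circlepath[OF Cauchy_integral_circlepath[OF cont hol, of w]] w by simp
qed

lemma Cauchy_derivative_circ:
  assumes cont: "continuous_on (cball 0 1) g" and hol: "g holomorphic_on ball 0 1" and w: "norm w < 1"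
  shows "(LINT t|circ. g (cis t) / (cis t - w)\<^sup>2 * cis t) = deriv g w"
proof -
  have [simp]: "cis t \<noteq> w" for t using w by auto
  have "continuous_on UNIV (\<lambda>t. g (cis t) / (cis t - w)\<^sup>2)"
    using continuous_on_circle[OF cont, of 0] by (intro continuous_intros) auto
  moreover have "((\<lambda>u. g u / (u - w)\<^sup>2) has_contour_integral (2 * pi * \<i> * deriv g w)) (circlepath 0 1)"
  proof -
    note * = Cauchy_derivative_integral_circlepath[OF cont hol, of w]
    have "deriv g w = 1 / (2 * of_real pi * \<i>) * contour_integral (circlepath 0 1) (\<lambda>u. g u / (u - w)\<^sup>2)"
      using w by (intro DERIV_imp_deriv *(2)) auto
    then have "contour_integral (circlepath 0 1) (\<lambda>u. g u / (u - w)\<^sup>2) = 2 * pi * \<i> * deriv g w"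
      by simp
    then show ?thesis
      using has_contour_integral_integral[OF *(1)] w by simp
  qed
  ultimately show ?thesis
    using integral_circ_circlepath[of "\<lambda>u. g u / (u - w)\<^sup>2"] by simp
qed

definition Poisson_kernel :: "real \<Rightarrow> real \<Rightarrow> real" where
  "Poisson_kernel r t = (1 - r\<^sup>2) / (norm (cis t - of_real r))\<^sup>2"

lemma Poisson_kernel_pos: "0 \<le> r \<Longrightarrow> r < 1 \<Longrightarrow> 0 < Poisson_kernel r t"
  using cis_neq_real[of r t] by (simp add: Poisson_kernel_def power_less_one_iff)

lemma continuous_on_Poisson_kernel: "0 \<le> r \<Longrightarrow> r < 1 \<Longrightarrow> continuous_on A (Poisson_kernel r)"
  unfolding Poisson_kernel_def using cis_neq_real[of r] by (intro continuous_intros) auto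

lemma measurable_Poisson_kernel [measurable]: "Poisson_kernel r \<in> borel_measurable borel"
proof -
  have [measurable]: "cis \<in> borel_measurable borel"
    by (intro borel_measurable_continuous_onI continuous_intros)
  show ?thesis unfolding Poisson_kernel_def by measurable
qed

text \<open>Cauchy's formula at the point \<open>r\<close> for the rotated function multiplied by \<open>(1 - r\<^sup>2) / (1 - r * u)\<close>. This
  factor equals \<open>1\<close> at \<open>u = r\<close>, and on the unit circle \<open>1 - r * u\<close> is \<open>u\<close> times the conjugate of \<open>u - r\<close>, so
  that the product of the two denominators is the squared modulus in the Poisson kernel.\<close>

lemma Poisson_formula:
  assumes cont: "continuous_on (cball 0 1) g" and hol: "g holomorphic_on ball 0 1" and r: "0 \<le> r" "r < 1"
  shows "(LINT t|circ. Poisson_kernel r t *\<^sub>R g (cis (\<theta> + t))) = g (of_real r * cis \<theta>)"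
proof -
  define k where "k u = g (cis \<theta> * u) * (1 - r\<^sup>2) / (1 - of_real r * u)" for u
  have nz: "1 - of_real r * u \<noteq> 0" if "u \<in> cball 0 1" for u :: complex
  proof -
    have "norm (of_real r * u) < 1" using that r mult_left_le[of "norm u" r] by (simp add: norm_mult)
    then show ?thesis by (metis norm_one less_irrefl right_minus_eq)
  qed
  have "continuous_on (cball 0 1) k" unfolding k_def
    using nz by (intro continuous_intros continuous_on_compose2[OF cont]) (auto simp: norm_mult)
  moreover have "k holomorphic_on ball 0 1" unfolding k_def
    using nz by (intro holomorphic_intros holomorphic_on_compose_gen[OF _ hol, unfolded o_def]) (auto simp: norm_mult)
  ultimately have "(LINT t|circ. k (cis t) / (cis t - of_real r) * cis t) = k (of_real r)"
    using r by (intro Cauchy_formula_circ) auto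
  also have "(\<lambda>t. k (cis t) / (cis t - of_real r) * cis t) = (\<lambda>t. Poisson_kernel r t *\<^sub>R g (cis (\<theta> + t)))"
  proof
    fix t
    have "of_real ((norm (cis t - of_real r))\<^sup>2) = (cis t - of_real r) * cnj (cis t - of_real r)"
      by (rule complex_norm_square)
    also have "cnj (cis t - of_real r) = (1 - of_real r * cis t) / cis t"
    proof -
      have "cis (- t) = 1 / cis t" by (metis cis_inverse inverse_eq_divide)
      then show ?thesis by (simp add: cis_cnj diff_divide_distrib)
    qed
    finally have *: "complex_of_real ((norm (cis t - of_real r))\<^sup>2) = (cis t - of_real r) * ((1 - of_real r * cis t) / cis t)" .
    show "k (cis t) / (cis t - of_real r) * cis t = Poisson_kernel r t *\<^sub>R g (cis (\<theta> + t))"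
      unfolding Poisson_kernel_def k_def scaleR_conv_of_real of_real_divide *
      by (simp add: cis_mult field_simps)
  qed
  also have "k (of_real r) = g (of_real r * cis \<theta>)"
  proof -
    have "1 - complex_of_real r * of_real r \<noteq> 0" using nz[of "of_real r"] r by simp
    then show ?thesis by (simp add: k_def power2_eq_square mult.commute)
  qed
  finally show ?thesis .
qed

lemma nn_integral_Poisson_kernel:
  assumes "0 \<le> r" "r < 1"
  shows "(\<integral>\<^sup>+t. Poisson_kernel r t \<partial>circ) = 1"
proof -
  have "(LINT t|circ. complex_of_real (Poisson_kernel r t)) = 1"
    using Poisson_formula[of "\<lambda>_. 1" r 0] assms by (simp add: scaleR_conv_of_real)
  moreover have "(LINT t|circ. complex_of_real (Poisson_kernel r t)) = complex_of_real (LINT t|circ. Poisson_kernel r t)"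
    by (rule integral_complex_of_real)
  ultimately have *: "(LINT t|circ. Poisson_kernel r t) = 1" by (metis of_real_eq_1_iff)
  have "integrable circ (Poisson_kernel r)"
    using * not_integrable_integral_eq by fastforce
  then show ?thesis
    using * Poisson_kernel_pos[OF assms] by (subst nn_integral_eq_integral) (auto intro: less_imp_le)
qed

lemma measurable_circle [measurable (raw)]:
  assumes "continuous_on (cball 0 1) g" "h \<in> borel_measurable M"
  shows "(\<lambda>x. g (cis (h x))) \<in> borel_measurable M"
  using assms(2) borel_measurable_continuous_onI[OF continuous_on_circle[OF assms(1), of 0]]
  by (auto intro: measurable_compose)

text \<open>The values on the smaller circle are averages of translates of the boundary values against a
  probability density.\<close>

lemma Lp_le_circle_interior:
  assumes cont: "continuous_on (cball 0 1) g" and hol: "g holomorphic_on ball 0 1" and r: "0 \<le> r" "r < 1"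
    and A: "Lp_le p (\<lambda>\<theta>. g (cis \<theta>)) A" and p: "1 \<le> p"
  shows "Lp_le p (on_circle g r) A"
proof (rule Lp_le_epsilon[where c = 1])
  fix e :: real assume e: "0 < e"
  note [measurable] = measurable_circle[OF cont]
  have "Lp_le p (\<lambda>\<theta>. LINT t:UNIV|circ. Poisson_kernel r t *\<^sub>R g (cis (\<theta> + t))) (A + e)"
  proof (rule Lp_le_set_integral[OF p, where w = "\<lambda>t. Poisson_kernel r t * (A + e)"])
    show "(\<integral>\<^sup>+t. ennreal (indicator UNIV t * (Poisson_kernel r t * (A + e))) \<partial>circ) \<le> ennreal (A + e)"
      using e Lp_leD(2)[OF A] Poisson_kernel_pos[OF r]
      by (simp add: ennreal_mult less_imp_le nn_integral_multc nn_integral_Poisson_kernel[OF r])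
    show "Lp_le p (\<lambda>\<theta>. Poisson_kernel r t *\<^sub>R g (cis (\<theta> + t))) (Poisson_kernel r t * (A + e))" for t
      unfolding scaleR_conv_of_real
      using e Poisson_kernel_pos[OF r, of t]
      by (intro Lp_le_cmult Lp_le_translate[of _ "\<lambda>\<theta>. g (cis \<theta>)"] Lp_le_mono[OF A] p)
         (auto simp: cis_mult[symmetric])
    show "sigma_finite_measure circ" by unfold_locales
  qed (use Lp_leD(2)[OF A] e Poisson_kernel_pos[OF r] in auto)
  then show "Lp_le p (on_circle g r) (A + e * 1)"
    by (simp add: set_lebesgue_integral_def Poisson_formula[OF cont hol r])
qed fact

lemma derivative_kernel_formula:
  assumes cont: "continuous_on (cball 0 1) g" and hol: "g holomorphic_on ball 0 1" and r: "0 \<le> r" "r < 1"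
  shows "(LINT t|circ. (cis t / (cis t - of_real r)\<^sup>2) * g (cis (\<theta> + t))) = cis \<theta> * deriv g (of_real r * cis \<theta>)"
proof -
  define k where "k u = g (cis \<theta> * u)" for u
  have kc: "continuous_on (cball 0 1) k" unfolding k_def
    by (intro continuous_intros continuous_on_compose2[OF cont]) (auto simp: norm_mult)
  have kh: "k holomorphic_on ball 0 1" unfolding k_def
    by (intro holomorphic_intros holomorphic_on_compose_gen[OF _ hol, unfolded o_def]) (auto simp: norm_mult)
  have "(g has_field_derivative deriv g (cis \<theta> * of_real r)) (at (cis \<theta> * of_real r))"
    using r by (intro holomorphic_derivI[OF hol]) (auto simp: norm_mult)
  moreover have "((\<lambda>u. cis \<theta> * u) has_field_derivative cis \<theta>) (at (of_real r))"
    by (auto intro!: derivative_eq_intros)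
  ultimately have "(k has_field_derivative deriv g (cis \<theta> * of_real r) * cis \<theta>) (at (of_real r))"
    unfolding k_def by (rule DERIV_chain2)
  then have "deriv k (of_real r) = cis \<theta> * deriv g (of_real r * cis \<theta>)"
    by (simp add: DERIV_imp_deriv mult.commute)
  moreover have "(LINT t|circ. k (cis t) / (cis t - of_real r)\<^sup>2 * cis t) = deriv k (of_real r)"
    using r by (intro Cauchy_derivative_circ kc kh) auto
  ultimately show ?thesis
    by (simp add: k_def cis_mult mult.commute add.commute)
qed

text \<open>Up to a constant the modulus of the kernel of the derivative is the Poisson kernel, whose integral is
  known exactly.\<close>

lemma norm_derivative_kernel:
  assumes "0 \<le> r" "r < 1"
  shows "norm (cis t / (cis t - of_real r)\<^sup>2) = Poisson_kernel r t / (1 - r\<^sup>2)"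
proof -
  have "1 - r\<^sup>2 \<noteq> 0" using assms by (simp add: power2_eq_1_iff)
  then show ?thesis by (simp add: Poisson_kernel_def norm_divide norm_power)
qed

lemma measurable_derivative_kernel [measurable]:
  "(\<lambda>t. cis t / (cis t - of_real r)\<^sup>2) \<in> borel_measurable borel"
proof -
  have [measurable]: "cis \<in> borel_measurable borel"
    by (intro borel_measurable_continuous_onI continuous_intros)
  show ?thesis by measurable
qed

lemma Lp_le_circle_derivative:
  assumes cont: "continuous_on (cball 0 1) g" and hol: "g holomorphic_on ball 0 1" and r: "0 \<le> r" "r < 1"
    and A: "Lp_le p (\<lambda>\<theta>. g (cis \<theta>)) A" and p: "1 \<le> p"
  shows "Lp_le p (\<lambda>\<theta>. deriv g (of_real r * cis \<theta>)) (A / (1 - r))"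
proof (rule Lp_le_epsilon[where c = "1 / (1 - r)"])
  fix e :: real assume e: "0 < e"
  note [measurable] = measurable_circle[OF cont]
  have r2: "1 - r \<le> 1 - r\<^sup>2" using r by (simp add: power2_eq_square mult_left_le)
  then have r2': "0 < 1 - r\<^sup>2" using r by linarith
  define w where "w t = Poisson_kernel r t / (1 - r\<^sup>2) * (A + e)" for t
  have w: "0 < w t" for t
    using r2' Lp_leD(2)[OF A] e Poisson_kernel_pos[OF r] by (auto simp: w_def)
  have [measurable]: "w \<in> borel_measurable borel" unfolding w_def by measurable
  have "Lp_le p (\<lambda>\<theta>. LINT t:UNIV|circ. (cis t / (cis t - of_real r)\<^sup>2) * g (cis (\<theta> + t))) ((A + e) / (1 - r))"
  proof (rule Lp_le_set_integral[OF p, where w = w])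
    have "(\<integral>\<^sup>+t. ennreal (indicator UNIV t * w t) \<partial>circ) = (\<integral>\<^sup>+t. ennreal (Poisson_kernel r t) * ennreal ((A + e) / (1 - r\<^sup>2)) \<partial>circ)"
      unfolding w_def using Lp_leD(2)[OF A] e Poisson_kernel_pos[OF r] r2'
      by (intro nn_integral_cong) (simp add: less_imp_le flip: ennreal_mult)
    also have "\<dots> = ennreal ((A + e) / (1 - r\<^sup>2))"
      by (simp add: nn_integral_multc nn_integral_Poisson_kernel[OF r])
    also have "\<dots> \<le> ennreal ((A + e) / (1 - r))"
      using r r2 e Lp_leD(2)[OF A] by (intro ennreal_leI divide_left_mono) auto
    finally show "(\<integral>\<^sup>+t. ennreal (indicator UNIV t * w t) \<partial>circ) \<le> ennreal ((A + e) / (1 - r))" .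
    show "Lp_le p (\<lambda>\<theta>. (cis t / (cis t - of_real r)\<^sup>2) * g (cis (\<theta> + t))) (w t)" for t
      unfolding w_def
      using e by (intro Lp_le_cmult Lp_le_translate[of _ "\<lambda>\<theta>. g (cis \<theta>)"] Lp_le_mono[OF A] p)
         (auto simp: cis_mult[symmetric] norm_derivative_kernel[OF r])
    show "sigma_finite_measure circ" by unfold_locales
  qed (use Lp_leD(2)[OF A] e r w in auto)
  then have "Lp_le p (\<lambda>\<theta>. cis \<theta> * deriv g (of_real r * cis \<theta>)) ((A + e) / (1 - r))"
    by (simp only: set_lebesgue_integral_def indicator_UNIV scaleR_one derivative_kernel_formula[OF cont hol r])
  moreover have [measurable]: "cis \<in> borel_measurable borel"
    by (intro borel_measurable_continuous_onI continuous_intros)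
  then have "(\<lambda>\<theta>. cis (- \<theta>) * (cis \<theta> * deriv g (of_real r * cis \<theta>))) \<in> borel_measurable borel"
    using Lp_leD(1)[OF calculation] by measurable
  then have "(\<lambda>\<theta>. deriv g (of_real r * cis \<theta>)) \<in> borel_measurable borel"
    by (simp add: mult.assoc[symmetric] cis_mult)
  ultimately have "Lp_le p (\<lambda>\<theta>. deriv g (of_real r * cis \<theta>)) ((A + e) / (1 - r))"
    using p by (elim Lp_le_AE_norm_mono) (auto simp: norm_mult)
  then show "Lp_le p (\<lambda>\<theta>. deriv g (of_real r * cis \<theta>)) (A / (1 - r) + e * (1 / (1 - r)))"
    by (simp add: add_divide_distrib)
qed fact

lemma scaled_disc:
  assumes f: "f holomorphic_on ball 0 1" and R: "0 \<le> R" "R < 1"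
  shows "continuous_on (cball 0 1) (\<lambda>z. f (of_real R * z))" "(\<lambda>z. f (of_real R * z)) holomorphic_on ball 0 1"
proof -
  have *: "norm (of_real R * z) < 1" if "norm z \<le> 1" for z :: complex
    using R that mult_left_le[of "norm z" R] by (simp add: norm_mult)
  show "continuous_on (cball 0 1) (\<lambda>z. f (of_real R * z))"
    by (rule continuous_on_compose2[OF holomorphic_on_imp_continuous_on[OF f]])
       (use * in \<open>auto intro!: continuous_intros\<close>)
  show "(\<lambda>z. f (of_real R * z)) holomorphic_on ball 0 1"
    by (rule holomorphic_on_compose_gen[OF _ f, unfolded o_def])
       (use * in \<open>auto intro!: holomorphic_intros\<close>)
qed

lemma Lp_le_radius_mono:
  assumes f: "f holomorphic_on ball 0 1" and R: "0 \<le> r" "r \<le> R" "R < 1"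
    and A: "Lp_le p (on_circle f R) A" and p: "1 \<le> p"
  shows "Lp_le p (on_circle f r) A"
proof (cases "r = R")
  case False
  then have "r < R" "0 < R" using R by auto
  then have "Lp_le p (\<lambda>\<theta>. f (of_real R * (of_real (r / R) * cis \<theta>))) A"
    using R by (intro Lp_le_circle_interior[OF scaled_disc[OF f, of R] _ _ A p]) auto
  then show ?thesis using \<open>0 < R\<close> by (simp add: mult.assoc[symmetric])
qed (use A in simp)

text \<open>Cauchy's estimate in the mean.\<close>

lemma Lp_le_derivative:
  assumes f: "f holomorphic_on ball 0 1" and R: "0 \<le> r" "r < R" "R < 1"
    and A: "Lp_le p (on_circle f R) A" and p: "1 \<le> p"
  shows "Lp_le p (on_circle (deriv f) r) (A / (R - r))"
proof -
  have R0: "0 < R" using R by simp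
  have "deriv (\<lambda>z. f (of_real R * z)) (of_real (r / R) * cis \<theta>) = of_real R * deriv f (of_real r * cis \<theta>)" for \<theta>
  proof -
    have "(f has_field_derivative deriv f (of_real r * cis \<theta>)) (at (of_real R * (of_real (r / R) * cis \<theta>)))"
    proof -
      have "of_real R * (of_real (r / R) * cis \<theta>) = of_real r * cis \<theta>" using R0 by simp
      then show ?thesis
        using R holomorphic_derivI[OF f, of "of_real r * cis \<theta>"] by (simp only:) (simp add: norm_mult)
    qed
    moreover have "((\<lambda>u. of_real R * u) has_field_derivative of_real R) (at (of_real (r / R) * cis \<theta>))"
      by (auto intro!: derivative_eq_intros)
    ultimately have "((\<lambda>z. f (of_real R * z)) has_field_derivative deriv f (of_real r * cis \<theta>) * of_real R)
        (at (of_real (r / R) * cis \<theta>))"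
      by (rule DERIV_chain2)
    then show ?thesis by (simp add: DERIV_imp_deriv mult.commute)
  qed
  moreover have "Lp_le p (\<lambda>\<theta>. deriv (\<lambda>z. f (of_real R * z)) (of_real (r / R) * cis \<theta>)) (A / (1 - r / R))"
    using R R0 by (intro Lp_le_circle_derivative[OF scaled_disc[OF f, of R] _ _ A p]) auto
  ultimately have "Lp_le p (\<lambda>\<theta>. of_real R * deriv f (of_real r * cis \<theta>)) (A / (1 - r / R))" by simp
  then have "Lp_le p (\<lambda>\<theta>. of_real (1 / R) * (of_real R * deriv f (of_real r * cis \<theta>))) (1 / R * (A / (1 - r / R)))"
    using R0 by (intro Lp_le_cmult p) (auto simp: norm_divide)
  moreover have "1 / R * (A / (1 - r / R)) = A / (R - r)"
  proof -
    have "1 / R * (A / (1 - r / R)) = A / (R * (1 - r / R))" by simp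
    also have "R * (1 - r / R) = R - r" using R0 by (simp add: right_diff_distrib)
    finally show ?thesis .
  qed
  moreover have "of_real (1 / R) * (of_real R * z) = z" for z :: complex
    using R0 by simp
  ultimately show ?thesis by (simp only:)
qed

section \<open>Increments of a holomorphic function in the mean\<close>

text \<open>The integration is over the open interval because the weights of interest may be unbounded or
  meaningless at its end points.\<close>

lemma Lp_le_interval_integral:
  fixes F :: "real \<Rightarrow> real \<Rightarrow> complex"
  assumes p: "1 \<le> p" and ab: "a \<le> b"
    and F: "continuous_on (UNIV \<times> {a..b}) (\<lambda>(x, y). F x y)"
    and w: "(\<lambda>y. indicator {a<..<b} y * w y) \<in> borel_measurable borel" "\<And>y. y \<in> {a<..<b} \<Longrightarrow> 0 \<le> w y"
    and W: "(\<integral>\<^sup>+y. ennreal (indicator {a<..<b} y * w y) \<partial>lborel) \<le> ennreal W" "0 \<le> W"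
    and bound: "\<And>y. y \<in> {a<..<b} \<Longrightarrow> Lp_le p (\<lambda>x. F x y) (w y)"
  shows "Lp_le p (\<lambda>x. integral {a..b} (F x)) W"
proof (rule Lp_le_epsilon[where c = "b - a + 1"])
  fix e :: real assume e: "0 < e"
  note [measurable] = w(1)
  have Fx: "continuous_on {a..b} (F x)" for x
    by (rule continuous_on_compose2[OF F, of _ "\<lambda>y. (x, y)", simplified]) (auto intro!: continuous_intros)
  have eq: "indicator {a<..<b} y * (w y + e) = indicator {a<..<b} y * w y + e * indicator {a<..<b} y" for y
    by (simp split: split_indicator)
  have [measurable]: "(\<lambda>y. indicator {a<..<b} y * (w y + e)) \<in> borel_measurable borel"
    unfolding eq by measurable
  have "Lp_le p (\<lambda>x. LBINT y:{a<..<b}. F x y) (W + e * (b - a + 1))"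
  proof (rule Lp_le_set_integral[OF p, where w = "\<lambda>y. w y + e"])
    have "(\<integral>\<^sup>+y. ennreal (indicator {a<..<b} y * (w y + e)) \<partial>lborel)
        = (\<integral>\<^sup>+y. ennreal (indicator {a<..<b} y * w y) + ennreal e * indicator {a<..<b} y \<partial>lborel)"
      unfolding eq using w(2) e
      by (intro nn_integral_cong) (auto simp: ennreal_plus split: split_indicator)
    also have "\<dots> = (\<integral>\<^sup>+y. ennreal (indicator {a<..<b} y * w y) \<partial>lborel) + ennreal e * ennreal (b - a)"
      using ab by (subst nn_integral_add) (auto simp: nn_integral_cmult)
    also have "\<dots> \<le> ennreal W + ennreal e * ennreal (b - a + 1)"
      by (intro add_mono mult_left_mono ennreal_leI W(1)) auto
    also have "\<dots> = ennreal (W + e * (b - a + 1))"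
      using W(2) e ab by (simp add: ennreal_mult ennreal_plus)
    finally show "(\<integral>\<^sup>+y. ennreal (indicator {a<..<b} y * (w y + e)) \<partial>lborel) \<le> ennreal (W + e * (b - a + 1))" .
    show "Lp_le p (\<lambda>x. F x y) (w y + e)" if "y \<in> {a<..<b}" for y
      using bound[OF that] e p by (elim Lp_le_mono) auto
    have "continuous_on (UNIV \<times> {a<..<b}) (\<lambda>(x, y). F x y)"
      by (rule continuous_on_subset[OF F]) auto
    then have "(\<lambda>z. indicator (UNIV \<times> {a<..<b}) z *\<^sub>R (\<lambda>(x, y). F x y) z) \<in> borel_measurable borel"
      by (intro borel_measurable_continuous_on_indicator borel_open open_Times) auto
    also have "(\<lambda>z. indicator (UNIV \<times> {a<..<b}) z *\<^sub>R (\<lambda>(x, y). F x y) z)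
        = (\<lambda>(x, y). indicator {a<..<b} y *\<^sub>R F x y)"
      by (auto simp: fun_eq_iff split: split_indicator)
    finally show "(\<lambda>(x, y). indicator {a<..<b} y *\<^sub>R F x y) \<in> borel_measurable (borel \<Otimes>\<^sub>M lborel)"
      by (simp add: borel_prod[symmetric] cong: measurable_cong_sets sets_pair_measure_cong)
    show "0 < w y + e" if "y \<in> {a<..<b}" for y using w(2)[OF that] e by simp
    show "0 < W + e * (b - a + 1)" using W e ab by (simp add: add_nonneg_pos)
    show "sigma_finite_measure (lborel :: real measure)" by unfold_locales
  qed auto
  moreover have "(LBINT y:{a<..<b}. F x y) = integral {a..b} (F x)" for x
  proof -
    have "set_integrable lborel {a<..<b} (F x)"
      by (rule set_integrable_subset[OF borel_integrable_atLeastAtMost'[OF Fx]]) auto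
    then show ?thesis
      by (simp add: set_borel_integral_eq_integral integral_open_interval_real)
  qed
  ultimately show "Lp_le p (\<lambda>x. integral {a..b} (F x)) (W + e * (b - a + 1))" by simp
qed fact

lemma nn_integral_const_interval:
  assumes "a \<le> b" "0 \<le> (c::real)"
  shows "(\<integral>\<^sup>+y. ennreal (indicator {a<..<b} y * c) \<partial>lborel) = ennreal (c * (b - a))"
proof -
  have "(\<integral>\<^sup>+y. ennreal (indicator {a<..<b} y * c) \<partial>lborel) = (\<integral>\<^sup>+y. ennreal c * indicator {a<..<b} y \<partial>lborel)"
    by (intro nn_integral_cong) (auto split: split_indicator)
  then show ?thesis using assms by (simp add: nn_integral_cmult ennreal_mult)
qed

lemma norm_scaled_cis_less:
  assumes "0 \<le> s" "s < 1" "0 \<le> y" "y \<le> 1"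
  shows "norm (of_real y * (of_real s * cis x)) < 1"
  using assms mult_left_le_one_le[of s y] by (simp add: norm_mult)

lemma continuous_on_holomorphic_circle:
  assumes "f holomorphic_on ball 0 1" "0 \<le> s" "s < 1"
  shows "continuous_on UNIV (on_circle f s)"
  by (rule continuous_on_compose2[OF holomorphic_on_imp_continuous_on[OF assms(1)]])
     (use assms in \<open>auto intro!: continuous_intros simp: norm_mult\<close>)

lemma measurable_holomorphic_circle:
  assumes "f holomorphic_on ball 0 1" "0 \<le> s" "s < 1"
  shows "(on_circle f s) \<in> borel_measurable borel"
  by (intro borel_measurable_continuous_onI continuous_on_holomorphic_circle[OF assms])

text \<open>With \<open>z = s * cis \<theta>\<close>, the difference is the integral of \<open>z * f' (y * z)\<close> over \<open>r \<le> y \<le> 1\<close>.\<close>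

lemma Lp_le_dilation_diff:
  assumes f: "f holomorphic_on ball 0 1" and p: "1 \<le> p" and r: "0 \<le> r" "r \<le> 1" and s: "0 \<le> s" "s < 1"
    and w: "(\<lambda>y. indicator {r<..<1} y * w y) \<in> borel_measurable borel"
    and W: "(\<integral>\<^sup>+y. ennreal (indicator {r<..<1} y * w y) \<partial>lborel) \<le> ennreal W" "0 \<le> W"
    and bound: "\<And>y. r < y \<Longrightarrow> y < 1 \<Longrightarrow> Lp_le p (\<lambda>\<theta>. deriv f (of_real y * (of_real s * cis \<theta>))) (w y)"
  shows "Lp_le p (\<lambda>\<theta>. f (of_real s * cis \<theta>) - f (of_real r * (of_real s * cis \<theta>))) W"
proof -
  define F where "F x y = (of_real s * cis x) * deriv f (of_real y * (of_real s * cis x))" for x y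
  have f': "deriv f holomorphic_on ball 0 1" by (intro holomorphic_deriv f) auto
  have in_disc: "of_real y * (of_real s * cis x) \<in> ball 0 1" if "y \<in> {r..1}" for x y
    using that r norm_scaled_cis_less[OF s, of y x] by simp
  have cont: "continuous_on (UNIV \<times> {r..1}) (\<lambda>(x, y). F x y)"
    unfolding F_def split_def
    by (intro continuous_intros continuous_on_compose2[OF holomorphic_on_imp_continuous_on[OF f']])
       (use in_disc in auto)
  have "integral {r..1} (F x) = f (of_real s * cis x) - f (of_real r * (of_real s * cis x))" for x
  proof (rule integral_unique)
    have "(F x has_integral f (of_real 1 * (of_real s * cis x)) - f (of_real r * (of_real s * cis x))) {r..1}"
    proof (intro fundamental_theorem_of_calculus r)
      fix y assume y: "y \<in> {r..1}"
      have "((\<lambda>u. u * (of_real s * cis x)) has_field_derivative (of_real s * cis x)) (at (of_real y))"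
        by (auto intro!: derivative_eq_intros)
      with holomorphic_derivI[OF f open_ball in_disc[OF y]]
      have "((\<lambda>u. f (u * (of_real s * cis x))) has_field_derivative
          deriv f (of_real y * (of_real s * cis x)) * (of_real s * cis x)) (at (of_real y))"
        by (rule DERIV_chain2)
      then have "((\<lambda>y. f (of_real y * (of_real s * cis x))) has_vector_derivative F x y) (at y)"
        using has_vector_derivative_real_field[of "\<lambda>u. f (u * (of_real s * cis x))"] by (simp add: F_def mult.commute)
      then show "((\<lambda>y. f (of_real y * (of_real s * cis x))) has_vector_derivative F x y) (at y within {r..1})"
        by (rule has_vector_derivative_at_within)
    qed
    then show "(F x has_integral f (of_real s * cis x) - f (of_real r * (of_real s * cis x))) {r..1}" by simp
  qed
  moreover have "Lp_le p (\<lambda>x. integral {r..1} (F x)) W"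
  proof (rule Lp_le_interval_integral[OF p r(2) cont w _ W])
    fix y assume y: "y \<in> {r<..<1}"
    show "Lp_le p (\<lambda>x. F x y) (w y)"
    proof (rule Lp_le_AE_norm_mono[OF bound _ _ p])
      have "continuous_on UNIV (\<lambda>x. F x y)"
        by (rule continuous_on_compose2[OF cont, of UNIV "\<lambda>x. (x, y)", simplified])
           (use y in \<open>auto intro!: continuous_intros\<close>)
      then show "(\<lambda>x. F x y) \<in> borel_measurable borel" by (rule borel_measurable_continuous_onI)
      show "AE x in circ. norm (F x y) \<le> norm (deriv f (of_real y * (of_real s * cis x)))"
        using s by (auto simp: F_def norm_mult mult_left_le_one_le)
    qed (use y in auto)
    show "0 \<le> w y" using bound[of y] y Lp_leD(2) by auto
  qed
  ultimately show ?thesis by simp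
qed

lemma Lp_le_dilation_diff_const:
  assumes f: "f holomorphic_on ball 0 1" and p: "1 \<le> p" and r: "0 \<le> r" "r \<le> 1" and s: "0 \<le> s" "s < 1"
    and B: "Lp_le p (on_circle (deriv f) s) B"
  shows "Lp_le p (\<lambda>\<theta>. f (of_real s * cis \<theta>) - f (of_real r * (of_real s * cis \<theta>))) (B * (1 - r))"
proof (rule Lp_le_dilation_diff[OF f p r s, where w = "\<lambda>_. B"])
  show "(\<integral>\<^sup>+y. ennreal (indicator {r<..<1} y * B) \<partial>lborel) \<le> ennreal (B * (1 - r))"
    using r Lp_leD(2)[OF B] by (subst nn_integral_const_interval) auto
  have f': "deriv f holomorphic_on ball 0 1" by (intro holomorphic_deriv f) auto
  show "Lp_le p (\<lambda>\<theta>. deriv f (of_real y * (of_real s * cis \<theta>))) B" if "r < y" "y < 1" for y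
    using Lp_le_radius_mono[OF f', of "y * s" s p B] that r s B p mult_left_le_one_le[of s y]
    by (simp add: mult.assoc)
qed (use r Lp_leD(2)[OF B] in auto)

text \<open>The remainder is the integral of \<open>z * (f' (y * z) - f' z)\<close> over \<open>r \<le> y \<le> 1\<close>, and the preceding bound for
  \<open>f'\<close> makes each of these functions of order \<open>1 - r\<close> in the mean.\<close>

lemma Lp_le_Taylor:
  assumes f: "f holomorphic_on ball 0 1" and p: "1 \<le> p" and r: "0 \<le> r" "r \<le> 1" and s: "0 \<le> s" "s < 1"
    and B: "Lp_le p (on_circle (deriv (deriv f)) s) B"
  shows "Lp_le p (\<lambda>\<theta>. f (of_real s * cis \<theta>) - f (of_real r * (of_real s * cis \<theta>))
      - of_real (1 - r) * (of_real s * cis \<theta>) * deriv f (of_real s * cis \<theta>)) (B * (1 - r)\<^sup>2)"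
proof -
  define F where "F x y = (of_real s * cis x) * (deriv f (of_real y * (of_real s * cis x)) - deriv f (of_real s * cis x))" for x y
  have f': "deriv f holomorphic_on ball 0 1" by (intro holomorphic_deriv f) auto
  have in_disc: "of_real y * (of_real s * cis x) \<in> ball 0 1" if "y \<in> {r..1}" for x y
    using that r norm_scaled_cis_less[OF s, of y x] by simp
  have cont: "continuous_on (UNIV \<times> {r..1}) (\<lambda>(x, y). F x y)"
    unfolding F_def split_def
    by (intro continuous_intros continuous_on_compose2[OF holomorphic_on_imp_continuous_on[OF f']])
       (use in_disc s in \<open>auto simp: norm_mult\<close>)
  have "integral {r..1} (F x) = f (of_real s * cis x) - f (of_real r * (of_real s * cis x))
      - of_real (1 - r) * (of_real s * cis x) * deriv f (of_real s * cis x)" for x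
  proof (rule integral_unique)
    define G where "G u = f (u * (of_real s * cis x)) - u * (of_real s * cis x) * deriv f (of_real s * cis x)" for u
    have "(F x has_integral G (of_real 1) - G (of_real r)) {r..1}"
    proof (intro fundamental_theorem_of_calculus r)
      fix y assume y: "y \<in> {r..1}"
      have "((\<lambda>u. u * (of_real s * cis x)) has_field_derivative (of_real s * cis x)) (at (of_real y))"
        by (auto intro!: derivative_eq_intros)
      with holomorphic_derivI[OF f open_ball in_disc[OF y]]
      have 1: "((\<lambda>u. f (u * (of_real s * cis x))) has_field_derivative
          deriv f (of_real y * (of_real s * cis x)) * (of_real s * cis x)) (at (of_real y))"
        by (rule DERIV_chain2)
      have 2: "((\<lambda>u. u * (of_real s * cis x) * deriv f (of_real s * cis x)) has_field_derivative
          (of_real s * cis x) * deriv f (of_real s * cis x)) (at (of_real y))"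
        by (auto intro!: derivative_eq_intros)
      have "(G has_field_derivative F x y) (at (of_real y))"
        using DERIV_diff[OF 1 2] unfolding G_def F_def by (simp add: algebra_simps)
      then have "((\<lambda>y. G (of_real y)) has_vector_derivative F x y) (at y)"
        using has_vector_derivative_real_field[of G] by simp
      then show "((\<lambda>y. G (of_real y)) has_vector_derivative F x y) (at y within {r..1})"
        by (rule has_vector_derivative_at_within)
    qed
    then show "(F x has_integral f (of_real s * cis x) - f (of_real r * (of_real s * cis x))
      - of_real (1 - r) * (of_real s * cis x) * deriv f (of_real s * cis x)) {r..1}"
      by (simp add: G_def algebra_simps)
  qed
  moreover have "Lp_le p (\<lambda>x. integral {r..1} (F x)) (B * (1 - r)\<^sup>2)"
  proof (rule Lp_le_interval_integral[OF p r(2) cont, where w = "\<lambda>_. B * (1 - r)"])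
    show "(\<integral>\<^sup>+y. ennreal (indicator {r<..<1} y * (B * (1 - r))) \<partial>lborel) \<le> ennreal (B * (1 - r)\<^sup>2)"
      using r Lp_leD(2)[OF B] by (subst nn_integral_const_interval) (auto simp: power2_eq_square mult.assoc)
    fix y assume y: "y \<in> {r<..<1}"
    have D: "Lp_le p (\<lambda>\<theta>. deriv f (of_real s * cis \<theta>) - deriv f (of_real y * (of_real s * cis \<theta>))) (B * (1 - y))"
      using y r by (intro Lp_le_dilation_diff_const[OF f' p _ _ s B]) auto
    have "Lp_le p (\<lambda>\<theta>. deriv f (of_real s * cis \<theta>) - deriv f (of_real y * (of_real s * cis \<theta>))) (B * (1 - r))"
      using y Lp_leD(2)[OF B] by (intro Lp_le_mono[OF D _ p] mult_left_mono) auto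
    then show "Lp_le p (\<lambda>x. F x y) (B * (1 - r))"
    proof (rule Lp_le_AE_norm_mono[OF _ _ _ p])
      have "continuous_on UNIV (\<lambda>x. F x y)"
        by (rule continuous_on_compose2[OF cont, of UNIV "\<lambda>x. (x, y)", simplified])
           (use y in \<open>auto intro!: continuous_intros\<close>)
      then show "(\<lambda>x. F x y) \<in> borel_measurable borel" by (rule borel_measurable_continuous_onI)
      show "AE x in circ. norm (F x y) \<le> norm (deriv f (of_real s * cis x) - deriv f (of_real y * (of_real s * cis x)))"
        using s by (auto simp: F_def norm_mult mult_left_le_one_le norm_minus_commute)
    qed
  qed (use r Lp_leD(2)[OF B] in auto)
  ultimately show ?thesis by simp
qed

text \<open>For \<open>t \<ge> 0\<close> integrate the derivative along the arc; a negative \<open>t\<close> is reduced to \<open>- t\<close> by a translation.\<close>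

lemma Lp_le_rotation_diff:
  assumes f: "f holomorphic_on ball 0 1" and p: "1 \<le> p" and s: "0 \<le> s" "s < 1"
    and B: "Lp_le p (on_circle (deriv f) s) B"
  shows "Lp_le p (\<lambda>\<theta>. f (of_real s * cis (\<theta> + t)) - f (of_real s * cis \<theta>)) (\<bar>t\<bar> * B)"
proof -
  have pos: "Lp_le p (\<lambda>\<theta>. f (of_real s * cis (\<theta> + t)) - f (of_real s * cis \<theta>)) (B * t)" if t: "0 \<le> t" for t
  proof -
    define F where "F x y = \<i> * (of_real s * cis (x + y)) * deriv f (of_real s * cis (x + y))" for x y
    have f': "deriv f holomorphic_on ball 0 1" by (intro holomorphic_deriv f) auto
    have in_disc: "of_real s * cis x \<in> ball 0 1" for x using s by (simp add: norm_mult)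
    have cont: "continuous_on UNIV (\<lambda>(x, y). F x y)"
      unfolding F_def split_def
      by (intro continuous_intros continuous_on_compose2[OF holomorphic_on_imp_continuous_on[OF f']])
         (use in_disc in auto)
    have "integral {0..t} (F x) = f (of_real s * cis (x + t)) - f (of_real s * cis x)" for x
    proof (rule integral_unique)
      have "(F x has_integral f (of_real s * cis (x + t)) - f (of_real s * cis (x + 0))) {0..t}"
      proof (intro fundamental_theorem_of_calculus t)
        fix y assume y: "y \<in> {0..t}"
        have "((\<lambda>y. of_real s * cis (x + y)) has_vector_derivative \<i> * (of_real s * cis (x + y))) (at y within {0..t})"
        proof -
          have "((\<lambda>u. of_real s * exp (\<i> * (of_real x + u))) has_field_derivative
              \<i> * (of_real s * exp (\<i> * (of_real x + of_real y)))) (at (of_real y))"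
            by (auto intro!: derivative_eq_intros)
          from has_vector_derivative_real_field[OF this] show ?thesis
            by (auto simp: cis_conv_exp intro: has_vector_derivative_at_within)
        qed
        then have "((f \<circ> (\<lambda>y. of_real s * cis (x + y))) has_vector_derivative
           (\<i> * (of_real s * cis (x + y))) * deriv f (of_real s * cis (x + y))) (at y within {0..t})"
          by (rule field_vector_diff_chain_within)
             (use holomorphic_derivI[OF f open_ball in_disc] in \<open>auto intro: has_field_derivative_at_within\<close>)
        then show "((\<lambda>y. f (of_real s * cis (x + y))) has_vector_derivative F x y) (at y within {0..t})"
          by (simp add: o_def F_def)
      qed
      then show "(F x has_integral f (of_real s * cis (x + t)) - f (of_real s * cis x)) {0..t}" by simp
    qed
    moreover have "Lp_le p (\<lambda>x. integral {0..t} (F x)) (B * t)"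
    proof (rule Lp_le_interval_integral[OF p t, where w = "\<lambda>_. B"])
      show "continuous_on (UNIV \<times> {0..t}) (\<lambda>(x, y). F x y)" by (rule continuous_on_subset[OF cont]) auto
      show "(\<integral>\<^sup>+y. ennreal (indicator {0<..<t} y * B) \<partial>lborel) \<le> ennreal (B * t)"
        using t Lp_leD(2)[OF B] by (subst nn_integral_const_interval) auto
      fix y assume y: "y \<in> {0<..<t}"
      have "Lp_le p (\<lambda>x. deriv f (of_real s * cis (x + y))) B"
        by (rule Lp_le_translate[OF B]) (simp add: cis_mult[symmetric])
      then show "Lp_le p (\<lambda>x. F x y) B"
      proof (rule Lp_le_AE_norm_mono[OF _ _ _ p])
        have "continuous_on UNIV (\<lambda>x. F x y)"
          by (rule continuous_on_compose2[OF cont, of UNIV "\<lambda>x. (x, y)", simplified])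
             (auto intro!: continuous_intros)
        then show "(\<lambda>x. F x y) \<in> borel_measurable borel" by (rule borel_measurable_continuous_onI)
        show "AE x in circ. norm (F x y) \<le> norm (deriv f (of_real s * cis (x + y)))"
          using s by (auto simp: F_def norm_mult mult_left_le_one_le)
      qed
    qed (use t Lp_leD(2)[OF B] in auto)
    ultimately show ?thesis by simp
  qed
  show ?thesis
  proof (cases "0 \<le> t")
    case True
    then show ?thesis using pos[OF True] by (simp add: mult.commute)
  next
    case False
    have "Lp_le p (\<lambda>\<theta>. (-1) * (f (of_real s * cis (\<theta> + (-t))) - f (of_real s * cis \<theta>))) (1 * (B * (-t)))"
      using False by (intro Lp_le_cmult pos p) auto
    then have "Lp_le p (\<lambda>\<theta>. (-1) * (f (of_real s * cis ((\<theta> + t) + (-t))) - f (of_real s * cis (\<theta> + t)))) (1 * (B * (-t)))"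
      by (rule Lp_le_translate) (simp add: cis_mult[symmetric] cis_divide[symmetric])
    then show ?thesis using False by (simp add: mult.commute)
  qed
qed

section \<open>Growth of the derivative against dilations\<close>

lemma Lp_le_integral_mean:
  assumes "g holomorphic_on ball 0 1" "0 \<le> r" "r < 1" "1 \<le> p"
  shows "Lp_le p (on_circle g r) (integral_mean p r g)"
  unfolding integral_mean_def
  by (intro Lp_le_continuous continuous_on_holomorphic_circle assms)

lemma integral_mean_le_iff:
  assumes "g holomorphic_on ball 0 1" "0 \<le> r" "r < 1" "1 \<le> p"
  shows "integral_mean p r g \<le> A \<longleftrightarrow> Lp_le p (on_circle g r) A"
  using Lp_le_mono[OF Lp_le_integral_mean[OF assms], of A] Lp_norm_le[of p "\<lambda>\<theta>. g (of_real r * cis \<theta>)" A] assms(4)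
  by (auto simp: integral_mean_def)

lemma integral_mean_nonneg: "0 \<le> integral_mean p r g"
  by (simp add: integral_mean_def Lp_norm_def)

lemma hardy_space_bounded_means:
  assumes "g \<in> hardy_space p" "0 \<le> r" "r < 1" "1 \<le> p"
  shows "Lp_le p (on_circle g r) (hardy_norm p g)"
proof -
  have "integral_mean p r g \<le> hardy_norm p g"
    using assms unfolding hardy_space_def hardy_norm_def by (intro cSUP_upper) auto
  then show ?thesis
    using assms by (subst integral_mean_le_iff[symmetric]) (auto simp: hardy_space_def)
qed

lemma hardy_spaceI:
  assumes "g holomorphic_on ball 0 1" "\<And>r. 0 \<le> r \<Longrightarrow> r < 1 \<Longrightarrow> Lp_le p (on_circle g r) A" "1 \<le> p"
  shows "g \<in> hardy_space p" "hardy_norm p g \<le> A"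
proof -
  have *: "integral_mean p r g \<le> A" if "r \<in> {0..<1}" for r
    using that assms by (subst integral_mean_le_iff) auto
  then show "g \<in> hardy_space p"
    using assms unfolding hardy_space_def by (auto intro!: bdd_aboveI[of _ A])
  show "hardy_norm p g \<le> A"
    using * unfolding hardy_norm_def by (intro cSUP_least) auto
qed

lemma hardy_norm_nonneg:
  assumes "g \<in> hardy_space p" "1 \<le> p"
  shows "0 \<le> hardy_norm p g"
  using Lp_leD(2)[OF hardy_space_bounded_means[OF assms(1), of 0]] assms by simp

lemma dilation_diff_hardy_space:
  assumes f: "f \<in> hardy_space p" and p: "1 \<le> p" and r: "0 \<le> r" "r \<le> 1"
  shows "(\<lambda>z. dilation r f z - f z) \<in> hardy_space p"
proof (rule hardy_spaceI(1)[OF _ _ p])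
  have hol: "f holomorphic_on ball 0 1" using f by (simp add: hardy_space_def)
  have "norm (of_real r * z) < 1" if "norm z < 1" for z :: complex
    using r that mult_left_le_one_le[of "norm z" r] by (simp add: norm_mult)
  then show "(\<lambda>z. dilation r f z - f z) holomorphic_on ball 0 1"
    unfolding dilation_def
    by (intro holomorphic_intros hol holomorphic_on_compose_gen[OF _ hol, unfolded o_def]) auto
  fix s :: real assume s: "0 \<le> s" "s < 1"
  then have "r * s < 1" "0 \<le> r * s" using r mult_left_le_one_le[of s r] by auto
  then have "Lp_le p (\<lambda>\<theta>. f (of_real (r * s) * cis \<theta>) - f (of_real s * cis \<theta>)) (hardy_norm p f + hardy_norm p f)"
    using s by (intro Lp_le_diff hardy_space_bounded_means f p) auto
  then show "Lp_le p (\<lambda>\<theta>. dilation r f (of_real s * cis \<theta>) - f (of_real s * cis \<theta>)) (hardy_norm p f + hardy_norm p f)"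
    by (simp add: dilation_def mult.assoc)
qed

lemma weightD:
  assumes "weight \<omega>"
  shows "\<And>s t. 0 \<le> s \<Longrightarrow> s \<le> t \<Longrightarrow> t < 1 \<Longrightarrow> \<omega> s \<le> \<omega> t" "\<And>t. 0 \<le> t \<Longrightarrow> t < 1 \<Longrightarrow> 0 \<le> \<omega> t"
  using assms by (auto simp: weight_def mono_on_def)

text \<open>In terms of the distance \<open>t = 1 - r\<close> to the boundary the Landau symbol becomes an inequality between real
  numbers, without absolute values because both sides are nonnegative.\<close>

lemma bigo_at_left_1_iff:
  fixes M \<nu> :: "real \<Rightarrow> real"
  assumes "\<And>r. 0 \<le> r \<Longrightarrow> r < 1 \<Longrightarrow> 0 \<le> M r" and "\<And>t. 0 < t \<Longrightarrow> t < 1 \<Longrightarrow> 0 \<le> \<nu> t"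
  shows "M \<in> O[at_left 1](\<lambda>r. \<nu> (1 - r)) \<longleftrightarrow>
    (\<exists>K>0. \<exists>t0. 0 < t0 \<and> t0 < 1 \<and> (\<forall>t. 0 < t \<and> t < t0 \<longrightarrow> M (1 - t) \<le> K * \<nu> t))"
proof
  assume "M \<in> O[at_left 1](\<lambda>r. \<nu> (1 - r))"
  then obtain K where K: "0 < K" "\<forall>\<^sub>F r in at_left 1. norm (M r) \<le> K * norm (\<nu> (1 - r))"
    by (elim landau_o.bigE)
  then obtain b where b: "b < 1" "\<And>r. b < r \<Longrightarrow> r < 1 \<Longrightarrow> norm (M r) \<le> K * norm (\<nu> (1 - r))"
    by (auto simp: eventually_at_left_field)
  define t0 where "t0 = min (1/2) (1 - b)"
  have "M (1 - t) \<le> K * \<nu> t" if "0 < t" "t < t0" for t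
    using b(2)[of "1 - t"] that assms(1)[of "1 - t"] assms(2)[of t] by (auto simp: t0_def)
  moreover have "0 < t0" "t0 < 1" using b by (auto simp: t0_def)
  ultimately show "\<exists>K>0. \<exists>t0. 0 < t0 \<and> t0 < 1 \<and> (\<forall>t. 0 < t \<and> t < t0 \<longrightarrow> M (1 - t) \<le> K * \<nu> t)"
    using K(1) by blast
next
  assume "\<exists>K>0. \<exists>t0. 0 < t0 \<and> t0 < 1 \<and> (\<forall>t. 0 < t \<and> t < t0 \<longrightarrow> M (1 - t) \<le> K * \<nu> t)"
  then obtain K t0 where K: "0 < K" "0 < t0" "t0 < 1" "\<And>t. 0 < t \<Longrightarrow> t < t0 \<Longrightarrow> M (1 - t) \<le> K * \<nu> t"
    by blast
  have "norm (M r) \<le> K * norm (\<nu> (1 - r))" if "1 - t0 < r" "r < 1" for r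
    using K(4)[of "1 - r"] K(1-3) assms(1)[of r] assms(2)[of "1 - r"] that by auto
  moreover have "\<forall>\<^sub>F r in at_left 1. 1 - t0 < r \<and> r < (1::real)"
    using K by (auto simp: eventually_at_left_field intro!: exI[of _ "1 - t0"])
  ultimately have "\<forall>\<^sub>F r in at_left 1. norm (M r) \<le> K * norm (\<nu> (1 - r))"
    by (auto elim: eventually_mono)
  then show "M \<in> O[at_left 1](\<lambda>r. \<nu> (1 - r))" by (rule bigoI)
qed

text \<open>The Dini condition in the variable \<open>y = 1 - t\<close> of the radial integration.\<close>

lemma Dini_integral_bound:
  assumes dini: "dini_weight \<omega>"
  obtains C where "\<And>t. 0 < t \<Longrightarrow> t < 1 \<Longrightarrow>
      (\<lambda>y. indicator {1-t<..<1} y * (\<omega> (1 - y) / (1 - y))) \<in> borel_measurable borel \<and>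
      (\<integral>\<^sup>+y. ennreal (indicator {1-t<..<1} y * (\<omega> (1 - y) / (1 - y))) \<partial>lborel) \<le> ennreal (C * \<omega> t) \<and> 0 \<le> C * \<omega> t"
proof -
  from dini obtain C where w: "weight \<omega>" and int: "set_integrable lborel {0<..<1} (\<lambda>t. \<omega> t / t)"
    and C: "\<And>t. t \<in> {0<..<1} \<Longrightarrow> (LBINT s:{0<..<t}. \<omega> s / s) \<le> C * \<omega> t"
    unfolding dini_weight_def by blast
  show thesis
  proof (rule that)
    fix t :: real assume t: "0 < t" "t < 1"
    have int_t: "set_integrable lborel {0<..<t} (\<lambda>t. \<omega> t / t)"
      using t by (intro set_integrable_subset[OF int]) auto
    define g where "g s = indicator {0<..<t} s * (\<omega> s / s)" for s
    have g0: "0 \<le> g s" for s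
      using weightD(2)[OF w, of s] t by (auto simp: g_def split: split_indicator)
    have "g = (\<lambda>s. indicator {0<..<t} s *\<^sub>R (\<omega> s / s))" by (simp add: g_def fun_eq_iff)
    then have g_int: "integrable lborel g" using int_t unfolding set_integrable_def by simp
    then have [measurable]: "g \<in> borel_measurable borel" by (simp add: borel_measurable_integrable)
    have eq: "indicator {1-t<..<1} y * (\<omega> (1 - y) / (1 - y)) = g (1 - y)" for y
      by (auto simp: g_def split: split_indicator)
    have "(\<integral>\<^sup>+y. ennreal (g (1 - y)) \<partial>lborel) = (\<integral>\<^sup>+y. ennreal (g y) \<partial>lborel)"
      using nn_integral_real_affine[of "\<lambda>y. ennreal (g y)" "-1" 1] by simp
    also have "\<dots> = ennreal (LBINT s:{0<..<t}. \<omega> s / s)"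
    proof -
      have "(LBINT s:{0<..<t}. \<omega> s / s) = integral\<^sup>L lborel g"
        unfolding set_lebesgue_integral_def by (intro Bochner_Integration.integral_cong) (auto simp: g_def)
      then show ?thesis using nn_integral_eq_integral[OF g_int] g0 by simp
    qed
    also have "\<dots> \<le> ennreal (C * \<omega> t)" using C[of t] t by (intro ennreal_leI) auto
    finally have "(\<integral>\<^sup>+y. ennreal (g (1 - y)) \<partial>lborel) \<le> ennreal (C * \<omega> t)" .
    moreover have "0 \<le> (LBINT s:{0<..<t}. \<omega> s / s)"
      using g0 by (auto simp: set_lebesgue_integral_def g_def intro!: Bochner_Integration.integral_nonneg)
    then have "0 \<le> C * \<omega> t" using C[of t] t by auto
    ultimately show "(\<lambda>y. indicator {1-t<..<1} y * (\<omega> (1 - y) / (1 - y))) \<in> borel_measurable borel \<and>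
      (\<integral>\<^sup>+y. ennreal (indicator {1-t<..<1} y * (\<omega> (1 - y) / (1 - y))) \<partial>lborel) \<le> ennreal (C * \<omega> t) \<and> 0 \<le> C * \<omega> t"
      unfolding eq by simp
  qed
qed

lemma derivative_growth_imp_dilation_bound:
  assumes dini: "dini_weight \<omega>" and p: "1 \<le> p" and f: "f holomorphic_on ball 0 1"
    and K: "0 \<le> K" "t0 < 1"
    and growth: "\<And>t. 0 < t \<Longrightarrow> t < t0 \<Longrightarrow> Lp_le p (on_circle (deriv f) (1 - t)) (K * (\<omega> t / t))"
  obtains K' where "0 < K'" "\<And>t s. 0 < t \<Longrightarrow> t < t0 \<Longrightarrow> 0 \<le> s \<Longrightarrow> s < 1 \<Longrightarrow>
      Lp_le p (\<lambda>\<theta>. f (of_real (1 - t) * (of_real s * cis \<theta>)) - f (of_real s * cis \<theta>)) (K' * \<omega> t)"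
proof -
  obtain C where C: "\<And>t. 0 < t \<Longrightarrow> t < 1 \<Longrightarrow>
      (\<lambda>y. indicator {1-t<..<1} y * (\<omega> (1 - y) / (1 - y))) \<in> borel_measurable borel \<and>
      (\<integral>\<^sup>+y. ennreal (indicator {1-t<..<1} y * (\<omega> (1 - y) / (1 - y))) \<partial>lborel) \<le> ennreal (C * \<omega> t) \<and> 0 \<le> C * \<omega> t"
    using Dini_integral_bound[OF dini] by blast
  have w: "weight \<omega>" using dini by (simp add: dini_weight_def)
  have f': "deriv f holomorphic_on ball 0 1" by (intro holomorphic_deriv f) auto
  show thesis
  proof (rule that[of "\<bar>K * C\<bar> + 1"])
    fix t s :: real assume t: "0 < t" "t < t0" and s: "0 \<le> s" "s < 1"
    then have t1: "t < 1" using K by simp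
    note Ct = C[OF t(1) t1]
    have eq: "indicator {1-t<..<1} y * (K * (\<omega> (1 - y) / (1 - y))) = K * (indicator {1-t<..<1} y * (\<omega> (1 - y) / (1 - y)))" for y
      by simp
    have "Lp_le p (\<lambda>\<theta>. f (of_real s * cis \<theta>) - f (of_real (1 - t) * (of_real s * cis \<theta>))) (K * (C * \<omega> t))"
    proof (rule Lp_le_dilation_diff[OF f p _ _ s])
      show "(\<lambda>y. indicator {1-t<..<1} y * (K * (\<omega> (1 - y) / (1 - y)))) \<in> borel_measurable borel"
        unfolding eq by (intro borel_measurable_times borel_measurable_const conjunct1[OF Ct])
      have "(\<integral>\<^sup>+y. ennreal (indicator {1-t<..<1} y * (K * (\<omega> (1 - y) / (1 - y)))) \<partial>lborel)
          = (\<integral>\<^sup>+y. ennreal K * ennreal (indicator {1-t<..<1} y * (\<omega> (1 - y) / (1 - y))) \<partial>lborel)"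
        unfolding eq by (intro nn_integral_cong ennreal_mult'[OF K(1)])
      also have "\<dots> = ennreal K * (\<integral>\<^sup>+y. ennreal (indicator {1-t<..<1} y * (\<omega> (1 - y) / (1 - y))) \<partial>lborel)"
        using Ct by (intro nn_integral_cmult) auto
      also have "\<dots> \<le> ennreal K * ennreal (C * \<omega> t)" using Ct by (intro mult_left_mono) auto
      also have "\<dots> = ennreal (K * (C * \<omega> t))" using K by (simp add: ennreal_mult')
      finally show "(\<integral>\<^sup>+y. ennreal (indicator {1-t<..<1} y * (K * (\<omega> (1 - y) / (1 - y)))) \<partial>lborel) \<le> ennreal (K * (C * \<omega> t))" .
      show "0 \<le> K * (C * \<omega> t)" using K Ct by simp
      show "Lp_le p (\<lambda>\<theta>. deriv f (of_real y * (of_real s * cis \<theta>))) (K * (\<omega> (1 - y) / (1 - y)))"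
        if y: "1 - t < y" "y < 1" for y
      proof -
        have "Lp_le p (on_circle (deriv f) y) (K * (\<omega> (1 - y) / (1 - y)))"
          using growth[of "1 - y"] y t by simp
        then have "Lp_le p (on_circle (deriv f) (y * s)) (K * (\<omega> (1 - y) / (1 - y)))"
          using y s t1 by (intro Lp_le_radius_mono[OF f', of "y * s" y] p) (auto simp: mult_left_le)
        then show ?thesis by (simp add: mult.assoc)
      qed
    qed (use t t1 in auto)
    then have "Lp_le p (\<lambda>\<theta>. (-1) * (f (of_real s * cis \<theta>) - f (of_real (1 - t) * (of_real s * cis \<theta>)))) (1 * (K * (C * \<omega> t)))"
      by (rule Lp_le_cmult) (auto simp: p)
    moreover have "K * (C * \<omega> t) \<le> (\<bar>K * C\<bar> + 1) * \<omega> t"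
      unfolding mult.assoc[symmetric] using weightD(2)[OF w, of t] t t1 by (intro mult_right_mono) auto
    ultimately show "Lp_le p (\<lambda>\<theta>. f (of_real (1 - t) * (of_real s * cis \<theta>)) - f (of_real s * cis \<theta>)) ((\<bar>K * C\<bar> + 1) * \<omega> t)"
      using p by (auto elim: Lp_le_mono)
  qed auto
qed

text \<open>Let \<open>\<phi> t = t * M (1 - t) f'\<close>. Taylor's formula with step \<open>\<delta>\<close> at radius \<open>1 - t \<ge> 1 / 2\<close> and Cauchy's estimate
  for \<open>f''\<close> between the radii \<open>1 - t\<close> and \<open>1 - t / 2\<close> give
  \<open>\<phi> t \<le> (2 * t / \<delta>) * (K * \<omega> \<delta>) + (8 * \<delta> / t) * \<phi> (t / 2)\<close>. With \<open>\<delta> = t / 16\<close> the last coefficient is \<open>1 / 2\<close>,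
  and the iterated inequality sums to \<open>64 * K * \<omega> t\<close> because \<open>\<omega>\<close> is nondecreasing. The a priori bound
  \<open>\<phi> t \<le> 2 * B\<close>, with \<open>B\<close> the Hardy norm, makes the remainder after \<open>n\<close> steps at most \<open>2 * B / 2 ^ n\<close>.\<close>

lemma dilation_bound_imp_derivative_growth:
  assumes w: "weight \<omega>" and p: "1 \<le> p" and f: "f \<in> hardy_space p"
    and K: "0 \<le> K" "t0 \<le> 1 / 2"
    and dil: "\<And>t s. 0 < t \<Longrightarrow> t < t0 \<Longrightarrow> 0 \<le> s \<Longrightarrow> s < 1 \<Longrightarrow>
      Lp_le p (\<lambda>\<theta>. f (of_real (1 - t) * (of_real s * cis \<theta>)) - f (of_real s * cis \<theta>)) (K * \<omega> t)"
    and t: "0 < t" "t < t0"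
  shows "Lp_le p (on_circle (deriv f) (1 - t)) (64 * K * (\<omega> t / t))"
proof -
  have hol: "f holomorphic_on ball 0 1" using f by (simp add: hardy_space_def)
  have f': "deriv f holomorphic_on ball 0 1" by (intro holomorphic_deriv hol) auto
  define B where "B = hardy_norm p f"
  have B: "0 \<le> B" using hardy_norm_nonneg[OF f p] by (simp add: B_def)
  have iterate: "Lp_le p (on_circle (deriv f) (1 - t)) ((64 * K * \<omega> t + 2 * B / 2 ^ n) / t)"
    if "0 < t" "t < t0" for n t
    using that
  proof (induction n arbitrary: t)
    case 0
    have "0 \<le> K * \<omega> t" using K weightD(2)[OF w, of t] 0 by simp
    have "Lp_le p (on_circle (deriv f) (1 - t)) (B / ((1 - t / 2) - (1 - t)))"
      using 0 K by (intro Lp_le_derivative[OF hol] hardy_space_bounded_means[OF f, folded B_def] p) auto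
    then have "Lp_le p (on_circle (deriv f) (1 - t)) (2 * B / t)"
      using 0 by (simp add: field_simps)
    then show ?case
      using \<open>0 \<le> K * \<omega> t\<close> 0 p by (elim Lp_le_mono) (auto intro!: divide_right_mono)
  next
    case (Suc n)
    \<comment> \<open>the bound for \<open>M (1 - t / 2) f'\<close> from the induction hypothesis\<close>
    define \<Phi> where "\<Phi> = (64 * K * \<omega> (t / 2) + 2 * B / 2 ^ n) / (t / 2)"
    define \<delta> where "\<delta> = t / 16"
    have \<Phi>: "Lp_le p (on_circle (deriv f) (1 - t / 2)) \<Phi>"
      unfolding \<Phi>_def using Suc by (intro Suc.IH) auto
    have "Lp_le p (on_circle (deriv (deriv f)) (1 - t)) (\<Phi> / ((1 - t / 2) - (1 - t)))"
      using Suc.prems K by (intro Lp_le_derivative[OF f' _ _ _ \<Phi>] p) auto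
    then have f2: "Lp_le p (on_circle (deriv (deriv f)) (1 - t)) (\<Phi> / (t / 2))"
      by simp
    have T: "Lp_le p (\<lambda>\<theta>. f (of_real (1 - t) * cis \<theta>) - f (of_real (1 - \<delta>) * (of_real (1 - t) * cis \<theta>))
        - of_real (1 - (1 - \<delta>)) * (of_real (1 - t) * cis \<theta>) * deriv f (of_real (1 - t) * cis \<theta>))
        (\<Phi> / (t / 2) * (1 - (1 - \<delta>))\<^sup>2)"
      using Suc.prems K by (intro Lp_le_Taylor[OF hol p _ _ _ _ f2]) (auto simp: \<delta>_def)
    have D: "Lp_le p (\<lambda>\<theta>. f (of_real (1 - \<delta>) * (of_real (1 - t) * cis \<theta>)) - f (of_real (1 - t) * cis \<theta>)) (K * \<omega> \<delta>)"
      using Suc.prems K by (intro dil) (auto simp: \<delta>_def)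
    have main: "Lp_le p (\<lambda>\<theta>. of_real \<delta> * (of_real (1 - t) * cis \<theta>) * deriv f (of_real (1 - t) * cis \<theta>))
        (K * \<omega> \<delta> + \<Phi> / (t / 2) * \<delta>\<^sup>2)"
      using Lp_le_cmult[OF Lp_le_add[OF D T p] p, of "-1" 1] by (simp add: algebra_simps)
    have "Lp_le p (\<lambda>\<theta>. of_real (2 / \<delta>) * (of_real \<delta> * (of_real (1 - t) * cis \<theta>) * deriv f (of_real (1 - t) * cis \<theta>)))
        (2 / \<delta> * (K * \<omega> \<delta> + \<Phi> / (t / 2) * \<delta>\<^sup>2))"
      using Suc.prems by (intro Lp_le_cmult[OF main p]) (auto simp: \<delta>_def norm_divide)
    then have "Lp_le p (on_circle (deriv f) (1 - t)) (2 / \<delta> * (K * \<omega> \<delta> + \<Phi> / (t / 2) * \<delta>\<^sup>2))"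
    proof (rule Lp_le_AE_norm_mono[OF _ _ _ p])
      show "(on_circle (deriv f) (1 - t)) \<in> borel_measurable borel"
        using Suc.prems K by (intro measurable_holomorphic_circle[OF f']) auto
      have "norm (deriv f (of_real (1 - t) * cis \<theta>))
          \<le> 2 * (1 - t) * norm (deriv f (of_real (1 - t) * cis \<theta>))" for \<theta>
        using Suc.prems K mult_right_mono[of 1 "2 * (1 - t)" "norm (deriv f (of_real (1 - t) * cis \<theta>))"] by simp
      also have "2 * (1 - t) * norm (deriv f (of_real (1 - t) * cis \<theta>))
          = norm (of_real (2 / \<delta>) * (of_real \<delta> * (of_real (1 - t) * cis \<theta>) * deriv f (of_real (1 - t) * cis \<theta>)))" for \<theta>
        using Suc.prems K unfolding norm_mult norm_of_real norm_cis by (auto simp: \<delta>_def)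
      finally show "AE \<theta> in circ. norm (deriv f (of_real (1 - t) * cis \<theta>))
          \<le> norm (of_real (2 / \<delta>) * (of_real \<delta> * (of_real (1 - t) * cis \<theta>) * deriv f (of_real (1 - t) * cis \<theta>)))"
        by simp
    qed
    moreover have "2 / \<delta> * (K * \<omega> \<delta> + \<Phi> / (t / 2) * \<delta>\<^sup>2) = (32 * K * \<omega> \<delta>  + 32 * K * \<omega> (t / 2) + 2 * B / 2 ^ Suc n) / t"
      using Suc.prems by (simp add: \<delta>_def \<Phi>_def field_simps power2_eq_square)
    moreover have "\<dots> \<le> (64 * K * \<omega> t + 2 * B / 2 ^ Suc n) / t"
    proof -
      have "K * \<omega> \<delta> \<le> K * \<omega> t" "K * \<omega> (t / 2) \<le> K * \<omega> t"
        using Suc.prems K by (auto simp: \<delta>_def intro!: mult_left_mono weightD(1)[OF w])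
      then show ?thesis using Suc.prems by (intro divide_right_mono) auto
    qed
    ultimately show ?case using Lp_le_mono p by metis
  qed
  show ?thesis
  proof (rule Lp_le_LIMSEQ[OF iterate[OF t]])
    have "(\<lambda>n. (64 * K * \<omega> t + 2 * B * (1 / 2) ^ n) / t) \<longlonglongrightarrow> (64 * K * \<omega> t + 2 * B * 0) / t"
      using t by (intro tendsto_intros LIMSEQ_realpow_zero) auto
    then show "(\<lambda>n. (64 * K * \<omega> t + 2 * B / 2 ^ n) / t) \<longlonglongrightarrow> 64 * K * (\<omega> t / t)"
      by (simp add: power_one_over)
    show "(on_circle (deriv f) (1 - t)) \<in> borel_measurable borel"
      using t K by (intro measurable_holomorphic_circle[OF f']) auto
  qed (use p in auto)
qed

section \<open>Factorization of Hardy functions\<close>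

lemma holomorphic_divide_out_zero:
  assumes F: "F holomorphic_on S" and S: "open S" "connected S" and a: "a \<in> S" "F a = 0"
    and nonconst: "\<not> F constant_on S"
  obtains G n where "0 < n" "G holomorphic_on S" "\<And>w. w \<in> S \<Longrightarrow> F w = (w - a) ^ n * G w" "G a \<noteq> 0"
proof -
  obtain g r n where g: "0 < n" "0 < r" "ball a r \<subseteq> S" "g holomorphic_on ball a r"
      "\<And>w. w \<in> ball a r \<Longrightarrow> F w = (w - a) ^ n * g w" "\<And>w. w \<in> ball a r \<Longrightarrow> g w \<noteq> 0"
    using holomorphic_factor_zero_nonconstant[OF F S a nonconst] by metis
  define G where "G w = (if w = a then g a else F w / (w - a) ^ n)" for w
  have G_eq: "G w = g w" if "w \<in> ball a r" for w
    using g(5)[OF that] by (auto simp: G_def)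
  show thesis
  proof (rule that[OF g(1)])
    have "G holomorphic_on (S - {a}) \<union> ball a r"
    proof (intro holomorphic_on_Un)
      have "(\<lambda>w. F w / (w - a) ^ n) holomorphic_on S - {a}"
        by (intro holomorphic_intros holomorphic_on_subset[OF F]) auto
      then show "G holomorphic_on S - {a}"
        by (rule holomorphic_transform) (auto simp: G_def)
      show "G holomorphic_on ball a r"
        by (rule holomorphic_transform[OF g(4)]) (auto simp: G_eq)
    qed (use S in auto)
    moreover have "(S - {a}) \<union> ball a r = S" using g(2,3) a by auto
    ultimately show "G holomorphic_on S" by simp
    show "F w = (w - a) ^ n * G w" if "w \<in> S" for w
      using a g(1) by (auto simp: G_def)
    show "G a \<noteq> 0" using g(2) g(6)[of a] by (simp add: G_def)
  qed
qed

text \<open>Hence \<open>w - a\<close> is dominated by \<open>1 - cnj a * w\<close> in the closed disc, with equality on the unit circle.\<close>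

lemma Blaschke_factor_identity:
  fixes a w :: complex
  shows "(norm (1 - cnj a * w))\<^sup>2 - (norm (w - a))\<^sup>2 = (1 - (norm w)\<^sup>2) * (1 - (norm a)\<^sup>2)"
  unfolding cmod_power2 by (simp add: power2_eq_square algebra_simps)

text \<open>Each zero \<open>a\<close> in the disc is exchanged for the factor \<open>1 - cnj a * w\<close>, which does not vanish there.\<close>

lemma zero_free_majorant:
  assumes "F holomorphic_on ball 0 R" "1 < R" "finite {z \<in> ball 0 1. F z = 0}" "\<exists>z\<in>ball 0 R. F z \<noteq> 0"
  shows "\<exists>K. K holomorphic_on ball 0 R \<and> (\<forall>z\<in>ball 0 1. K z \<noteq> 0) \<and>
    (\<forall>z\<in>sphere 0 1. norm (K z) = norm (F z)) \<and> (\<forall>z\<in>cball 0 1. norm (F z) \<le> norm (K z))"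
  using assms
proof (induction "card {z \<in> ball 0 1. F z = 0}" arbitrary: F)
  case 0
  then show ?case by (intro exI[of _ F]) auto
next
  case (Suc m)
  have "{z \<in> ball 0 1. F z = 0} \<noteq> {}" using Suc.hyps(2) by (metis card.empty nat.distinct(1))
  then obtain a where a: "norm a < 1" "F a = 0" by auto
  have aR: "a \<in> ball 0 R" using a Suc.prems by simp
  have "\<not> F constant_on ball 0 R"
    using Suc.prems(4) a aR by (metis constant_on_def)
  then obtain G n where G: "0 < n" "G holomorphic_on ball 0 R"
      "\<And>w. w \<in> ball 0 R \<Longrightarrow> F w = (w - a) ^ n * G w" "G a \<noteq> 0"
    using holomorphic_divide_out_zero[OF Suc.prems(1) open_ball connected_ball aR a(2)] by metis
  have zeros: "{z \<in> ball 0 1. G z = 0} = {z \<in> ball 0 1. F z = 0} - {a}"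
    using G Suc.prems(2) by auto
  have "m = card {z \<in> ball 0 1. G z = 0}"
    unfolding zeros using Suc.hyps(2) Suc.prems(3) a by (subst card_Diff_singleton) auto
  moreover have "finite {z \<in> ball 0 1. G z = 0}" unfolding zeros using Suc.prems by simp
  moreover have "\<exists>z\<in>ball 0 R. G z \<noteq> 0" using G(4) aR by blast
  ultimately obtain K where K: "K holomorphic_on ball 0 R" "\<And>z. z \<in> ball 0 1 \<Longrightarrow> K z \<noteq> 0"
      "\<And>z. z \<in> sphere 0 1 \<Longrightarrow> norm (K z) = norm (G z)" "\<And>z. z \<in> cball 0 1 \<Longrightarrow> norm (G z) \<le> norm (K z)"
    using Suc.hyps(1)[OF _ G(2) Suc.prems(2)] by blast
  have a2: "0 < 1 - (norm a)\<^sup>2" using a by (simp add: power_less_one_iff)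
  have sphere_eq: "norm (w - a) = norm (1 - cnj a * w)" if "w \<in> sphere 0 1" for w
    using Blaschke_factor_identity[of a w] that by (simp add: power2_eq_iff_nonneg)
  have le: "norm (w - a) \<le> norm (1 - cnj a * w)" if "w \<in> cball 0 1" for w
  proof -
    have "0 \<le> (1 - (norm w)\<^sup>2) * (1 - (norm a)\<^sup>2)"
      using that a by (intro mult_nonneg_nonneg) (auto simp: power_le_one_iff)
    then have "(norm (w - a))\<^sup>2 \<le> (norm (1 - cnj a * w))\<^sup>2"
      using Blaschke_factor_identity[of a w] by linarith
    then show ?thesis by (rule power2_le_imp_le) simp
  qed
  show ?case
  proof (intro exI[of _ "\<lambda>w. (1 - cnj a * w) ^ n * K w"] conjI ballI)
    show "(\<lambda>w. (1 - cnj a * w) ^ n * K w) holomorphic_on ball 0 R"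
      by (intro holomorphic_intros K)
    show "(1 - cnj a * z) ^ n * K z \<noteq> 0" if z: "z \<in> ball 0 1" for z
    proof -
      have "norm (cnj a * z) < 1"
        using z a mult_left_le_one_le[of "norm z" "norm a"] by (simp add: norm_mult)
      then have "1 - cnj a * z \<noteq> 0" by (metis norm_one less_irrefl right_minus_eq)
      then show ?thesis using K(2)[OF z] by simp
    qed
    show "norm ((1 - cnj a * z) ^ n * K z) = norm (F z)" if z: "z \<in> sphere 0 1" for z
      using K(3)[OF z] sphere_eq[OF z] G(3)[of z] z Suc.prems(2) by (simp add: norm_mult norm_power)
    show "norm (F z) \<le> norm ((1 - cnj a * z) ^ n * K z)" if z: "z \<in> cball 0 1" for z
      using K(4)[OF z] le[OF z] G(3)[of z] z Suc.prems(2)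
      by (auto simp: norm_mult norm_power intro!: mult_mono power_mono)
  qed
qed

lemma Lp_le_2_of_square:
  assumes h: "Lp_le 1 h A" and g: "g \<in> borel_measurable borel" and le: "\<And>\<theta>. (norm (g \<theta>))\<^sup>2 \<le> norm (h \<theta>)"
  shows "Lp_le 2 g (sqrt A)"
proof -
  have "(\<integral>\<^sup>+\<theta>. norm (g \<theta>) powr 2 \<partial>circ) \<le> (\<integral>\<^sup>+\<theta>. norm (h \<theta>) powr 1 \<partial>circ)"
    using le by (intro nn_integral_mono ennreal_leI) simp
  also have "\<dots> \<le> ennreal (A powr 1)" by (rule Lp_leD(3)[OF h])
  also have "A powr 1 = (sqrt A) powr 2" using Lp_leD(2)[OF h] by simp
  finally show ?thesis using g Lp_leD(2)[OF h] by (auto simp: Lp_le_def)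
qed

text \<open>The zero-free majorant \<open>K\<close> of the dilated function has a holomorphic square root \<open>g\<close>, and the second factor is
  \<open>F / g\<close>. Both squared moduli are at most \<open>norm K\<close>. On the unit circle \<open>norm K\<close> is the modulus of the given
  function, which bounds its means on all smaller circles.\<close>

lemma Riesz_factorization_dilated:
  assumes f: "f holomorphic_on ball 0 1" and nz: "\<exists>z\<in>ball 0 1. f z \<noteq> 0" and r: "0 < r" "r < 1"
    and A: "Lp_le 1 (on_circle f r) A"
  shows "\<exists>g k. (g holomorphic_on ball 0 1 \<and> (\<forall>s. 0 \<le> s \<and> s < 1 \<longrightarrow> Lp_le 2 (on_circle g s) (sqrt A))) \<and>
    (k holomorphic_on ball 0 1 \<and> (\<forall>s. 0 \<le> s \<and> s < 1 \<longrightarrow> Lp_le 2 (on_circle k s) (sqrt A))) \<and>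
    (\<forall>z\<in>ball 0 1. f (of_real r * z) = g z * k z)"
proof -
  define F where "F z = f (of_real r * z)" for z
  have F: "F holomorphic_on ball 0 (1 / r)" unfolding F_def
    by (rule holomorphic_on_compose_gen[OF _ f, unfolded o_def])
       (use r in \<open>auto intro!: holomorphic_intros simp: norm_mult field_simps\<close>)
  have R: "1 < 1 / r" using r by simp
  have nzF: "\<exists>z\<in>ball 0 (1 / r). F z \<noteq> 0"
  proof -
    obtain z where "z \<in> ball 0 1" "f z \<noteq> 0" using nz by blast
    then show ?thesis using r
      by (intro bexI[of _ "z / of_real r"]) (auto simp: F_def norm_divide field_simps)
  qed
  have fin: "finite {z \<in> ball 0 1. F z = 0}"
  proof (cases "F constant_on ball 0 (1 / r)")
    case True
    then obtain c where c: "\<And>z. z \<in> ball 0 (1 / r) \<Longrightarrow> F z = c" by (auto simp: constant_on_def)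
    then have "c \<noteq> 0" using nzF by auto
    then have "{z \<in> ball 0 1. F z = 0} = {}" using c R by force
    then show ?thesis by (metis finite.emptyI)
  next
    case False
    have "finite {z \<in> cball 0 1. F z = 0}"
      using R by (intro holomorphic_compact_finite_zeros[OF F _ _ _ _ False]) auto
    then show ?thesis by (rule rev_finite_subset) auto
  qed
  obtain K where K: "K holomorphic_on ball 0 (1 / r)" "\<And>z. z \<in> ball 0 1 \<Longrightarrow> K z \<noteq> 0"
      "\<And>z. z \<in> sphere 0 1 \<Longrightarrow> norm (K z) = norm (F z)" "\<And>z. z \<in> cball 0 1 \<Longrightarrow> norm (F z) \<le> norm (K z)"
    using zero_free_majorant[OF F R fin nzF] by blast
  have sub: "cball 0 1 \<subseteq> ball (0::complex) (1 / r)" using R by auto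
  have K1: "K holomorphic_on ball 0 1" by (rule holomorphic_on_subset[OF K(1)]) (use sub in auto)
  have F1: "F holomorphic_on ball 0 1" by (rule holomorphic_on_subset[OF F]) (use sub in auto)
  have Kc: "continuous_on (cball 0 1) K"
    by (rule continuous_on_subset[OF holomorphic_on_imp_continuous_on[OF K(1)] sub])
  have KA: "Lp_le 1 (\<lambda>\<theta>. K (cis \<theta>)) A"
    using A K(3) borel_measurable_continuous_onI[OF continuous_on_circle[OF Kc, of 0]]
    by (intro Lp_le_AE_norm_mono[OF A]) (auto simp: F_def)
  have KsA: "Lp_le 1 (\<lambda>\<theta>. K (of_real s * cis \<theta>)) A" if "0 \<le> s" "s < 1" for s
    using that by (intro Lp_le_circle_interior[OF Kc K1 _ _ KA]) auto
  have "simply_connected (ball (0::complex) 1)" by (intro convex_imp_simply_connected convex_ball)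
  then obtain g where g: "g holomorphic_on ball 0 1" "\<And>z. z \<in> ball 0 1 \<Longrightarrow> K z = (g z)\<^sup>2"
    using K1 K(2) unfolding simply_connected_eq_holomorphic_sqrt[OF open_ball] by blast
  have g0: "g z \<noteq> 0" if "z \<in> ball 0 1" for z using g(2)[OF that] K(2)[OF that] by auto
  define k where "k z = F z / g z" for z
  have k: "k holomorphic_on ball 0 1" unfolding k_def using g0 by (intro holomorphic_intros F1 g) auto
  have in_disc: "of_real s * cis \<theta> \<in> ball 0 1" if "0 \<le> s" "s < 1" for s \<theta>
    using that by (simp add: norm_mult)
  have norm_g: "(norm (g z))\<^sup>2 = norm (K z)" if "z \<in> ball 0 1" for z
    using g(2)[OF that] by (simp add: norm_power)
  have norm_k: "(norm (k z))\<^sup>2 \<le> norm (K z)" if "z \<in> ball 0 1" for z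
  proof -
    have "norm (F z) * norm (F z) \<le> norm (K z) * norm (K z)"
      using K(4)[of z] that by (intro mult_mono) auto
    then have "(norm (F z))\<^sup>2 / norm (K z) \<le> norm (K z)"
      using K(2)[OF that] by (simp add: power2_eq_square divide_le_eq)
    then show ?thesis using norm_g[OF that] by (simp add: k_def norm_divide power_divide)
  qed
  show ?thesis
  proof (rule exI[of _ g], rule exI[of _ k], intro conjI allI impI ballI g k)
    fix s :: real assume s: "0 \<le> s \<and> s < 1"
    then have "(norm (g (of_real s * cis \<theta>)))\<^sup>2 \<le> norm (K (of_real s * cis \<theta>))"
      and "(norm (k (of_real s * cis \<theta>)))\<^sup>2 \<le> norm (K (of_real s * cis \<theta>))" for \<theta>
      using norm_g[OF in_disc[of s \<theta>]] norm_k[OF in_disc[of s \<theta>]] by auto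
    then have *: "Lp_le 2 (on_circle g s) (sqrt A)" "Lp_le 2 (on_circle k s) (sqrt A)"
      using s by (auto intro!: Lp_le_2_of_square[OF KsA] measurable_holomorphic_circle g k)
    show "Lp_le 2 (on_circle g s) (sqrt A)" by fact
    show "Lp_le 2 (on_circle k s) (sqrt A)" by fact
  next
    fix z :: complex assume "z \<in> ball 0 1"
    then show "f (of_real r * z) = g z * k z" using g0[of z] by (simp add: k_def F_def)
  qed
qed

lemma Poisson_kernel_le:
  assumes "0 \<le> r" "r < 1"
  shows "Poisson_kernel r t \<le> 2 / (1 - r)"
proof -
  have "1 - r \<le> norm (cis t - of_real r)"
    using norm_triangle_ineq2[of "cis t" "of_real r"] assms by simp
  then have "(1 - r)\<^sup>2 \<le> (norm (cis t - of_real r))\<^sup>2"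
    using assms by (intro power_mono) auto
  then have "Poisson_kernel r t \<le> (1 - r\<^sup>2) / (1 - r)\<^sup>2"
    unfolding Poisson_kernel_def
  proof (rule divide_left_mono)
    have "0 < norm (cis t - of_real r)" using \<open>1 - r \<le> _\<close> assms by linarith
    then show "0 < (norm (cis t - of_real r))\<^sup>2 * (1 - r)\<^sup>2"
      using assms by (intro mult_pos_pos zero_less_power) auto
    show "0 \<le> 1 - r\<^sup>2" using assms by (simp add: power_le_one_iff)
  qed
  also have "\<dots> = (1 + r) / (1 - r)"
  proof -
    have "1 - r\<^sup>2 = (1 + r) * (1 - r)" by (simp add: power2_eq_square algebra_simps)
    then show ?thesis using assms by (simp add: power2_eq_square)
  qed
  also have "\<dots> \<le> 2 / (1 - r)" using assms by (intro divide_right_mono) auto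
  finally show ?thesis .
qed

lemma integral_mean_1_pointwise_bound:
  assumes f: "f holomorphic_on ball 0 1" and r: "0 \<le> r" "r < R" "R < 1"
    and A: "Lp_le 1 (on_circle f R) A"
  shows "norm (f (of_real r * cis \<theta>)) \<le> 2 / (1 - r / R) * A"
proof -
  define q where "q = r / R"
  have q: "0 \<le> q" "q < 1" using r by (auto simp: q_def)
  have Rq: "of_real R * (of_real q * cis \<theta>) = of_real r * cis \<theta>" using r by (simp add: q_def)
  note cont = scaled_disc[OF f, of R]
  have Rb: "0 \<le> R" "R < 1" using r by auto
  have T: "Lp_le 1 (\<lambda>t. f (of_real R * cis (\<theta> + t))) A"
    using Lp_le_translate[OF A, of \<theta>] by (simp add: add.commute cis_mult[symmetric])
  have P: "(LINT t|circ. Poisson_kernel q t *\<^sub>R f (of_real R * cis (\<theta> + t))) = f (of_real r * cis \<theta>)"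
    using Poisson_formula[OF cont(1)[OF Rb] cont(2)[OF Rb] q, of \<theta>] Rq by simp
  have contF: "continuous_on UNIV (\<lambda>t. Poisson_kernel q t *\<^sub>R f (of_real R * cis (\<theta> + t)))"
    using continuous_on_circle[OF cont(1)[OF Rb], of \<theta>]
    by (intro continuous_intros continuous_on_Poisson_kernel q)
  have "ennreal (norm (f (of_real r * cis \<theta>)))
      \<le> (\<integral>\<^sup>+t. norm (Poisson_kernel q t *\<^sub>R f (of_real R * cis (\<theta> + t))) \<partial>circ)"
    unfolding P[symmetric] by (rule integral_norm_bound_ennreal[OF integral_circ_continuous(2)[OF contF]])
  also have "\<dots> \<le> (\<integral>\<^sup>+t. ennreal (2 / (1 - q)) * ennreal (norm (f (of_real R * cis (\<theta> + t))) powr 1) \<partial>circ)"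
  proof (intro nn_integral_mono)
    fix t
    have "norm (Poisson_kernel q t *\<^sub>R f (of_real R * cis (\<theta> + t)))
        = Poisson_kernel q t * norm (f (of_real R * cis (\<theta> + t)))"
      using Poisson_kernel_pos[OF q, of t] by simp
    also have "\<dots> \<le> 2 / (1 - q) * norm (f (of_real R * cis (\<theta> + t)))"
      by (intro mult_right_mono Poisson_kernel_le q) auto
    finally show "ennreal (norm (Poisson_kernel q t *\<^sub>R f (of_real R * cis (\<theta> + t))))
        \<le> ennreal (2 / (1 - q)) * ennreal (norm (f (of_real R * cis (\<theta> + t))) powr 1)"
      using q by (simp add: ennreal_leI flip: ennreal_mult)
  qed
  also have "\<dots> = ennreal (2 / (1 - q)) * (\<integral>\<^sup>+t. ennreal (norm (f (of_real R * cis (\<theta> + t))) powr 1) \<partial>circ)"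
    using Lp_leD(1)[OF T] by (intro nn_integral_cmult) auto
  also have "\<dots> \<le> ennreal (2 / (1 - q)) * ennreal (A powr 1)"
    by (intro mult_left_mono Lp_leD(3)[OF T]) auto
  also have "\<dots> = ennreal (2 / (1 - q) * A)"
    using Lp_leD(2)[OF A] q by (simp flip: ennreal_mult)
  finally show ?thesis
    using Lp_leD(2)[OF A] q by (subst (asm) ennreal_le_iff) (auto simp: q_def)
qed

text \<open>The hypothesis of Montel's theorem for the factors.\<close>

lemma H2_ball_locally_bounded:
  assumes K: "compact K" "K \<subseteq> ball 0 1"
  shows "\<exists>B. \<forall>h. h holomorphic_on ball 0 1 \<and> (\<forall>s. 0 \<le> s \<and> s < 1 \<longrightarrow> Lp_le 2 (on_circle h s) A)
      \<longrightarrow> (\<forall>z\<in>K. norm (h z) \<le> B)"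
proof (cases "K = {}")
  case False
  obtain z0 where z0: "z0 \<in> K" "\<And>z. z \<in> K \<Longrightarrow> norm z \<le> norm z0"
  proof -
    have "\<exists>x\<in>K. \<forall>y\<in>K. norm y \<le> norm x"
      by (rule continuous_attains_sup[OF K(1) False]) (intro continuous_intros)
    then show thesis using that by blast
  qed
  define R where "R = (1 + norm z0) / 2"
  have z01: "norm z0 < 1" using z0 K by auto
  then have R: "norm z0 < R" "R < 1" by (auto simp: R_def)
  have R0: "0 < R" using R(1) norm_ge_zero[of z0] by linarith
  show ?thesis
  proof (intro exI[of _ "2 / (1 - norm z0 / R) * \<bar>A\<bar>"] allI impI ballI)
    fix h z assume h: "h holomorphic_on ball 0 1 \<and> (\<forall>s. 0 \<le> s \<and> s < 1 \<longrightarrow> Lp_le 2 (on_circle h s) A)"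
      and z: "z \<in> K"
    have "Lp_le 1 (on_circle h R) A"
      using h R0 R by (intro Lp_le_imp_L1[of 2]) auto
    then have *: "norm (h (of_real (norm z) * cis (Arg z))) \<le> 2 / (1 - norm z / R) * A" "0 \<le> A"
      using h R z0(2)[OF z] Lp_leD(2) integral_mean_1_pointwise_bound[of h "norm z" R A "Arg z"] by auto
    have "of_real (norm z) * cis (Arg z) = z"
      using rcis_cmod_Arg[of z] by (simp add: rcis_def)
    then have "norm (h z) \<le> 2 / (1 - norm z / R) * A" using *(1) by simp
    also have "\<dots> \<le> 2 / (1 - norm z0 / R) * \<bar>A\<bar>"
    proof -
      have "norm z / R \<le> norm z0 / R" "norm z0 / R < 1"
        using z0(2)[OF z] R R0 by (auto intro: divide_right_mono)
      then show ?thesis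
        using *(2) by (intro mult_mono divide_left_mono) (auto intro!: mult_pos_pos)
    qed
    finally show "norm (h z) \<le> 2 / (1 - norm z0 / R) * \<bar>A\<bar>" .
  qed
qed auto

text \<open>The factors on the circles of radius \<open>r n\<close> form normal families. Along a common subsequence they converge
  in the disc, and Fatou's lemma preserves the bounds.\<close>

lemma Riesz_factorization:
  assumes f: "f holomorphic_on ball 0 1"
    and A: "\<And>s. 0 \<le> s \<Longrightarrow> s < 1 \<Longrightarrow> Lp_le 1 (on_circle f s) A"
  obtains g k where "g holomorphic_on ball 0 1" "k holomorphic_on ball 0 1"
    "\<And>z. z \<in> ball 0 1 \<Longrightarrow> f z = g z * k z"
    "\<And>s. 0 \<le> s \<Longrightarrow> s < 1 \<Longrightarrow> Lp_le 2 (on_circle g s) (sqrt A)"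
    "\<And>s. 0 \<le> s \<Longrightarrow> s < 1 \<Longrightarrow> Lp_le 2 (on_circle k s) (sqrt A)"
proof (cases "\<exists>z\<in>ball 0 1. f z \<noteq> 0")
  case False
  have "0 \<le> A" using Lp_leD(2)[OF A[of 0]] by simp
  then have "Lp_le 2 (\<lambda>_. 0) (sqrt A)" by (intro Lp_le_bounded) auto
  then show thesis using False by (intro that[of "\<lambda>_. 0" "\<lambda>_. 0"]) auto
next
  case nz: True
  define \<H> where "\<H> = {h. h holomorphic_on ball 0 1 \<and> (\<forall>s. 0 \<le> s \<and> s < 1 \<longrightarrow> Lp_le 2 (on_circle h s) (sqrt A))}"
  define r where "r n = 1 - inverse (real (n + 2))" for n
  have r: "0 < r n" "r n < 1" for n
    by (auto simp: r_def inverse_eq_divide field_simps)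
  have r_lim: "r \<longlonglongrightarrow> 1"
  proof -
    have "(\<lambda>n. 1 - inverse (real (n + 2))) \<longlonglongrightarrow> 1 - 0"
      using LIMSEQ_ignore_initial_segment[OF lim_inverse_n, of 2] by (intro tendsto_intros) auto
    then show ?thesis by (simp add: r_def[abs_def])
  qed
  have "\<exists>g k. g \<in> \<H> \<and> k \<in> \<H> \<and> (\<forall>z\<in>ball 0 1. f (of_real (r n) * z) = g z * k z)" for n
    unfolding \<H>_def mem_Collect_eq using r[of n]
    by (intro Riesz_factorization_dilated[OF f nz] A) auto
  then obtain G K where GK: "\<And>n. G n \<in> \<H>" "\<And>n. K n \<in> \<H>"
      "\<And>n z. z \<in> ball 0 1 \<Longrightarrow> f (of_real (r n) * z) = G n z * K n z"
    by metis
  have bdd: "\<exists>B. \<forall>h\<in>\<H>. \<forall>z\<in>X. norm (h z) \<le> B" if "compact X" "X \<subseteq> ball 0 1" for X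
    using H2_ball_locally_bounded[OF that, of "sqrt A"] unfolding \<H>_def by blast
  have hol: "\<And>h. h \<in> \<H> \<Longrightarrow> h holomorphic_on ball 0 1" by (simp add: \<H>_def)
  obtain g \<sigma> where g: "g holomorphic_on ball 0 1" "strict_mono (\<sigma> :: nat \<Rightarrow> nat)"
      "\<And>z. z \<in> ball 0 1 \<Longrightarrow> (\<lambda>n. G (\<sigma> n) z) \<longlonglongrightarrow> g z"
    using Montel[OF open_ball hol bdd, of G] GK(1) by (metis image_subset_iff)
  obtain k \<tau> where k: "k holomorphic_on ball 0 1" "strict_mono (\<tau> :: nat \<Rightarrow> nat)"
      "\<And>z. z \<in> ball 0 1 \<Longrightarrow> (\<lambda>n. K (\<sigma> (\<tau> n)) z) \<longlonglongrightarrow> k z"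
    using Montel[OF open_ball hol bdd, of "\<lambda>n. K (\<sigma> n)"] GK(2) by (metis image_subset_iff)
  have g': "(\<lambda>n. G (\<sigma> (\<tau> n)) z) \<longlonglongrightarrow> g z" if "z \<in> ball 0 1" for z
    using LIMSEQ_subseq_LIMSEQ[OF g(3)[OF that] k(2)] by (simp add: o_def)
  have in_disc: "of_real s * cis \<theta> \<in> ball 0 1" if "0 \<le> s" "s < 1" for s \<theta>
    using that by (simp add: norm_mult)
  have bound: "Lp_le 2 (on_circle h s) (sqrt A)"
    if s: "0 \<le> s" "s < 1" and h: "h holomorphic_on ball 0 1" "\<And>n. H n \<in> \<H>" "\<And>z. z \<in> ball 0 1 \<Longrightarrow> (\<lambda>n. H n z) \<longlonglongrightarrow> h z"
    for s h and H :: "nat \<Rightarrow> complex \<Rightarrow> complex"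
  proof (rule Lp_le_LIMSEQ)
    show "Lp_le 2 (\<lambda>\<theta>. H n (of_real s * cis \<theta>)) (sqrt A)" for n
      using h(2)[of n] s by (auto simp: \<H>_def)
    show "AE \<theta> in circ. (\<lambda>n. H n (of_real s * cis \<theta>)) \<longlonglongrightarrow> h (of_real s * cis \<theta>)"
      using h(3)[OF in_disc[OF s]] by simp
  qed (use s measurable_holomorphic_circle[OF h(1)] in auto)
  show thesis
  proof (rule that[OF g(1) k(1)])
    fix z :: complex assume z: "z \<in> ball 0 1"
    have "(\<lambda>n. of_real (r (\<sigma> (\<tau> n))) * z) \<longlonglongrightarrow> of_real 1 * z"
      using LIMSEQ_subseq_LIMSEQ[OF LIMSEQ_subseq_LIMSEQ[OF r_lim g(2)] k(2)]
      by (intro tendsto_intros) (simp add: o_def)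
    then have "(\<lambda>n. f (of_real (r (\<sigma> (\<tau> n))) * z)) \<longlonglongrightarrow> f z"
      using z f by (intro isCont_tendsto_compose[of z f])
        (auto intro: continuous_on_interior holomorphic_on_imp_continuous_on)
    moreover have "(\<lambda>n. G (\<sigma> (\<tau> n)) z * K (\<sigma> (\<tau> n)) z) \<longlonglongrightarrow> g z * k z"
      by (intro tendsto_intros g' k z)
    ultimately show "f z = g z * k z"
      using GK(3)[OF z] by (simp add: LIMSEQ_unique)
  next
    fix s :: real assume s: "0 \<le> s" "s < 1"
    show "Lp_le 2 (on_circle g s) (sqrt A)" by (rule bound[OF s g(1) _ g']) (auto simp: GK)
    show "Lp_le 2 (on_circle k s) (sqrt A)" by (rule bound[OF s k(1) _ k(3)]) (auto simp: GK)
  qed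
qed

section \<open>Convergence in the mean to the boundary\<close>

text \<open>On the unit circle \<open>z ^ N * cnj (z ^ n) = z ^ (N - n)\<close>, so this is the mean value of a polynomial that vanishes
  at \<open>0\<close>.\<close>

lemma integral_circ_power_cnj_polynomial:
  fixes c :: "nat \<Rightarrow> complex"
  shows "(LINT t|circ. cis t ^ N * cnj (\<Sum>n<N. c n * cis t ^ n)) = 0"
proof (cases "N = 0")
  case False
  define q where "q z = (\<Sum>n<N. cnj (c n) * z ^ (N - n))" for z :: complex
  have "cis t ^ N * cnj (\<Sum>n<N. c n * cis t ^ n) = q (cis t)" for t
  proof -
    have "cis t ^ N * cnj (cis t ^ n) = cis t ^ (N - n)" if "n < N" for n
    proof -
      have "cis t ^ N = cis t ^ (N - n) * cis t ^ n" using that by (simp flip: power_add)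
      moreover have "cis t ^ n * cnj (cis t ^ n) = 1"
        by (simp add: cis_cnj cis_mult flip: power_mult_distrib)
      ultimately show ?thesis by (simp add: mult.assoc)
    qed
    then show ?thesis
      by (auto simp: q_def cnj_sum sum_distrib_left mult.left_commute intro!: sum.cong)
  qed
  moreover have "(LINT t|circ. q (cis t) / (cis t - 0) * cis t) = q 0"
    unfolding q_def by (intro Cauchy_formula_circ continuous_intros holomorphic_intros) auto
  moreover have "q 0 = 0" by (auto simp: q_def power_0_left)
  ultimately show ?thesis by simp
qed simp

lemma Parseval_polynomial:
  fixes c :: "nat \<Rightarrow> complex"
  shows "(LINT t|circ. (norm (\<Sum>n<N. c n * cis t ^ n))\<^sup>2) = (\<Sum>n<N. (norm (c n))\<^sup>2)"
proof (induction N)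
  case (Suc N)
  define S where "S t = (\<Sum>n<N. c n * cis t ^ n)" for t
  have contS: "continuous_on UNIV S" unfolding S_def by (intro continuous_intros)
  have int: "integrable circ (\<lambda>t. Re (F t))" if "continuous_on UNIV F" for F :: "real \<Rightarrow> complex"
    using integral_circ_continuous(2)[OF that] by (rule integrable_Re)
  have int_S: "integrable circ (\<lambda>t. (norm (S t))\<^sup>2)"
    using int[of "\<lambda>t. of_real ((norm (S t))\<^sup>2)"] contS by (simp add: continuous_intros)
  have int_c: "integrable circ (\<lambda>t. c N * (cis t ^ N * cnj (S t)))"
    by (intro integral_circ_continuous(2) continuous_intros contS)
  have expand: "(norm (S t + c N * cis t ^ N))\<^sup>2
      = (norm (S t))\<^sup>2 + 2 * Re (c N * (cis t ^ N * cnj (S t))) + (norm (c N))\<^sup>2" for t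
  proof -
    have "(norm (S t + c N * cis t ^ N))\<^sup>2
        = (norm (S t))\<^sup>2 + 2 * Re (c N * cis t ^ N * cnj (S t)) + (norm (c N * cis t ^ N))\<^sup>2"
      unfolding cmod_power2 by (simp add: power2_eq_square algebra_simps)
    then show ?thesis by (simp add: norm_mult norm_power mult.assoc)
  qed
  have "(LINT t|circ. (norm (\<Sum>n<Suc N. c n * cis t ^ n))\<^sup>2)
      = (LINT t|circ. (norm (S t))\<^sup>2 + 2 * Re (c N * (cis t ^ N * cnj (S t))) + (norm (c N))\<^sup>2)"
    unfolding expand[symmetric] by (simp add: S_def)
  also have "\<dots> = (LINT t|circ. (norm (S t))\<^sup>2) + 2 * (LINT t|circ. Re (c N * (cis t ^ N * cnj (S t)))) + (norm (c N))\<^sup>2"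
  proof -
    define G where "G t = Re (c N * (cis t ^ N * cnj (S t)))" for t
    have "integrable circ G" unfolding G_def by (rule integrable_Re[OF int_c])
    then show ?thesis using int_S unfolding G_def[symmetric] by simp
  qed
  also have "(LINT t|circ. Re (c N * (cis t ^ N * cnj (S t)))) = Re (c N * (LINT t|circ. cis t ^ N * cnj (S t)))"
    by (simp only: integral_Re[OF int_c] integral_mult_right_zero)
  also have "\<dots> = 0" unfolding S_def by (simp only: integral_circ_power_cnj_polynomial) simp
  finally show ?case using Suc.IH by (simp add: S_def)
qed simp

lemma Parseval_absolutely_convergent:
  fixes c :: "nat \<Rightarrow> complex"
  assumes c: "summable (\<lambda>n. norm (c n))" and F: "\<And>t. (\<lambda>n. c n * cis t ^ n) sums F t"
  shows "(\<lambda>N. \<Sum>n<N. (norm (c n))\<^sup>2) \<longlonglongrightarrow> (LINT t|circ. (norm (F t))\<^sup>2)"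
proof -
  define B where "B = (\<Sum>n. norm (c n))"
  have [measurable]: "cis \<in> borel_measurable borel"
    by (intro borel_measurable_continuous_onI continuous_intros)
  have F_lim: "(\<lambda>N. \<Sum>n<N. c n * cis t ^ n) \<longlonglongrightarrow> F t" for t using F[of t] by (simp add: sums_def)
  have [measurable]: "F \<in> borel_measurable borel"
    by (rule borel_measurable_LIMSEQ_metric[where f = "\<lambda>N t. \<Sum>n<N. c n * cis t ^ n"])
       (measurable, rule F_lim)
  have "(\<lambda>N. LINT t|circ. (norm (\<Sum>n<N. c n * cis t ^ n))\<^sup>2) \<longlonglongrightarrow> (LINT t|circ. (norm (F t))\<^sup>2)"
  proof (rule integral_dominated_convergence[where w = "\<lambda>_. B\<^sup>2"])
    show "AE t in circ. (\<lambda>N. (norm (\<Sum>n<N. c n * cis t ^ n))\<^sup>2) \<longlonglongrightarrow> (norm (F t))\<^sup>2"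
      by (intro AE_I2 tendsto_power tendsto_norm F_lim)
    have "norm (\<Sum>n<N. c n * cis t ^ n) \<le> B" for N t
    proof -
      have "norm (\<Sum>n<N. c n * cis t ^ n) \<le> (\<Sum>n<N. norm (c n))"
        by (rule order_trans[OF norm_sum]) (simp add: norm_mult norm_power)
      also have "\<dots> \<le> B" unfolding B_def by (intro sum_le_suminf c) auto
      finally show ?thesis .
    qed
    then show "AE t in circ. norm ((norm (\<Sum>n<N. c n * cis t ^ n))\<^sup>2) \<le> B\<^sup>2" for N
      by (auto intro!: power_mono)
  qed auto
  then show ?thesis by (simp only: Parseval_polynomial)
qed

text \<open>By Parseval this can be checked for each coefficient, where it is \<open>(s ^ n - r ^ n)\<^sup>2 \<le> (s ^ n)\<^sup>2 - (r ^ n)\<^sup>2\<close>.\<close>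

lemma L2_diff_le_diff_means:
  assumes g: "g holomorphic_on ball 0 1" and r: "0 \<le> r" "r \<le> s" "s < 1"
  shows "(LINT t|circ. (norm (g (of_real s * cis t) - g (of_real r * cis t)))\<^sup>2)
    \<le> (LINT t|circ. (norm (g (of_real s * cis t)))\<^sup>2) - (LINT t|circ. (norm (g (of_real r * cis t)))\<^sup>2)"
proof -
  define a where "a n = (deriv ^^ n) g 0 / fact n" for n
  have sums: "(\<lambda>n. a n * of_real x ^ n * cis t ^ n) sums g (of_real x * cis t)" if "0 \<le> x" "x < 1" for x t
    using holomorphic_power_series[OF g, of "of_real x * cis t"] that
    by (simp add: a_def norm_mult power_mult_distrib mult.assoc)
  have summ: "summable (\<lambda>n. norm (a n * of_real x ^ n))" if x: "0 \<le> x" "x < 1" for x :: real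
  proof -
    \<comment> \<open>a larger radius of convergence gives absolute convergence at \<open>x\<close>\<close>
    define y where "y = (1 + x) / 2"
    have y: "0 \<le> y" "x < y" "y < 1" using x by (auto simp: y_def)
    have "summable (\<lambda>n. a n * of_real y ^ n)" using sums[of y 0] y by (simp add: sums_iff)
    then show ?thesis
      using powser_insidea[of a "of_real y" "of_real x"] x y by simp
  qed
  have P: "(\<lambda>N. \<Sum>n<N. (norm (a n * of_real x ^ n))\<^sup>2) \<longlonglongrightarrow> (LINT t|circ. (norm (g (of_real x * cis t)))\<^sup>2)"
    if "0 \<le> x" "x < 1" for x
    by (rule Parseval_absolutely_convergent[OF summ[OF that] sums[OF that]])
  have s: "0 \<le> s" "r < 1" using r by auto
  have D: "(\<lambda>N. \<Sum>n<N. (norm (a n * of_real s ^ n - a n * of_real r ^ n))\<^sup>2)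
      \<longlonglongrightarrow> (LINT t|circ. (norm (g (of_real s * cis t) - g (of_real r * cis t)))\<^sup>2)"
  proof (rule Parseval_absolutely_convergent)
    show "summable (\<lambda>n. norm (a n * of_real s ^ n - a n * of_real r ^ n))"
      by (rule summable_comparison_test'[OF summable_add[OF summ[of s] summ[of r]], of 0])
         (use r s norm_triangle_ineq4 in auto)
    show "(\<lambda>n. (a n * of_real s ^ n - a n * of_real r ^ n) * cis t ^ n) sums (g (of_real s * cis t) - g (of_real r * cis t))" for t
      using sums_diff[OF sums[OF s(1) r(3), of t] sums[OF r(1) s(2), of t]] by (simp add: left_diff_distrib)
  qed
  show ?thesis
  proof (rule LIMSEQ_le[OF D tendsto_diff[OF P[OF s(1) r(3)] P[OF r(1) s(2)]]])
    have "(norm (a n * of_real s ^ n - a n * of_real r ^ n))\<^sup>2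
        \<le> (norm (a n * of_real s ^ n))\<^sup>2 - (norm (a n * of_real r ^ n))\<^sup>2" for n
    proof -
      have "r ^ n \<le> s ^ n" "0 \<le> r ^ n" using r by (auto intro: power_mono)
      then have "(s ^ n - r ^ n)\<^sup>2 \<le> (s ^ n)\<^sup>2 - (r ^ n)\<^sup>2"
        using mult_left_mono[of "r ^ n" "s ^ n" "r ^ n"] by (simp add: power2_eq_square algebra_simps)
      then have "(norm (a n))\<^sup>2 * (s ^ n - r ^ n)\<^sup>2 \<le> (norm (a n))\<^sup>2 * ((s ^ n)\<^sup>2 - (r ^ n)\<^sup>2)"
        by (intro mult_left_mono) auto
      moreover have "a n * of_real s ^ n - a n * of_real r ^ n = a n * of_real (s ^ n - r ^ n)"
        by (simp add: right_diff_distrib)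
      ultimately show ?thesis
        using r s by (simp add: norm_mult norm_power power_mult_distrib right_diff_distrib del: of_real_diff of_real_power)
    qed
    then show "\<exists>N0. \<forall>N\<ge>N0. (\<Sum>n<N. (norm (a n * of_real s ^ n - a n * of_real r ^ n))\<^sup>2)
      \<le> (\<Sum>n<N. (norm (a n * of_real s ^ n))\<^sup>2) - (\<Sum>n<N. (norm (a n * of_real r ^ n))\<^sup>2)"
      unfolding sum_subtractf[symmetric] by (intro exI allI impI sum_mono)
  qed
qed

lemma nn_integral_norm_square:
  assumes "continuous_on UNIV (F :: real \<Rightarrow> complex)"
  shows "(\<integral>\<^sup>+t. norm (F t) powr 2 \<partial>circ) = ennreal (LINT t|circ. (norm (F t))\<^sup>2)"
proof -
  have "integrable circ (\<lambda>t. (norm (F t))\<^sup>2)"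
    using integrable_Re[OF integral_circ_continuous(2)[of "\<lambda>t. of_real ((norm (F t))\<^sup>2)"]] assms
    by (simp add: continuous_intros)
  then show ?thesis by (simp add: nn_integral_eq_integral)
qed

text \<open>The squared means increase with the radius and are bounded; beyond a radius where they are within
  \<open>e\<^sup>2\<close> of their supremum, differences of dilations are at most \<open>e\<close>.\<close>

lemma Cauchy_in_L2:
  assumes g: "g holomorphic_on ball 0 1"
    and B: "\<And>s. 0 \<le> s \<Longrightarrow> s < 1 \<Longrightarrow> Lp_le 2 (on_circle g s) B" and e: "0 < e"
  shows "\<exists>R. 0 \<le> R \<and> R < 1 \<and> (\<forall>r s. R \<le> r \<and> r \<le> s \<and> s < 1 \<longrightarrow>
    Lp_le 2 (\<lambda>\<theta>. g (of_real s * cis \<theta>) - g (of_real r * cis \<theta>)) e)"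
proof -
  define m where "m r = (LINT t|circ. (norm (g (of_real r * cis t)))\<^sup>2)" for r
  note cont = continuous_on_holomorphic_circle[OF g]
  have m_le: "m r \<le> B\<^sup>2" if "0 \<le> r" "r < 1" for r
  proof -
    have "ennreal (m r) \<le> ennreal (B powr 2)"
      using Lp_leD(3)[OF B[OF that]] unfolding nn_integral_norm_square[OF cont[OF that]] m_def .
    then show ?thesis using Lp_leD(2)[OF B[OF that]] by (simp add: ennreal_le_iff)
  qed
  define L where "L = (SUP r\<in>{0..<1}. m r)"
  have bdd: "bdd_above (m ` {0..<1})" using m_le by (auto intro!: bdd_aboveI[of _ "B\<^sup>2"])
  have "L - e\<^sup>2 < L" using e by simp
  then obtain R where R: "0 \<le> R" "R < 1" "L - e\<^sup>2 < m R"
    unfolding L_def using less_cSUP_iff[OF _ bdd, of "L - e\<^sup>2"] by (auto simp: L_def)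
  have "Lp_le 2 (\<lambda>\<theta>. g (of_real s * cis \<theta>) - g (of_real r * cis \<theta>)) e"
    if rs: "R \<le> r" "r \<le> s" "s < 1" for r s
  proof -
    have contD: "continuous_on UNIV (\<lambda>\<theta>. g (of_real s * cis \<theta>) - g (of_real r * cis \<theta>))"
      using rs R by (intro continuous_intros cont) auto
    have D: "(LINT t|circ. (norm (g (of_real y * cis t) - g (of_real x * cis t)))\<^sup>2) \<le> m y - m x"
      if "0 \<le> x" "x \<le> y" "y < 1" for x y
      unfolding m_def by (rule L2_diff_le_diff_means[OF g that])
    have "0 \<le> m r - m R"
      using D[of R r] R rs by (intro order_trans[OF _ D]) (auto intro!: Bochner_Integration.integral_nonneg)
    moreover have "m s \<le> L" unfolding L_def using rs R by (intro cSUP_upper bdd) auto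
    ultimately have "(LINT t|circ. (norm (g (of_real s * cis t) - g (of_real r * cis t)))\<^sup>2) \<le> e\<^sup>2"
      using D[of r s] R rs by auto
    then show ?thesis
      using e nn_integral_norm_square[OF contD] borel_measurable_continuous_onI[OF contD]
      by (auto simp: Lp_le_def intro!: ennreal_leI)
  qed
  then show ?thesis using R by blast
qed

text \<open>The Cauchy-Schwarz inequality, as Jensen's inequality for \<open>norm u / norm v\<close> with the weight \<open>(norm v)\<^sup>2\<close>.\<close>

lemma Lp_le_1_mult:
  assumes u: "Lp_le 2 u A" and v: "Lp_le 2 v B"
  shows "Lp_le 1 (\<lambda>\<theta>. u \<theta> * v \<theta>) (A * B)"
proof (rule Lp_le_epsilon[where c = A])
  fix e :: real assume e: "0 < e"
  note [measurable] = Lp_leD(1)[OF u] Lp_leD(1)[OF v]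
  have Be: "Lp_le 2 v (B + e)" using v e by (elim Lp_le_mono) auto
  have A0: "0 \<le> A" "0 \<le> B" using Lp_leD(2)[OF u] Lp_leD(2)[OF v] by auto
  have "(\<integral>\<^sup>+\<theta>. (norm (u \<theta>) / norm (v \<theta>)) * (norm (v \<theta>))\<^sup>2 \<partial>circ)
      \<le> ennreal ((A powr 2) powr (1 / 2) * ((B + e) powr 2) powr (1 - 1 / 2))"
  proof (rule weighted_Jensen)
    have "(\<integral>\<^sup>+\<theta>. (norm (u \<theta>) / norm (v \<theta>)) powr 2 * (norm (v \<theta>))\<^sup>2 \<partial>circ) \<le> (\<integral>\<^sup>+\<theta>. norm (u \<theta>) powr 2 \<partial>circ)"
      by (intro nn_integral_mono ennreal_leI) (auto simp: power_divide)
    also have "\<dots> \<le> ennreal (A powr 2)" by (rule Lp_leD(3)[OF u])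
    finally show "(\<integral>\<^sup>+\<theta>. ennreal ((norm (u \<theta>) / norm (v \<theta>)) powr 2 * (norm (v \<theta>))\<^sup>2) \<partial>circ) \<le> ennreal (A powr 2)" .
    show "(\<integral>\<^sup>+\<theta>. ennreal ((norm (v \<theta>))\<^sup>2) \<partial>circ) \<le> ennreal ((B + e) powr 2)"
      using Lp_leD(3)[OF Be] by simp
    show "0 < (B + e) powr 2" using A0 e by simp
  qed auto
  also have "(A powr 2) powr (1 / 2) * ((B + e) powr 2) powr (1 - 1 / 2) = A * (B + e)"
    using A0 e by (simp add: powr_powr)
  also have "(\<lambda>\<theta>. (norm (u \<theta>) / norm (v \<theta>)) * (norm (v \<theta>))\<^sup>2) = (\<lambda>\<theta>. norm (u \<theta> * v \<theta>) powr 1)"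
    by (auto simp: fun_eq_iff norm_mult power2_eq_square)
  finally show "Lp_le 1 (\<lambda>\<theta>. u \<theta> * v \<theta>) (A * B + e * A)"
    using A0 e by (auto simp: Lp_le_def algebra_simps)
qed auto

lemma Cauchy_in_L1:
  assumes f: "f holomorphic_on ball 0 1"
    and A: "\<And>s. 0 \<le> s \<Longrightarrow> s < 1 \<Longrightarrow> Lp_le 1 (on_circle f s) A" and e: "0 < e"
  shows "\<exists>R. 0 \<le> R \<and> R < 1 \<and> (\<forall>r s. R \<le> r \<and> r \<le> s \<and> s < 1 \<longrightarrow>
    Lp_le 1 (\<lambda>\<theta>. f (of_real s * cis \<theta>) - f (of_real r * cis \<theta>)) e)"
proof -
  obtain g k where g: "g holomorphic_on ball 0 1" and k: "k holomorphic_on ball 0 1"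
    and f_eq: "\<And>z. z \<in> ball 0 1 \<Longrightarrow> f z = g z * k z"
    and gA: "\<And>s. 0 \<le> s \<Longrightarrow> s < 1 \<Longrightarrow> Lp_le 2 (on_circle g s) (sqrt A)"
    and kA: "\<And>s. 0 \<le> s \<Longrightarrow> s < 1 \<Longrightarrow> Lp_le 2 (on_circle k s) (sqrt A)"
    using Riesz_factorization[OF f A] by blast
  have "0 \<le> A" using Lp_leD(2)[OF A[of 0]] by simp
  \<comment> \<open>\<open>f = g * k\<close> changes by at most \<open>2 * sqrt A * d\<close> if both factors change by at most \<open>d\<close>; the summand \<open>1\<close> covers \<open>A = 0\<close>\<close>
  define d where "d = e / (2 * (sqrt A + 1))"
  have d: "0 < d" using e \<open>0 \<le> A\<close> by (simp add: d_def add_nonneg_pos)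
  obtain R1 where R1: "0 \<le> R1" "R1 < 1" "\<And>r s. R1 \<le> r \<Longrightarrow> r \<le> s \<Longrightarrow> s < 1 \<Longrightarrow>
      Lp_le 2 (\<lambda>\<theta>. g (of_real s * cis \<theta>) - g (of_real r * cis \<theta>)) d"
    using Cauchy_in_L2[OF g gA d] by blast
  obtain R2 where R2: "0 \<le> R2" "R2 < 1" "\<And>r s. R2 \<le> r \<Longrightarrow> r \<le> s \<Longrightarrow> s < 1 \<Longrightarrow>
      Lp_le 2 (\<lambda>\<theta>. k (of_real s * cis \<theta>) - k (of_real r * cis \<theta>)) d"
    using Cauchy_in_L2[OF k kA d] by blast
  have "Lp_le 1 (\<lambda>\<theta>. f (of_real s * cis \<theta>) - f (of_real r * cis \<theta>)) e"
    if rs: "max R1 R2 \<le> r" "r \<le> s" "s < 1" for r s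
  proof -
    have in_disc: "of_real s * cis \<theta> \<in> ball 0 1" "of_real r * cis \<theta> \<in> ball 0 1" for \<theta>
      using rs R1 by (auto simp: norm_mult)
    have "Lp_le 1 (\<lambda>\<theta>. g (of_real s * cis \<theta>) * (k (of_real s * cis \<theta>) - k (of_real r * cis \<theta>))
        + (g (of_real s * cis \<theta>) - g (of_real r * cis \<theta>)) * k (of_real r * cis \<theta>)) (sqrt A * d + d * sqrt A)"
      using rs R1 R2 by (intro Lp_le_add Lp_le_1_mult gA kA R1(3) R2(3)) auto
    also have "(\<lambda>\<theta>. g (of_real s * cis \<theta>) * (k (of_real s * cis \<theta>) - k (of_real r * cis \<theta>))
        + (g (of_real s * cis \<theta>) - g (of_real r * cis \<theta>)) * k (of_real r * cis \<theta>))
        = (\<lambda>\<theta>. f (of_real s * cis \<theta>) - f (of_real r * cis \<theta>))"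
      unfolding f_eq[OF in_disc(1)] f_eq[OF in_disc(2)] by (simp add: algebra_simps)
    finally show ?thesis
    proof (rule Lp_le_mono)
      have "sqrt A * d + d * sqrt A \<le> d * (2 * (sqrt A + 1))" using d by (simp add: algebra_simps)
      also have "\<dots> = e" using \<open>0 \<le> A\<close> by (simp add: d_def add_nonneg_eq_0_iff)
      finally show "sqrt A * d + d * sqrt A \<le> e" .
    qed auto
  qed
  then show ?thesis using R1 R2 by (intro exI[of _ "max R1 R2"]) auto
qed

text \<open>Completeness of \<open>L\<^sup>1\<close>: along radii chosen so that successive differences have mean at most \<open>(1/2) ^ k\<close> the
  functions converge almost everywhere. The limit is taken pointwise, which makes it periodic.\<close>

lemma L1_boundary_function:
  assumes f: "f holomorphic_on ball 0 1"
    and A: "\<And>s. 0 \<le> s \<Longrightarrow> s < 1 \<Longrightarrow> Lp_le 1 (on_circle f s) A"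
  obtains h where "\<And>\<theta>. h (\<theta> + 2 * pi) = h \<theta>"
    "\<And>e. 0 < e \<Longrightarrow> \<exists>R. 0 \<le> R \<and> R < 1 \<and> (\<forall>r. R \<le> r \<and> r < 1 \<longrightarrow> Lp_le 1 (\<lambda>\<theta>. f (of_real r * cis \<theta>) - h \<theta>) e)"
proof -
  have "\<forall>k. \<exists>R. 0 \<le> R \<and> R < 1 \<and> (\<forall>r s. R \<le> r \<and> r \<le> s \<and> s < 1 \<longrightarrow>
    Lp_le 1 (\<lambda>\<theta>. f (of_real s * cis \<theta>) - f (of_real r * cis \<theta>)) ((1/2) ^ k))"
    using Cauchy_in_L1[OF f A] by auto
  then obtain R where R: "\<And>k. 0 \<le> R k" "\<And>k. R k < 1" "\<And>k r s. R k \<le> r \<Longrightarrow> r \<le> s \<Longrightarrow> s < 1 \<Longrightarrow>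
    Lp_le 1 (\<lambda>\<theta>. f (of_real s * cis \<theta>) - f (of_real r * cis \<theta>)) ((1/2) ^ k)"
    by metis
  \<comment> \<open>an increasing sequence of radii, so that the Cauchy estimate applies to consecutive ones\<close>
  define \<rho> where "\<rho> k = Max (R ` {..k})" for k
  have \<rho>: "0 \<le> \<rho> k" "\<rho> k < 1" "R k \<le> \<rho> k" "\<rho> k \<le> \<rho> (Suc k)" for k
  proof -
    show "\<rho> k < 1" unfolding \<rho>_def using R(2) by (subst Max_less_iff) auto
    show "R k \<le> \<rho> k" unfolding \<rho>_def by (intro Max_ge) auto
    then show "0 \<le> \<rho> k" using R(1)[of k] by linarith
    show "\<rho> k \<le> \<rho> (Suc k)" unfolding \<rho>_def by (intro Max_mono) auto
  qed
  have \<rho>_mono: "\<rho> i \<le> \<rho> j" if "i \<le> j" for i j using that \<rho>(4) by (rule lift_Suc_mono_le[rotated])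
  define u where "u k \<theta> = f (of_real (\<rho> k) * cis \<theta>)" for k \<theta>
  have [measurable]: "u k \<in> borel_measurable borel" for k
    unfolding u_def using \<rho> by (intro measurable_holomorphic_circle f) auto
  define h where "h \<theta> = lim (\<lambda>k. u k \<theta>)" for \<theta>
  have [measurable]: "h \<in> borel_measurable borel" unfolding h_def by measurable
  have step: "(\<integral>\<^sup>+\<theta>. norm (u (Suc k) \<theta> - u k \<theta>) \<partial>circ) \<le> ennreal ((1/2) ^ k)" for k
    using Lp_leD(3)[OF R(3)[OF \<rho>(3)[of k] \<rho>(4)[of k] \<rho>(2)]] by (simp add: u_def)
  have "(\<integral>\<^sup>+\<theta>. (\<Sum>k. ennreal (norm (u (Suc k) \<theta> - u k \<theta>))) \<partial>circ)
      = (\<Sum>k. \<integral>\<^sup>+\<theta>. norm (u (Suc k) \<theta> - u k \<theta>) \<partial>circ)"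
    by (rule nn_integral_suminf) measurable
  also have "\<dots> \<le> (\<Sum>k. ennreal ((1/2) ^ k))" by (intro suminf_le step) auto
  also have "\<dots> = ennreal (\<Sum>k. (1/2) ^ k)" by (rule suminf_ennreal2) (auto intro: summable_geometric)
  also have "\<dots> < top" by simp
  finally have "(\<integral>\<^sup>+\<theta>. (\<Sum>k. ennreal (norm (u (Suc k) \<theta> - u k \<theta>))) \<partial>circ) \<noteq> \<infinity>" by simp
  then have "AE \<theta> in circ. (\<Sum>k. ennreal (norm (u (Suc k) \<theta> - u k \<theta>))) \<noteq> \<infinity>"
    by (intro nn_integral_PInf_AE) measurable
  then have conv: "AE \<theta> in circ. (\<lambda>k. u k \<theta>) \<longlonglongrightarrow> h \<theta>"
  proof eventually_elim
    case (elim \<theta>)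
    then have "summable (\<lambda>k. norm (u (Suc k) \<theta> - u k \<theta>))"
      by (intro summable_suminf_not_top) auto
    then have "summable (\<lambda>k. u (Suc k) \<theta> - u k \<theta>)" by (rule summable_norm_cancel)
    then have "convergent (\<lambda>n. (\<Sum>k<n. u (Suc k) \<theta> - u k \<theta>) + u 0 \<theta>)"
      by (intro convergent_add convergent_const) (simp add: summable_iff_convergent)
    then have "convergent (\<lambda>n. u n \<theta>)" using sum_lessThan_telescope[of "\<lambda>k. u k \<theta>"] by simp
    then show ?case by (simp add: h_def convergent_LIMSEQ_iff)
  qed
  show thesis
  proof (rule that)
    show "h (\<theta> + 2 * pi) = h \<theta>" for \<theta>
      by (simp add: h_def u_def cis_mult[symmetric])
    fix e :: real assume e: "0 < e"
    obtain R' where R': "0 \<le> R'" "R' < 1" "\<And>r s. R' \<le> r \<Longrightarrow> r \<le> s \<Longrightarrow> s < 1 \<Longrightarrow>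
      Lp_le 1 (\<lambda>\<theta>. f (of_real s * cis \<theta>) - f (of_real r * cis \<theta>)) (e / 2)"
      using Cauchy_in_L1[OF f A, of "e / 2"] e by auto
    obtain k0 where k0: "(1/2) ^ k0 < e / 2" using real_arch_pow_inv[of "e / 2" "1/2"] e by auto
    define R'' where "R'' = max R' (\<rho> k0)"
    have "Lp_le 1 (\<lambda>\<theta>. f (of_real r * cis \<theta>) - h \<theta>) e" if r: "R'' \<le> r" "r < 1" for r
    proof -
      have near: "Lp_le 1 (\<lambda>\<theta>. f (of_real r * cis \<theta>) - u (k + k0) \<theta>) (e / 2 + e / 2)" for k
      proof -
        have "Lp_le 1 (\<lambda>\<theta>. f (of_real r * cis \<theta>) - u k0 \<theta>) ((1/2) ^ k0)"
          unfolding u_def using \<rho>(3)[of k0] r by (intro R(3)) (auto simp: R''_def)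
        then have 1: "Lp_le 1 (\<lambda>\<theta>. f (of_real r * cis \<theta>) - u k0 \<theta>) (e / 2)"
          by (rule Lp_le_mono) (use k0 in auto)
        have "Lp_le 1 (\<lambda>\<theta>. u (k + k0) \<theta> - u k0 \<theta>) ((1/2) ^ k0)"
          unfolding u_def using \<rho>(2,3) \<rho>_mono[of k0 "k + k0"] by (intro R(3)) auto
        then have 2: "Lp_le 1 (\<lambda>\<theta>. u (k + k0) \<theta> - u k0 \<theta>) (e / 2)"
          by (rule Lp_le_mono) (use k0 in auto)
        show ?thesis using Lp_le_diff[OF 1 2] by simp
      qed
      have "Lp_le 1 (\<lambda>\<theta>. f (of_real r * cis \<theta>) - h \<theta>) (e / 2 + e / 2)"
      proof (rule Lp_le_LIMSEQ[OF near tendsto_const])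
        show "AE \<theta> in circ. (\<lambda>k. f (of_real r * cis \<theta>) - u (k + k0) \<theta>) \<longlonglongrightarrow> f (of_real r * cis \<theta>) - h \<theta>"
          using conv by eventually_elim (intro tendsto_diff tendsto_const LIMSEQ_ignore_initial_segment)
        have "0 \<le> r" using r R' by (simp add: R''_def)
        then show "(\<lambda>\<theta>. f (of_real r * cis \<theta>) - h \<theta>) \<in> borel_measurable borel"
          using r by (intro borel_measurable_diff measurable_holomorphic_circle f) auto
      qed simp
      then show ?thesis by simp
    qed
    moreover have "0 \<le> R''" "R'' < 1" using R' \<rho> by (auto simp: R''_def)
    ultimately show "\<exists>R. 0 \<le> R \<and> R < 1 \<and> (\<forall>r. R \<le> r \<and> r < 1 \<longrightarrow> Lp_le 1 (\<lambda>\<theta>. f (of_real r * cis \<theta>) - h \<theta>) e)"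
      by blast
  qed
qed

section \<open>Radial limits\<close>

lemma norm_cis_minus_real: "(norm (cis t - of_real r))\<^sup>2 = (1 - r)\<^sup>2 + 2 * r * (1 - cos t)"
proof -
  have "(norm (cis t - of_real r))\<^sup>2 = (cos t)\<^sup>2 + (sin t)\<^sup>2 - 2 * r * cos t + r\<^sup>2"
    unfolding cmod_power2 by (simp add: power2_eq_square algebra_simps)
  then show ?thesis by (simp add: power2_eq_square algebra_simps)
qed

lemma Poisson_kernel_even: "Poisson_kernel r (- t) = Poisson_kernel r t"
  by (simp add: Poisson_kernel_def norm_cis_minus_real)

lemma Poisson_kernel_deriv:
  assumes "0 \<le> r" "r < 1"
  shows "(Poisson_kernel r has_real_derivative
    - (1 - r\<^sup>2) * (2 * r * sin t) / ((1 - r)\<^sup>2 + 2 * r * (1 - cos t))\<^sup>2) (at t)"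
proof -
  have "(1 - r)\<^sup>2 + 2 * r * (1 - cos t) \<noteq> 0"
    using cis_neq_real[OF assms, of t] norm_cis_minus_real[of t r] by (metis norm_eq_zero power2_eq_iff_nonneg power_zero_numeral right_minus_eq zero_eq_power2)
  then have "((\<lambda>t. (1 - r\<^sup>2) / ((1 - r)\<^sup>2 + 2 * r * (1 - cos t))) has_real_derivative
    - (1 - r\<^sup>2) * (2 * r * sin t) / ((1 - r)\<^sup>2 + 2 * r * (1 - cos t))\<^sup>2) (at t)"
    by (auto intro!: derivative_eq_intros simp: power2_eq_square minus_divide_left algebra_simps)
  then show ?thesis by (simp add: Poisson_kernel_def[abs_def] norm_cis_minus_real)
qed

lemma integral_Poisson_kernel_le:
  assumes r: "0 \<le> r" "r < 1"
  shows "integral {0..pi} (Poisson_kernel r) \<le> 2 * pi"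
proof -
  have cont: "continuous_on UNIV (\<lambda>t. complex_of_real (Poisson_kernel r t))"
    by (intro continuous_intros continuous_on_Poisson_kernel r)
  have "integral {-pi..pi} (\<lambda>t. complex_of_real (Poisson_kernel r t)) / (2 * pi) = 1"
    using integral_circ_continuous(1)[OF cont] Poisson_formula[of "\<lambda>_. 1" r 0] r by (simp add: scaleR_conv_of_real)
  moreover have int: "Poisson_kernel r integrable_on {a..b}" for a b
    by (intro integrable_continuous_interval continuous_on_Poisson_kernel r)
  moreover have "integral {-pi..pi} (\<lambda>t. complex_of_real (Poisson_kernel r t)) = of_real (integral {-pi..pi} (Poisson_kernel r))"
    using integral_linear[OF int bounded_linear_of_real, of "-pi" pi] by (simp add: o_def)
  ultimately have "complex_of_real (integral {-pi..pi} (Poisson_kernel r)) = of_real (2 * pi)"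
    by (simp add: field_simps)
  then have "integral {-pi..pi} (Poisson_kernel r) = 2 * pi" by (simp only: of_real_eq_iff)
  moreover have "integral {0..pi} (Poisson_kernel r) \<le> integral {-pi..pi} (Poisson_kernel r)"
    using Poisson_kernel_pos[OF r] by (intro integral_subset_le int) (auto intro: less_imp_le)
  ultimately show ?thesis by simp
qed

text \<open>Both integrals are integrated by parts. As \<open>- P'\<close> is nonnegative, it suffices to compare the primitive of \<open>u\<close>
  with the primitive \<open>V\<close> of \<open>v\<close>; the value \<open>V 0\<close> appears as a boundary term.\<close>

lemma integral_decreasing_weight_bound:
  fixes P v :: "real \<Rightarrow> real" and u :: "real \<Rightarrow> complex"
  assumes b: "0 \<le> b" and P: "\<And>t. (P has_real_derivative P' t) (at t)" and P': "continuous_on {0..b} P'"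
    and dec: "\<And>t. t \<in> {0..b} \<Longrightarrow> P' t \<le> 0" and pos: "0 \<le> P b"
    and u: "continuous_on {0..b} u" and v: "continuous_on {0..b} v"
    and V: "\<And>t. (V has_real_derivative v t) (at t)"
    and bound: "\<And>t. t \<in> {0..b} \<Longrightarrow> norm (integral {0..t} u) \<le> V t"
  shows "norm (integral {0..b} (\<lambda>t. P t *\<^sub>R u t)) \<le> integral {0..b} (\<lambda>t. P t * v t) + P 0 * V 0"
proof -
  define U where "U t = integral {0..t} u" for t
  have contP: "continuous_on {0..b} P" using P by (meson DERIV_isCont continuous_at_imp_continuous_on)
  have contV: "continuous_on {0..b} V" using V by (meson DERIV_isCont continuous_at_imp_continuous_on)
  have dU: "(U has_vector_derivative u t) (at t within {0..b})" if "t \<in> {0..b}" for t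
    unfolding U_def[abs_def] by (rule integral_has_vector_derivative[OF u that])
  have contU: "continuous_on {0..b} U"
    using has_vector_derivative_continuous[OF dU] by (auto simp: continuous_on_eq_continuous_within)
  have *: "((\<lambda>t. P t *\<^sub>R u t + P' t *\<^sub>R U t) has_integral P b *\<^sub>R U b - P 0 *\<^sub>R U 0) {0..b}"
    using b dU P by (intro fundamental_theorem_of_calculus)
      (auto intro!: has_vector_derivative_scaleR intro: has_field_derivative_at_within)
  have 1: "integral {0..b} (\<lambda>t. P t *\<^sub>R u t) + integral {0..b} (\<lambda>t. P' t *\<^sub>R U t) = P b *\<^sub>R U b"
  proof -
    have "integral {0..b} (\<lambda>t. P t *\<^sub>R u t + P' t *\<^sub>R U t)
        = integral {0..b} (\<lambda>t. P t *\<^sub>R u t) + integral {0..b} (\<lambda>t. P' t *\<^sub>R U t)"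
      by (intro Henstock_Kurzweil_Integration.integral_add integrable_continuous_interval continuous_intros contP P' u contU)
    moreover have "U 0 = 0" by (simp add: U_def)
    ultimately show ?thesis using integral_unique[OF *] by simp
  qed
  have **: "((\<lambda>t. P t * v t + P' t * V t) has_integral P b * V b - P 0 * V 0) {0..b}"
  proof (rule fundamental_theorem_of_calculus[OF b])
    fix t
    have "((\<lambda>t. P t * V t) has_real_derivative P t * v t + P' t * V t) (at t)"
      using DERIV_mult[OF P V, of t] by (simp add: algebra_simps)
    then have "((\<lambda>t. P t * V t) has_real_derivative P t * v t + P' t * V t) (at t within {0..b})"
      by (rule has_field_derivative_at_within)
    then show "((\<lambda>t. P t * V t) has_vector_derivative P t * v t + P' t * V t) (at t within {0..b})"
      by (simp add: has_real_derivative_iff_has_vector_derivative)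
  qed
  have 2: "integral {0..b} (\<lambda>t. P t * v t) + integral {0..b} (\<lambda>t. P' t * V t) = P b * V b - P 0 * V 0"
  proof -
    have "integral {0..b} (\<lambda>t. P t * v t + P' t * V t)
        = integral {0..b} (\<lambda>t. P t * v t) + integral {0..b} (\<lambda>t. P' t * V t)"
      by (intro Henstock_Kurzweil_Integration.integral_add integrable_continuous_interval continuous_intros contP P' v contV)
    then show ?thesis using integral_unique[OF **] by simp
  qed
  have "norm (integral {0..b} (\<lambda>t. P' t *\<^sub>R U t)) \<le> integral {0..b} (\<lambda>t. - P' t * V t)"
  proof (rule integral_norm_bound_integral)
    show "norm (P' t *\<^sub>R U t) \<le> - P' t * V t" if "t \<in> {0..b}" for t
      using dec[OF that] mult_left_mono[OF bound[OF that], of "- P' t"] by (simp add: U_def)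
  qed (use P' contU contV in \<open>auto intro!: integrable_continuous_interval continuous_intros\<close>)
  also have "\<dots> = - integral {0..b} (\<lambda>t. P' t * V t)" by simp
  finally have 3: "norm (integral {0..b} (\<lambda>t. P' t *\<^sub>R U t)) \<le> - integral {0..b} (\<lambda>t. P' t * V t)" .
  have "norm (integral {0..b} (\<lambda>t. P t *\<^sub>R u t)) = norm (P b *\<^sub>R U b - integral {0..b} (\<lambda>t. P' t *\<^sub>R U t))"
    unfolding 1[symmetric] by simp
  also have "\<dots> \<le> norm (P b *\<^sub>R U b) + norm (integral {0..b} (\<lambda>t. P' t *\<^sub>R U t))"
    by (rule norm_triangle_ineq4)
  also have "norm (P b *\<^sub>R U b) \<le> P b * V b"
    using pos bound[of b] b by (auto simp: U_def intro: mult_left_mono)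
  finally show ?thesis using 2 3 by linarith
qed

lemma Lp_le_1_interval_integral:
  assumes k: "Lp_le 1 k A" and t: "0 \<le> t" "t \<le> pi"
  shows "set_integrable lborel {0..t} k" "norm (LBINT x:{0..t}. k x) \<le> 2 * pi * A"
proof -
  note [measurable] = Lp_leD(1)[OF k]
  have "(\<integral>\<^sup>+x. norm (indicator {0..t} x *\<^sub>R k x) \<partial>lborel)
      \<le> (\<integral>\<^sup>+x. ennreal (2 * pi) * (ennreal (indicator {-pi..pi} x / (2 * pi)) * ennreal (norm (k x))) \<partial>lborel)"
    using t by (intro nn_integral_mono) (auto split: split_indicator simp flip: ennreal_mult)
  also have "\<dots> = ennreal (2 * pi) * (\<integral>\<^sup>+x. norm (k x) \<partial>circ)"
    by (subst nn_integral_cmult) (auto simp: nn_integral_circ)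
  also have "\<dots> \<le> ennreal (2 * pi) * ennreal A"
    using Lp_leD[OF k] by (intro mult_left_mono) auto
  also have "\<dots> = ennreal (2 * pi * A)" using Lp_leD(2)[OF k] by (simp flip: ennreal_mult)
  finally have *: "(\<integral>\<^sup>+x. norm (indicator {0..t} x *\<^sub>R k x) \<partial>lborel) \<le> ennreal (2 * pi * A)" .
  show int: "set_integrable lborel {0..t} k"
    unfolding set_integrable_def by (intro integrableI_bounded) (use * in \<open>auto intro: le_less_trans\<close>)
  have "ennreal (norm (LBINT x:{0..t}. k x)) \<le> ennreal (2 * pi * A)"
    unfolding set_lebesgue_integral_def
    by (rule order_trans[OF integral_norm_bound_ennreal[OF int[unfolded set_integrable_def]] *])
  then show "norm (LBINT x:{0..t}. k x) \<le> 2 * pi * A"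
    using Lp_leD(2)[OF k] by (subst (asm) ennreal_le_iff) auto
qed

lemma x_minus_sin_mono:
  assumes "a \<le> b"
  shows "a - sin a \<le> b - sin (b::real)"
proof -
  have "\<exists>y. ((\<lambda>x. x - sin x) has_real_derivative y) (at x) \<and> 0 \<le> y" for x
    by (intro exI[of _ "1 - cos x"]) (auto intro!: derivative_eq_intros)
  then show ?thesis using DERIV_nonneg_imp_nondecreasing[OF assms, of "\<lambda>x. x - sin x"] by blast
qed

lemma x_minus_sin_pos:
  assumes "0 < x" "x \<le> pi"
  shows "0 < x - sin (x::real)"
proof -
  have "sin x = 2 * sin (x / 2) * cos (x / 2)" using sin_double[of "x / 2"] by simp
  also have "\<dots> \<le> x * cos (x / 2)"
    using sin_x_le_x[of "x / 2"] assms by (intro mult_right_mono cos_ge_zero) auto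
  also have "\<dots> < x"
    using cos_monotone_0_pi[of 0 "x / 2"] assms by simp
  finally show ?thesis by simp
qed

text \<open>The primitive of \<open>v\<close> is at most \<open>\<epsilon> * t\<close> near \<open>0\<close> and bounded elsewhere, hence at most
  \<open>\<epsilon> * t + C * (t - sin t)\<close>. The second term is chosen for its derivative \<open>C * (1 - cos t)\<close>: the factor \<open>1 - cos t\<close>
  occurs in the denominator of the Poisson kernel, so that their product is at most a multiple of \<open>1 - r\<close>. The
  passage from \<open>v\<close> to \<open>u s\<close> costs a constant \<open>2 * pi * \<eta>\<close>, which is small only once \<open>s\<close> is chosen after \<open>r\<close>.\<close>

lemma Poisson_half_average_small:
  fixes u :: "real \<Rightarrow> real \<Rightarrow> complex"
  assumes u: "\<And>s. 0 \<le> s \<Longrightarrow> s < 1 \<Longrightarrow> continuous_on UNIV (u s)" and v: "Lp_le 1 v A"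
    and conv: "\<And>e. 0 < e \<Longrightarrow> \<exists>R. 0 \<le> R \<and> R < 1 \<and> (\<forall>s. R \<le> s \<and> s < 1 \<longrightarrow> Lp_le 1 (\<lambda>t. u s t - v t) e)"
    and small: "\<And>e. 0 < e \<Longrightarrow> \<exists>d>0. \<forall>t. 0 < t \<and> t < d \<longrightarrow> norm (LBINT x:{0..t}. v x) \<le> e * t"
    and e: "0 < e"
  shows "\<exists>\<rho>. 0 \<le> \<rho> \<and> \<rho> < 1 \<and> (\<forall>r. \<rho> < r \<and> r < 1 \<longrightarrow>
    (\<exists>R. 0 \<le> R \<and> R < 1 \<and> (\<forall>s. R \<le> s \<and> s < 1 \<longrightarrow>
      norm (integral {0..pi} (\<lambda>t. Poisson_kernel r t *\<^sub>R u s t)) \<le> e)))"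
proof -
  define \<epsilon> where "\<epsilon> = e / (6 * pi)"
  have \<epsilon>: "0 < \<epsilon>" using e by (simp add: \<epsilon>_def)
  obtain d0 where d0: "0 < d0" "\<And>t. 0 < t \<Longrightarrow> t < d0 \<Longrightarrow> norm (LBINT x:{0..t}. v x) \<le> \<epsilon> * t"
    using small[OF \<epsilon>] by blast
  define d where "d = min (d0 / 2) pi"
  have d: "0 < d" "d \<le> pi" "d < d0" using d0 by (auto simp: d_def)
  \<comment> \<open>with this constant \<open>C * (t - sin t)\<close> reaches the global bound \<open>2 * pi * A\<close> at \<open>t = d\<close>\<close>
  define C where "C = 2 * pi * A / (d - sin d)"
  have A0: "0 \<le> A" by (rule Lp_leD(2)[OF v])
  have C: "0 \<le> C" using x_minus_sin_pos[OF d(1,2)] A0 by (simp add: C_def)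
  have v_bound: "norm (LBINT x:{0..t}. v x) \<le> \<epsilon> * t + C * (t - sin t)" if t: "0 \<le> t" "t \<le> pi" for t
  proof (cases "t \<le> d")
    case True
    have "0 \<le> C * (t - sin t)" using sin_x_le_x[OF t(1)] C by simp
    moreover have "norm (LBINT x:{0..t}. v x) \<le> \<epsilon> * t"
    proof (cases "t = 0")
      case True
      have "AE x in lborel. x \<noteq> (0::real)" by (rule AE_lborel_singleton)
      then have "AE x in lborel. indicator {0..t} x *\<^sub>R v x = 0"
        by eventually_elim (use True in \<open>auto split: split_indicator\<close>)
      then have "(LBINT x:{0..t}. v x) = 0"
        unfolding set_lebesgue_integral_def by (rule integral_eq_zero_AE)
      then show ?thesis using True by simp
    qed (use t d0(2)[of t] d \<open>t \<le> d\<close> in auto)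
    ultimately show ?thesis by simp
  next
    case False
    have "norm (LBINT x:{0..t}. v x) \<le> 2 * pi * A" by (rule Lp_le_1_interval_integral(2)[OF v t])
    also have "\<dots> = C * (d - sin d)" using x_minus_sin_pos[OF d(1,2)] by (simp add: C_def)
    also have "\<dots> \<le> C * (t - sin t)" using False C by (intro mult_left_mono x_minus_sin_mono) auto
    finally show ?thesis using \<epsilon> t by (simp add: add_increasing)
  qed
  define \<rho> where "\<rho> = max (1 / 2) (1 - e / (6 * pi * (C + 1)))"
  have "0 < e / (6 * pi * (C + 1))" using e C by (intro divide_pos_pos mult_pos_pos) auto
  then have \<rho>: "0 \<le> \<rho>" "\<rho> < 1" by (auto simp: \<rho>_def)
  have "\<exists>R. 0 \<le> R \<and> R < 1 \<and> (\<forall>s. R \<le> s \<and> s < 1 \<longrightarrow>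
      norm (integral {0..pi} (\<lambda>t. Poisson_kernel r t *\<^sub>R u s t)) \<le> e)" if r: "\<rho> < r" "r < 1" for r
  proof -
    have r0: "1 / 2 < r" "0 \<le> r" using r by (auto simp: \<rho>_def)
    note P_pos = Poisson_kernel_pos[OF r0(2) r(2)]
    define \<eta> where "\<eta> = e / (6 * pi * Poisson_kernel r 0)"
    have \<eta>: "0 < \<eta>" using e P_pos[of 0] by (simp add: \<eta>_def)
    obtain R where R: "0 \<le> R" "R < 1" "\<And>s. R \<le> s \<Longrightarrow> s < 1 \<Longrightarrow> Lp_le 1 (\<lambda>t. u s t - v t) \<eta>"
      using conv[OF \<eta>] by blast
    have "norm (integral {0..pi} (\<lambda>t. Poisson_kernel r t *\<^sub>R u s t)) \<le> e" if s: "R \<le> s" "s < 1" for s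
    proof -
      have us: "continuous_on {0..t} (u s)" for t
        by (rule continuous_on_subset[OF u]) (use s R in auto)
      define V where "V t = \<epsilon> * t + C * (t - sin t) + 2 * pi * \<eta>" for t
      have "norm (integral {0..t} (u s)) \<le> V t" if t: "t \<in> {0..pi}" for t
      proof -
        have int_u: "set_integrable lborel {0..t} (u s)" by (rule borel_integrable_atLeastAtMost'[OF us])
        have int_v: "set_integrable lborel {0..t} v" using t by (intro Lp_le_1_interval_integral[OF v]) auto
        have "integral {0..t} (u s) = (LBINT x:{0..t}. u s x)"
          by (simp add: set_borel_integral_eq_integral[OF int_u])
        also have "\<dots> = (LBINT x:{0..t}. v x) + (LBINT x:{0..t}. u s x - v x)"
          by (simp add: set_integral_diff[OF int_u int_v])
        also have "norm \<dots> \<le> (\<epsilon> * t + C * (t - sin t)) + 2 * pi * \<eta>"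
          using t by (intro order_trans[OF norm_triangle_ineq] add_mono v_bound
              Lp_le_1_interval_integral(2)[OF R(3)[OF s]]) auto
        finally show ?thesis by (simp add: V_def)
      qed
      then have "norm (integral {0..pi} (\<lambda>t. Poisson_kernel r t *\<^sub>R u s t))
          \<le> integral {0..pi} (\<lambda>t. Poisson_kernel r t * (\<epsilon> + C * (1 - cos t))) + Poisson_kernel r 0 * V 0"
      proof (rule integral_decreasing_weight_bound[rotated -1])
        show "(Poisson_kernel r has_real_derivative
            - (1 - r\<^sup>2) * (2 * r * sin t) / ((1 - r)\<^sup>2 + 2 * r * (1 - cos t))\<^sup>2) (at t)" for t
          by (rule Poisson_kernel_deriv[OF r0(2) r(2)])
        have nz: "(1 - r)\<^sup>2 + 2 * r * (1 - cos t) > 0" for t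
          using r r0 by (intro add_pos_nonneg) auto
        show "continuous_on {0..pi} (\<lambda>t. - (1 - r\<^sup>2) * (2 * r * sin t) / ((1 - r)\<^sup>2 + 2 * r * (1 - cos t))\<^sup>2)"
          using nz by (intro continuous_intros) (auto simp: less_le)
        show "- (1 - r\<^sup>2) * (2 * r * sin t) / ((1 - r)\<^sup>2 + 2 * r * (1 - cos t))\<^sup>2 \<le> 0" if "t \<in> {0..pi}" for t
          using that r r0 by (intro divide_nonpos_nonneg mult_nonpos_nonneg) (auto simp: power_le_one_iff sin_ge_zero)
        show "(V has_real_derivative \<epsilon> + C * (1 - cos t)) (at t)" for t
          unfolding V_def by (auto intro!: derivative_eq_intros)
      qed (use P_pos us in \<open>auto intro!: continuous_intros less_imp_le\<close>)
      also have "integral {0..pi} (\<lambda>t. Poisson_kernel r t * (\<epsilon> + C * (1 - cos t)))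
          \<le> integral {0..pi} (\<lambda>t. \<epsilon> * Poisson_kernel r t + C * (2 * (1 - r)))"
      proof (rule integral_le)
        fix t :: real
        have "Poisson_kernel r t * (1 - cos t) \<le> 2 * (1 - r)"
        proof (cases "cos t = 1")
          case False
          then have c: "0 < 1 - cos t" using cos_le_one[of t] by linarith
          then have "(1 - r\<^sup>2) / (norm (cis t - of_real r))\<^sup>2 \<le> (1 - r\<^sup>2) / (2 * r * (1 - cos t))"
            unfolding norm_cis_minus_real using r r0
            by (intro divide_left_mono mult_pos_pos add_nonneg_pos) (auto simp: power_le_one_iff)
          then have "Poisson_kernel r t * (1 - cos t) \<le> (1 - r\<^sup>2) / (2 * r * (1 - cos t)) * (1 - cos t)"
            unfolding Poisson_kernel_def using c by (intro mult_right_mono) auto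
          also have "\<dots> = (1 - r\<^sup>2) / (2 * r)" using c by simp
          also have "\<dots> \<le> (1 - r\<^sup>2) / 1" using r r0 by (intro divide_left_mono) (auto simp: power_le_one_iff)
          also have "\<dots> = (1 - r) * (1 + r)" by (simp add: power2_eq_square algebra_simps)
          also have "\<dots> \<le> (1 - r) * 2" using r by (intro mult_left_mono) auto
          finally show ?thesis by simp
        qed (use r in simp)
        then have "C * (Poisson_kernel r t * (1 - cos t)) \<le> C * (2 * (1 - r))"
          by (intro mult_left_mono C)
        then show "Poisson_kernel r t * (\<epsilon> + C * (1 - cos t)) \<le> \<epsilon> * Poisson_kernel r t + C * (2 * (1 - r))"
          by (simp add: algebra_simps)
      qed (use r r0 in \<open>auto intro!: integrable_continuous_interval continuous_intros continuous_on_Poisson_kernel\<close>)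
      also have "\<dots> = \<epsilon> * integral {0..pi} (Poisson_kernel r) + C * (2 * (1 - r)) * pi"
      proof -
        have "integral {0..pi} (\<lambda>t. \<epsilon> * Poisson_kernel r t + C * (2 * (1 - r)))
            = integral {0..pi} (\<lambda>t. \<epsilon> * Poisson_kernel r t) + integral {0..pi} (\<lambda>t. C * (2 * (1 - r)))"
          by (intro Henstock_Kurzweil_Integration.integral_add integrable_continuous_interval continuous_intros
              continuous_on_Poisson_kernel r0 r)
        then show ?thesis by simp
      qed
      also have "\<dots> \<le> \<epsilon> * (2 * pi) + e / 3"
      proof (intro add_mono mult_left_mono integral_Poisson_kernel_le)
        have "1 - r \<le> e / (6 * pi * (C + 1))" using r by (auto simp: \<rho>_def)
        then have "2 * pi * (C + 1) * (1 - r) \<le> 2 * pi * (C + 1) * (e / (6 * pi * (C + 1)))"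
          using C by (intro mult_left_mono) auto
        also have "\<dots> = e / 3"
        proof -
          have "2 * pi * D * (e / (6 * pi * D)) = e / 3" if "D \<noteq> 0" for D
            using that by simp
          then show ?thesis using C by (metis add_nonneg_eq_0_iff zero_le_one zero_neq_one)
        qed
        finally have "2 * pi * (C + 1) * (1 - r) \<le> e / 3" .
        moreover have "C * (2 * (1 - r)) * pi \<le> 2 * pi * (C + 1) * (1 - r)"
          using r by (simp add: algebra_simps)
        ultimately show "C * (2 * (1 - r)) * pi \<le> e / 3" by linarith
      qed (use \<epsilon> r r0 in auto)
      also have "Poisson_kernel r 0 * V 0 = e / 3"
        using P_pos[of 0] by (simp add: V_def \<eta>_def)
      also have "\<epsilon> * (2 * pi) + e / 3 + e / 3 = e" by (simp add: \<epsilon>_def)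
      finally show ?thesis by simp
    qed
    then show ?thesis using R by blast
  qed
  then show ?thesis using \<rho> by blast
qed

lemma Lp_le_reflect:
  assumes h: "Lp_le p h A"
  shows "Lp_le p (\<lambda>\<theta>. h (- \<theta>)) A"
proof -
  note [measurable] = Lp_leD(1)[OF h]
  have "(\<integral>\<^sup>+\<theta>. norm (h (- \<theta>)) powr p \<partial>circ)
      = (\<integral>\<^sup>+\<theta>. ennreal (indicator {-pi..pi} \<theta> / (2 * pi)) * ennreal (norm (h (- \<theta>)) powr p) \<partial>lborel)"
    by (subst nn_integral_circ) auto
  also have "\<dots> = (\<integral>\<^sup>+\<theta>. ennreal (indicator {-pi..pi} (0 + (-1) * \<theta>) / (2 * pi)) * ennreal (norm (h (- (0 + (-1) * \<theta>))) powr p) \<partial>lborel)"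
    by (subst nn_integral_real_affine[of _ "-1" 0]) auto
  also have "\<dots> = (\<integral>\<^sup>+\<theta>. ennreal (indicator {-pi..pi} \<theta> / (2 * pi)) * ennreal (norm (h \<theta>) powr p) \<partial>lborel)"
    by (intro nn_integral_cong) (auto split: split_indicator)
  also have "\<dots> = (\<integral>\<^sup>+\<theta>. norm (h \<theta>) powr p \<partial>circ)"
    by (subst nn_integral_circ) auto
  finally show ?thesis using h by (simp add: Lp_le_def)
qed

text \<open>Fatou's theorem. After subtracting \<open>h \<theta>\<close> the Poisson integral at \<open>\<theta>\<close> is split into its two halves, each of
  which is an average of a function with small primitive. Since \<open>h\<close> itself need not be continuous, the formula is
  applied to \<open>f\<close> on the circle of radius \<open>s\<close>, and \<open>s\<close> tends to \<open>1\<close> at the end.\<close>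

lemma radial_limit_at_differentiable_point:
  assumes f: "f holomorphic_on ball 0 1" and per: "\<And>\<theta>. h (\<theta> + 2 * pi) = h \<theta>" and hA: "Lp_le 1 h A"
    and conv: "\<And>e. 0 < e \<Longrightarrow> \<exists>R. 0 \<le> R \<and> R < 1 \<and> (\<forall>r. R \<le> r \<and> r < 1 \<longrightarrow> Lp_le 1 (\<lambda>\<theta>. f (of_real r * cis \<theta>) - h \<theta>) e)"
    and right: "\<And>e. 0 < e \<Longrightarrow> \<exists>d>0. \<forall>t. 0 < t \<and> t < d \<longrightarrow> norm (LBINT x:{0..t}. h (\<theta> + x) - h \<theta>) \<le> e * t"
    and left: "\<And>e. 0 < e \<Longrightarrow> \<exists>d>0. \<forall>t. 0 < t \<and> t < d \<longrightarrow> norm (LBINT x:{0..t}. h (\<theta> - x) - h \<theta>) \<le> e * t"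
  shows "((\<lambda>r. f (of_real r * cis \<theta>)) \<longlongrightarrow> h \<theta>) (at_left 1)"
proof -
  define c where "c = h \<theta>"
  have cB: "Lp_le 1 (\<lambda>_. c) (norm c)" by (intro Lp_le_bounded) auto
  define u where "u \<sigma> s t = f (of_real s * cis (\<theta> + \<sigma> * t)) - c" for \<sigma> s t
  have contu: "continuous_on UNIV (u \<sigma> s)" if "0 \<le> s" "s < 1" for \<sigma> s
  proof -
    have "continuous_on UNIV (\<lambda>t. \<theta> + \<sigma> * t)" by (intro continuous_intros)
    from continuous_on_compose2[OF continuous_on_holomorphic_circle[OF f that] this] show ?thesis
      unfolding u_def by (intro continuous_on_diff continuous_on_const) auto
  qed
  have tr: "Lp_le 1 (\<lambda>t. k (\<theta> + \<sigma> * t)) B"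
    if k: "Lp_le 1 k B" "\<And>x. k (x + 2 * pi) = k x" and \<sigma>: "\<sigma> = 1 \<or> \<sigma> = - 1" for k B \<sigma>
  proof -
    have *: "Lp_le 1 (\<lambda>t. k (\<theta> + t)) B"
      using Lp_le_translate[OF k, of \<theta>] unfolding add.commute[of _ \<theta>] .
    have "Lp_le 1 (\<lambda>t. k (\<theta> - t)) B" using Lp_le_reflect[OF *] by simp
    with * show ?thesis using \<sigma> by auto
  qed
  have half: "\<exists>\<rho>. 0 \<le> \<rho> \<and> \<rho> < 1 \<and> (\<forall>r. \<rho> < r \<and> r < 1 \<longrightarrow> (\<exists>R. 0 \<le> R \<and> R < 1 \<and> (\<forall>s. R \<le> s \<and> s < 1 \<longrightarrow>
      norm (integral {0..pi} (\<lambda>t. Poisson_kernel r t *\<^sub>R u \<sigma> s t)) \<le> e)))"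
    if e: "0 < e" and \<sigma>: "\<sigma> = 1 \<or> \<sigma> = - 1" for e \<sigma>
  proof (rule Poisson_half_average_small[OF _ _ _ _ e])
    show "Lp_le 1 (\<lambda>t. h (\<theta> + \<sigma> * t) - c) (A + norm c)"
      by (rule Lp_le_diff[OF tr[OF hA per \<sigma>] cB]) simp
    show "continuous_on UNIV (u \<sigma> s)" if "0 \<le> s" "s < 1" for s
      by (rule contu[OF that])
    fix e :: real assume e: "0 < e"
    show "\<exists>d>0. \<forall>t. 0 < t \<and> t < d \<longrightarrow> norm (LBINT x:{0..t}. h (\<theta> + \<sigma> * x) - c) \<le> e * t"
      using right[OF e] left[OF e] \<sigma> by (auto simp: c_def)
    obtain R where R: "0 \<le> R" "R < 1" "\<And>r. R \<le> r \<Longrightarrow> r < 1 \<Longrightarrow> Lp_le 1 (\<lambda>\<theta>. f (of_real r * cis \<theta>) - h \<theta>) e"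
      using conv[OF e] by blast
    have "Lp_le 1 (\<lambda>t. u \<sigma> s t - (h (\<theta> + \<sigma> * t) - c)) e" if "R \<le> s" "s < 1" for s
      using tr[OF R(3)[OF that] _ \<sigma>] by (simp add: u_def per cis_mult[symmetric])
    then show "\<exists>R. 0 \<le> R \<and> R < 1 \<and> (\<forall>s. R \<le> s \<and> s < 1 \<longrightarrow> Lp_le 1 (\<lambda>t. u \<sigma> s t - (h (\<theta> + \<sigma> * t) - c)) e)"
      using R by blast
  qed
  have Poisson_split: "f (of_real (r * s) * cis \<theta>) - c
      = (integral {0..pi} (\<lambda>t. Poisson_kernel r t *\<^sub>R u 1 s t) + integral {0..pi} (\<lambda>t. Poisson_kernel r t *\<^sub>R u (- 1) s t)) / (2 * pi)"
    if r: "0 \<le> r" "r < 1" and s: "0 \<le> s" "s < 1" for r s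
  proof -
    define F where "F t = Poisson_kernel r t *\<^sub>R u 1 s t" for t
    have contF: "continuous_on UNIV F" unfolding F_def
      by (intro continuous_intros continuous_on_Poisson_kernel r contu s)
    have F_int: "F integrable_on {a..b}" for a b
      by (intro integrable_continuous_interval continuous_on_subset[OF contF]) auto
    have "f (of_real s * (of_real r * cis \<theta>)) - c = (LINT t|circ. F t)"
      using Poisson_formula[of "\<lambda>z. f (of_real s * z) - c" r \<theta>] scaled_disc[OF f s] r
      by (simp add: F_def u_def continuous_intros holomorphic_intros)
    also have "\<dots> = integral {-pi..pi} F / (2 * pi)" by (rule integral_circ_continuous(1)[OF contF])
    also have "integral {-pi..pi} F = integral {-pi..0} F + integral {0..pi} F"
      using F_int by (intro Henstock_Kurzweil_Integration.integral_combine[symmetric]) auto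
    also have "integral {-pi..0} F = integral {0..pi} (\<lambda>t. F (- t))"
      using Henstock_Kurzweil_Integration.integral_reflect_real[where a = 0 and b = pi and f = "\<lambda>t. F (- t)"] by simp
    also have "(\<lambda>t. F (- t)) = (\<lambda>t. Poisson_kernel r t *\<^sub>R u (- 1) s t)"
      by (simp add: F_def u_def Poisson_kernel_even)
    finally show ?thesis by (simp add: F_def ac_simps)
  qed
  have "\<forall>\<^sub>F r in at_left 1. dist (f (of_real r * cis \<theta>)) c < e" if e: "0 < e" for e
  proof -
    obtain \<rho>1 where \<rho>1: "0 \<le> \<rho>1" "\<rho>1 < 1" "\<And>r. \<rho>1 < r \<Longrightarrow> r < 1 \<Longrightarrow> \<exists>R. 0 \<le> R \<and> R < 1 \<and> (\<forall>s. R \<le> s \<and> s < 1 \<longrightarrow>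
      norm (integral {0..pi} (\<lambda>t. Poisson_kernel r t *\<^sub>R u 1 s t)) \<le> e)"
      using half[OF e, of 1] by blast
    obtain \<rho>2 where \<rho>2: "0 \<le> \<rho>2" "\<rho>2 < 1" "\<And>r. \<rho>2 < r \<Longrightarrow> r < 1 \<Longrightarrow> \<exists>R. 0 \<le> R \<and> R < 1 \<and> (\<forall>s. R \<le> s \<and> s < 1 \<longrightarrow>
      norm (integral {0..pi} (\<lambda>t. Poisson_kernel r t *\<^sub>R u (- 1) s t)) \<le> e)"
      using half[OF e, of "- 1"] by blast
    have "dist (f (of_real r * cis \<theta>)) c < e" if r: "max \<rho>1 \<rho>2 < r" "r < 1" for r
    proof -
      obtain R1 where R1: "R1 < 1" "\<And>s. R1 \<le> s \<Longrightarrow> s < 1 \<Longrightarrow> norm (integral {0..pi} (\<lambda>t. Poisson_kernel r t *\<^sub>R u 1 s t)) \<le> e"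
        using \<rho>1(3)[of r] r by auto
      obtain R2 where R2: "R2 < 1" "\<And>s. R2 \<le> s \<Longrightarrow> s < 1 \<Longrightarrow> norm (integral {0..pi} (\<lambda>t. Poisson_kernel r t *\<^sub>R u (- 1) s t)) \<le> e"
        using \<rho>2(3)[of r] r by auto
      have r0: "0 \<le> r" using r \<rho>1 by simp
      have near: "norm (f (of_real (r * s) * cis \<theta>) - c) \<le> (e + e) / (2 * pi)"
        if s: "max 0 (max R1 R2) < s" "s < 1" for s
      proof -
        have "norm (integral {0..pi} (\<lambda>t. Poisson_kernel r t *\<^sub>R u 1 s t) + integral {0..pi} (\<lambda>t. Poisson_kernel r t *\<^sub>R u (- 1) s t)) \<le> e + e"
          using s by (intro order_trans[OF norm_triangle_ineq] add_mono R1 R2) auto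
        from divide_right_mono[OF this, of "2 * pi"] show ?thesis
          using s r0 r by (subst Poisson_split) (auto simp: norm_divide norm_mult)
      qed
      have "((\<lambda>s. f (of_real (r * s) * cis \<theta>) - c) \<longlongrightarrow> f (of_real (r * 1) * cis \<theta>) - c) (at_left 1)"
      proof -
        have "isCont f (of_real (r * 1) * cis \<theta>)"
          using r r0 by (intro continuous_on_interior[OF holomorphic_on_imp_continuous_on[OF f]]) (auto simp: norm_mult)
        then show ?thesis by (intro tendsto_intros isCont_tendsto_compose[of _ f])
      qed
      moreover have "\<forall>\<^sub>F s in at_left 1. norm (f (of_real (r * s) * cis \<theta>) - c) \<le> (e + e) / (2 * pi)"
        unfolding eventually_at_left_field using R1(1) R2(1) near by (intro exI[of _ "max 0 (max R1 R2)"]) auto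
      ultimately have "norm (f (of_real r * cis \<theta>) - c) \<le> (e + e) / (2 * pi)"
        using Lim_norm_ubound[of "at_left (1::real)"] by fastforce
      also have "\<dots> = e / pi" by simp
      also have "\<dots> < e" using e pi_gt3 by (simp add: divide_less_eq)
      finally show ?thesis by (simp add: dist_norm)
    qed
    then show ?thesis
      unfolding eventually_at_left_field using \<rho>1 \<rho>2 by (intro exI[of _ "max \<rho>1 \<rho>2"]) auto
  qed
  then show ?thesis unfolding c_def by (rule tendstoI)
qed

lemma AE_Lebesgue_point_right:
  fixes k :: "real \<Rightarrow> complex"
  assumes k: "integrable lborel k"
  obtains N where "negligible N" "\<And>x e. x \<notin> N \<Longrightarrow> 0 < e \<Longrightarrow>
    \<exists>d>0. \<forall>t. 0 < t \<and> t < d \<longrightarrow> norm (LBINT y:{0..t}. k (x + y) - k x) \<le> e * t"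
proof -
  have int: "set_integrable lborel S k" if "S \<in> sets borel" for S
    using integrable_mult_indicator[OF _ k, of S] that by (simp add: set_integrable_def)
  have "k integrable_on cbox a b" for a b
    by (rule set_borel_integral_eq_integral(1)[OF int]) auto
  then obtain N where N: "negligible N"
    "\<And>x e. \<lbrakk>x \<notin> N; 0 < e\<rbrakk> \<Longrightarrow> \<exists>d>0. \<forall>h. 0 < h \<and> h < d \<longrightarrow>
        norm (integral (cbox x (x + h *\<^sub>R One)) k /\<^sub>R h ^ DIM(real) - k x) < e"
    using integrable_ccontinuous_explicit[of k] by metis
  have "\<exists>d>0. \<forall>t. 0 < t \<and> t < d \<longrightarrow> norm (LBINT y:{0..t}. k (x + y) - k x) \<le> e * t"
    if x: "x \<notin> N" "0 < e" for x e
  proof -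
    obtain d where d: "0 < d" "\<And>t. 0 < t \<Longrightarrow> t < d \<Longrightarrow>
        norm (integral (cbox x (x + t *\<^sub>R One)) k /\<^sub>R t ^ DIM(real) - k x) < e"
      using N(2)[OF x] by blast
    have "norm (LBINT y:{0..t}. k (x + y) - k x) \<le> e * t" if t: "0 < t" "t < d" for t
    proof -
      have shift: "indicator {x..x+t} (x + y) *\<^sub>R k (x + y) = indicator {0..t} y *\<^sub>R k (x + y)" for y
        by (auto split: split_indicator)
      have "(LBINT y:{x..x+t}. k y) = (LBINT y:{0..t}. k (x + y))"
        unfolding set_lebesgue_integral_def
        by (subst lborel_integral_real_affine[of 1 _ x]) (auto simp: shift)
      moreover have int_shift: "set_integrable lborel {0..t} (\<lambda>y. k (x + y))"
        using lborel_integrable_real_affine[OF int[of "{x..x+t}", unfolded set_integrable_def], of 1 x]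
        by (simp add: set_integrable_def shift)
      moreover have "(LBINT y:{x..x+t}. k y) = integral {x..x+t} k"
        by (rule set_borel_integral_eq_integral(2)[OF int]) auto
      ultimately have eq: "integral {x..x+t} k = (LBINT y:{0..t}. k (x + y))" by simp
      have "set_integrable lborel {0..t} (\<lambda>y. k x)"
        by (rule borel_integrable_atLeastAtMost') (intro continuous_intros)
      then have "(LBINT y:{0..t}. k (x + y) - k x) = (LBINT y:{0..t}. k (x + y)) - (LBINT y:{0..t}. k x)"
        by (rule set_integral_diff(2)[OF int_shift])
      also have "(LBINT y:{0..t}. k x) = t *\<^sub>R k x"
        using t by (simp add: set_lebesgue_integral_def)
      finally have "(LBINT y:{0..t}. k (x + y) - k x) = t *\<^sub>R (integral {x..x+t} k /\<^sub>R t - k x)"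
        using t by (simp add: eq scaleR_right_diff_distrib)
      then have "norm (LBINT y:{0..t}. k (x + y) - k x) = t * norm (integral {x..x+t} k /\<^sub>R t - k x)"
        using t by simp
      also have "\<dots> \<le> t * e" using d(2)[OF t] t by (intro mult_left_mono) auto
      finally show ?thesis by (simp add: mult.commute)
    qed
    then show ?thesis using d(1) by blast
  qed
  then show thesis using that N(1) by blast
qed

lemma AE_lborel_of_negligible: "negligible N \<Longrightarrow> AE x in lborel. x \<notin> N"
  using AE_not_in[of N lebesgue] by (simp add: negligible_iff_null_sets AE_completion_iff)

text \<open>Almost every point is a right-hand Lebesgue point both of \<open>h\<close> and, after reflection, of \<open>h (- x)\<close>, which gives the left-hand
  condition. Cutting \<open>h\<close> off outside one period makes it integrable on the line and affects only the end points.\<close>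

lemma AE_radial_limit:
  assumes f: "f holomorphic_on ball 0 1" and per: "\<And>\<theta>. h (\<theta> + 2 * pi) = h \<theta>" and hA: "Lp_le 1 h A"
    and conv: "\<And>e. 0 < e \<Longrightarrow> \<exists>R. 0 \<le> R \<and> R < 1 \<and> (\<forall>r. R \<le> r \<and> r < 1 \<longrightarrow> Lp_le 1 (\<lambda>\<theta>. f (of_real r * cis \<theta>) - h \<theta>) e)"
  shows "AE \<theta> in circ. ((\<lambda>r. f (of_real r * cis \<theta>)) \<longlongrightarrow> h \<theta>) (at_left 1)"
proof -
  define k where "k x = indicator {-pi..pi} x *\<^sub>R h x" for x
  have "integrable circ h"
    using Lp_leD(1,3)[OF hA] by (intro integrableI_bounded) (auto intro: le_less_trans)
  then have k: "integrable lborel k"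
    using integrable_circ_iff[OF Lp_leD(1)[OF hA]] by (simp add: k_def[abs_def] set_integrable_def)
  have k': "integrable lborel (\<lambda>x. k (- x))"
    using lborel_integrable_real_affine[OF k, of "-1" 0] by simp
  obtain N where N: "negligible N" "\<And>x e. x \<notin> N \<Longrightarrow> 0 < e \<Longrightarrow>
    \<exists>d>0. \<forall>t. 0 < t \<and> t < d \<longrightarrow> norm (LBINT y:{0..t}. k (x + y) - k x) \<le> e * t"
    using AE_Lebesgue_point_right[OF k] by metis
  obtain N' where N': "negligible N'" "\<And>x e. x \<notin> N' \<Longrightarrow> 0 < e \<Longrightarrow>
    \<exists>d>0. \<forall>t. 0 < t \<and> t < d \<longrightarrow> norm (LBINT y:{0..t}. k (- (x + y)) - k (- x)) \<le> e * t"
    using AE_Lebesgue_point_right[OF k'] by metis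
  have "negligible (uminus ` N')"
    by (rule negligible_differentiable_image_negligible[OF _ N'(1)])
       (auto intro!: differentiable_on_minus)
  then have "AE \<theta> in lborel. \<theta> \<notin> uminus ` N'" "AE \<theta> in lborel. \<theta> \<notin> N"
    using N(1) by (auto intro: AE_lborel_of_negligible)
  moreover have "AE \<theta> in lborel. \<theta> \<noteq> pi" "AE \<theta> in lborel. \<theta> \<noteq> - pi"
    by (rule AE_lborel_singleton)+
  ultimately have "AE \<theta> in lborel. \<theta> \<in> {-pi..pi} \<longrightarrow> ((\<lambda>r. f (of_real r * cis \<theta>)) \<longlongrightarrow> h \<theta>) (at_left 1)"
  proof eventually_elim
    case (elim \<theta>)
    show ?case
    proof
      assume "\<theta> \<in> {-pi..pi}"
      with elim have \<theta>: "-pi < \<theta>" "\<theta> < pi" by auto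
      have notN': "- \<theta> \<notin> N'" using elim by force
      show "((\<lambda>r. f (of_real r * cis \<theta>)) \<longlongrightarrow> h \<theta>) (at_left 1)"
      proof (rule radial_limit_at_differentiable_point[OF f per hA conv])
        fix e :: real assume e: "0 < e"
        have set_cong: "(LBINT x:{0..t}. a x) = (LBINT x:{0..t}. b x)"
          if "\<And>x. 0 \<le> x \<Longrightarrow> x \<le> t \<Longrightarrow> a x = b x" for a b :: "real \<Rightarrow> complex" and t
          unfolding set_lebesgue_integral_def using that
          by (intro Bochner_Integration.integral_cong) (auto split: split_indicator)
        obtain d where d: "0 < d" "\<And>t. 0 < t \<Longrightarrow> t < d \<Longrightarrow> norm (LBINT y:{0..t}. k (\<theta> + y) - k \<theta>) \<le> e * t"
          using N(2)[OF _ e, of \<theta>] elim by blast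
        show "\<exists>d>0. \<forall>t. 0 < t \<and> t < d \<longrightarrow> norm (LBINT x:{0..t}. h (\<theta> + x) - h \<theta>) \<le> e * t"
        proof (intro exI[of _ "min d (pi - \<theta>)"] conjI allI impI)
          fix t assume t: "0 < t \<and> t < min d (pi - \<theta>)"
          then have "(LBINT x:{0..t}. h (\<theta> + x) - h \<theta>) = (LBINT y:{0..t}. k (\<theta> + y) - k \<theta>)"
            using \<theta> by (intro set_cong) (auto simp: k_def)
          then show "norm (LBINT x:{0..t}. h (\<theta> + x) - h \<theta>) \<le> e * t" using d(2)[of t] t by simp
        qed (use d \<theta> in auto)
        obtain d' where d': "0 < d'" "\<And>t. 0 < t \<Longrightarrow> t < d' \<Longrightarrow> norm (LBINT y:{0..t}. k (- (- \<theta> + y)) - k (- (- \<theta>))) \<le> e * t"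
          using N'(2)[OF notN' e] by blast
        show "\<exists>d>0. \<forall>t. 0 < t \<and> t < d \<longrightarrow> norm (LBINT x:{0..t}. h (\<theta> - x) - h \<theta>) \<le> e * t"
        proof (intro exI[of _ "min d' (\<theta> + pi)"] conjI allI impI)
          fix t assume t: "0 < t \<and> t < min d' (\<theta> + pi)"
          then have "(LBINT x:{0..t}. h (\<theta> - x) - h \<theta>) = (LBINT y:{0..t}. k (- (- \<theta> + y)) - k (- (- \<theta>)))"
            using \<theta> by (intro set_cong) (auto simp: k_def)
          then show "norm (LBINT x:{0..t}. h (\<theta> - x) - h \<theta>) \<le> e * t" using d'(2)[of t] t by simp
        qed (use d' \<theta> in auto)
      qed
    qed
  qed
  then show ?thesis by (simp add: AE_circ_iff)
qed

text \<open>The exceptional null set is translated by all multiples of the period, so that it covers the exceptions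
  on the whole line.\<close>

lemma AE_circ_periodic_shift:
  assumes Q: "AE \<theta> in circ. Q \<theta>" and per: "\<And>\<theta>. Q (\<theta> + 2 * pi) = Q \<theta>"
  shows "AE \<theta> in circ. Q (\<theta> + t)"
proof -
  obtain N where N: "N \<in> null_sets lborel" "{\<theta>. \<not> (\<theta> \<in> {-pi..pi} \<longrightarrow> Q \<theta>)} \<subseteq> N"
    using Q unfolding AE_circ_iff by (auto elim!: AE_E simp: null_sets_def)
  have "AE \<theta> in lborel. \<forall>k::int. \<theta> + t + 2 * pi * of_int k \<notin> N"
  proof (subst AE_all_countable, rule allI)
    fix k :: int
    have "{\<theta>. \<theta> - (- t - 2 * pi * of_int k) \<in> N} \<in> null_sets lborel" by (rule null_sets_translation[OF N(1)])
    then have "AE \<theta> in lborel. \<theta> \<notin> {\<theta>. \<theta> - (- t - 2 * pi * of_int k) \<in> N}" by (rule AE_not_in)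
    then show "AE \<theta> in lborel. \<theta> + t + 2 * pi * of_int k \<notin> N"
      by (simp add: algebra_simps)
  qed
  then have "AE \<theta> in lborel. Q (\<theta> + t)"
  proof eventually_elim
    case (elim \<theta>)
    define k where "k = - \<lfloor>(\<theta> + t + pi) / (2 * pi)\<rfloor>"
    have "of_int (- k) \<le> (\<theta> + t + pi) / (2 * pi)" "(\<theta> + t + pi) / (2 * pi) < of_int (- k) + 1"
      unfolding k_def by linarith+
    then have "\<theta> + t + 2 * pi * of_int k \<in> {-pi..pi}" by (auto simp: field_simps)
    then have "Q (\<theta> + t + 2 * pi * of_int k)" using elim N(2) by blast
    then show ?case using periodic_int_shift[of Q] per by blast
  qed
  then show ?thesis unfolding AE_circ_iff by eventually_elim simp
qed

text \<open>A limit along one sequence of radii is Borel measurable, and it agrees with \<open>boundary_fun\<close> wherever the radial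
  limit exists.\<close>

definition radial_sequence_limit :: "(complex \<Rightarrow> complex) \<Rightarrow> real \<Rightarrow> complex" where
  "radial_sequence_limit f \<theta> = lim (\<lambda>n. f (of_real (1 - inverse (real (n + 2))) * cis \<theta>))"

lemma radius_sequence:
  "0 \<le> 1 - inverse (real (n + 2))" "1 - inverse (real (n + 2)) < 1"
  "filterlim (\<lambda>n. 1 - inverse (real (n + 2))) (at_left 1) sequentially"
proof -
  show "0 \<le> 1 - inverse (real (n + 2))" "1 - inverse (real (n + 2)) < 1"
    by (auto simp: inverse_eq_divide field_simps)
  have "(\<lambda>n. 1 - inverse (real (n + 2))) \<longlonglongrightarrow> 1 - 0"
    using LIMSEQ_ignore_initial_segment[OF lim_inverse_n, of 2] by (intro tendsto_intros) auto
  then show "filterlim (\<lambda>n. 1 - inverse (real (n + 2))) (at_left 1) sequentially"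
    by (auto simp: filterlim_at intro!: always_eventually)
qed

lemma radial_sequence_limit_eq:
  assumes "((\<lambda>r. f (of_real r * cis \<theta>)) \<longlongrightarrow> l) (at_left 1)"
  shows "radial_sequence_limit f \<theta> = l" "boundary_fun f \<theta> = l"
    "(\<lambda>n. f (of_real (1 - inverse (real (n + 2))) * cis \<theta>)) \<longlonglongrightarrow> l"
proof -
  show *: "(\<lambda>n. f (of_real (1 - inverse (real (n + 2))) * cis \<theta>)) \<longlonglongrightarrow> l"
    using filterlim_compose[OF assms radius_sequence(3)] .
  then show "radial_sequence_limit f \<theta> = l" unfolding radial_sequence_limit_def by (rule limI)
  have "Lim (at_left 1) (\<lambda>r. f (of_real r * cis \<theta>)) = l"
    by (rule tendsto_Lim[OF _ assms]) simp
  then show "boundary_fun f \<theta> = l" using assms by (auto simp: boundary_fun_def)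
qed

lemma measurable_radial_sequence_limit:
  assumes "f holomorphic_on ball 0 1"
  shows "radial_sequence_limit f \<in> borel_measurable borel"
proof -
  have [measurable]: "(\<lambda>\<theta>. f (of_real (1 - inverse (real (n + 2))) * cis \<theta>)) \<in> borel_measurable borel" for n
    by (rule measurable_holomorphic_circle[OF assms radius_sequence(1,2)])
  show ?thesis unfolding radial_sequence_limit_def[abs_def] by measurable
qed

lemma hardy_space_boundary_values:
  assumes f: "f \<in> hardy_space p" and p: "1 \<le> p"
  defines "b \<equiv> radial_sequence_limit f"
  shows "b (\<theta> + 2 * pi) = b \<theta>" and "Lp_le p b (hardy_norm p f)"
    and "AE \<theta> in circ. (\<lambda>n. f (of_real (1 - inverse (real (n + 2))) * cis (\<theta> + t))) \<longlonglongrightarrow> b (\<theta> + t)"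
    and "AE \<theta> in circ. boundary_fun f (\<theta> + t) = b (\<theta> + t)"
    and "0 < e \<Longrightarrow> \<exists>R. 0 \<le> R \<and> R < 1 \<and> (\<forall>r. R \<le> r \<and> r < 1 \<longrightarrow> Lp_le 1 (\<lambda>\<theta>. f (of_real r * cis \<theta>) - b \<theta>) e)"
proof -
  have hol: "f holomorphic_on ball 0 1" using f by (simp add: hardy_space_def)
  note bound = hardy_space_bounded_means[OF f _ _ p]
  have bound1: "Lp_le 1 (on_circle f s) (hardy_norm p f)" if "0 \<le> s" "s < 1" for s
    by (rule Lp_le_imp_L1[OF bound[OF that] p])
  show per: "b (\<theta> + 2 * pi) = b \<theta>" for \<theta>
    by (simp add: b_def radial_sequence_limit_def cis_mult[symmetric])
  have b_meas: "b \<in> borel_measurable borel" unfolding b_def by (rule measurable_radial_sequence_limit[OF hol])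
  obtain h where h_per: "\<And>\<theta>. h (\<theta> + 2 * pi) = h \<theta>"
    and h: "\<And>e. 0 < e \<Longrightarrow> \<exists>R. 0 \<le> R \<and> R < 1 \<and> (\<forall>r. R \<le> r \<and> r < 1 \<longrightarrow> Lp_le 1 (\<lambda>\<theta>. f (of_real r * cis \<theta>) - h \<theta>) e)"
    using L1_boundary_function[OF hol bound1] by blast
  have "\<exists>A. Lp_le 1 h A"
  proof -
    obtain R where "0 \<le> R" "R < 1" "Lp_le 1 (\<lambda>\<theta>. f (of_real R * cis \<theta>) - h \<theta>) 1"
      using h[of 1] by auto
    then have "Lp_le 1 (\<lambda>\<theta>. f (of_real R * cis \<theta>) - (f (of_real R * cis \<theta>) - h \<theta>)) (hardy_norm p f + 1)"
      by (intro Lp_le_diff bound1) auto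
    then show ?thesis by auto
  qed
  then obtain A where "Lp_le 1 h A" by blast
  then have lim: "AE \<theta> in circ. ((\<lambda>r. f (of_real r * cis \<theta>)) \<longlongrightarrow> h \<theta>) (at_left 1)"
    by (rule AE_radial_limit[OF hol h_per _ h])
  have bh: "AE \<theta> in circ. b \<theta> = h \<theta>"
    using lim by eventually_elim (simp add: b_def radial_sequence_limit_eq(1))
  define Q where "Q \<theta> \<longleftrightarrow> (\<exists>l. ((\<lambda>r. f (of_real r * cis \<theta>)) \<longlongrightarrow> l) (at_left 1))" for \<theta>
  have Q_shift: "AE \<theta> in circ. Q (\<theta> + t)" for t
  proof (rule AE_circ_periodic_shift)
    show "AE \<theta> in circ. Q \<theta>" using lim by eventually_elim (auto simp: Q_def)
    show "Q (\<theta> + 2 * pi) = Q \<theta>" for \<theta> by (simp add: Q_def cis_mult[symmetric])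
  qed
  show seq: "AE \<theta> in circ. (\<lambda>n. f (of_real (1 - inverse (real (n + 2))) * cis (\<theta> + t))) \<longlonglongrightarrow> b (\<theta> + t)" for t
    using Q_shift[of t] by eventually_elim (metis Q_def b_def radial_sequence_limit_eq(1,3))
  show "AE \<theta> in circ. boundary_fun f (\<theta> + t) = b (\<theta> + t)"
    using Q_shift[of t] by eventually_elim (metis Q_def b_def radial_sequence_limit_eq(1,2))
  show "Lp_le p b (hardy_norm p f)"
    by (rule Lp_le_LIMSEQ[OF bound[OF radius_sequence(1,2)] tendsto_const p b_meas]) (use seq[of 0] in simp)
  assume e: "0 < e"
  obtain R where R: "0 \<le> R" "R < 1" "\<And>r. R \<le> r \<Longrightarrow> r < 1 \<Longrightarrow> Lp_le 1 (\<lambda>\<theta>. f (of_real r * cis \<theta>) - h \<theta>) e"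
    using h[OF e] by blast
  have "Lp_le 1 (\<lambda>\<theta>. f (of_real r * cis \<theta>) - b \<theta>) e" if "R \<le> r" "r < 1" for r
  proof (rule Lp_le_cong_AE[OF R(3)[OF that]])
    show "(\<lambda>\<theta>. f (of_real r * cis \<theta>) - b \<theta>) \<in> borel_measurable borel"
      using that R by (intro borel_measurable_diff b_meas measurable_holomorphic_circle hol) auto
    show "AE \<theta> in circ. f (of_real r * cis \<theta>) - b \<theta> = f (of_real r * cis \<theta>) - h \<theta>"
      using bh by eventually_elim simp
  qed simp
  then show "\<exists>R. 0 \<le> R \<and> R < 1 \<and> (\<forall>r. R \<le> r \<and> r < 1 \<longrightarrow> Lp_le 1 (\<lambda>\<theta>. f (of_real r * cis \<theta>) - b \<theta>) e)"
    using R by blast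
qed

section \<open>Mean moduli of continuity\<close>

text \<open>The equality makes \<open>h\<close> measurable for the completed measure but not necessarily Borel measurable. It is applied to
  increments of \<open>boundary_fun\<close>.\<close>

lemma Lp_norm_cong_AE:
  assumes g: "g \<in> borel_measurable borel" and eq: "AE \<theta> in circ. h \<theta> = g \<theta>"
  shows "Lp_norm p h = Lp_norm p g"
proof -
  have ae: "AE \<theta> in lebesgue. indicator {-pi..pi} \<theta> *\<^sub>R (norm (g \<theta>) powr p) = indicator {-pi..pi} \<theta> *\<^sub>R (norm (h \<theta>) powr p)"
    using eq unfolding AE_circ_iff AE_completion_iff by eventually_elim (auto split: split_indicator)
  have "(\<lambda>\<theta>. indicator {-pi..pi} \<theta> *\<^sub>R (norm (g \<theta>) powr p)) \<in> borel_measurable lborel" using g by simp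
  then have "(\<lambda>\<theta>. indicator {-pi..pi} \<theta> *\<^sub>R (norm (g \<theta>) powr p)) \<in> borel_measurable lebesgue"
    by (rule measurable_completion)
  then have "(LINT \<theta>:{-pi..pi}|lebesgue. norm (h \<theta>) powr p) = (LINT \<theta>:{-pi..pi}|lebesgue. norm (g \<theta>) powr p)"
    unfolding set_lebesgue_integral_def
    using borel_measurable_AE[OF _ ae] ae by (intro Bochner_Integration.integral_cong_AE) (auto elim: eventually_mono)
  then show ?thesis by (simp add: Lp_norm_def)
qed

lemma Lp_le_dilation_boundary:
  assumes f: "f \<in> hardy_space p" and p: "1 \<le> p" and r: "0 \<le> r" "r < 1"
    and A: "\<And>s. 0 \<le> s \<Longrightarrow> s < 1 \<Longrightarrow> Lp_le p (\<lambda>\<theta>. f (of_real r * (of_real s * cis \<theta>)) - f (of_real s * cis \<theta>)) A"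
  shows "Lp_le p (\<lambda>\<theta>. f (of_real r * cis \<theta>) - radial_sequence_limit f \<theta>) A"
proof (rule Lp_le_LIMSEQ[OF A[OF radius_sequence(1,2)] tendsto_const p])
  have hol: "f holomorphic_on ball 0 1" using f by (simp add: hardy_space_def)
  show "(\<lambda>\<theta>. f (of_real r * cis \<theta>) - radial_sequence_limit f \<theta>) \<in> borel_measurable borel"
    by (intro borel_measurable_diff measurable_holomorphic_circle[OF hol r] measurable_radial_sequence_limit hol)
  have "AE \<theta> in circ. (\<lambda>n. f (of_real (1 - inverse (real (n + 2))) * cis \<theta>)) \<longlonglongrightarrow> radial_sequence_limit f \<theta>"
    using hardy_space_boundary_values(3)[OF f p, of 0] by simp
  then show "AE \<theta> in circ. (\<lambda>n. f (of_real r * (of_real (1 - inverse (real (n + 2))) * cis \<theta>)) - f (of_real (1 - inverse (real (n + 2))) * cis \<theta>))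
      \<longlonglongrightarrow> f (of_real r * cis \<theta>) - radial_sequence_limit f \<theta>"
  proof eventually_elim
    case (elim \<theta>)
    have "isCont f (of_real r * (of_real 1 * cis \<theta>))"
      using r by (intro continuous_on_interior[OF holomorphic_on_imp_continuous_on[OF hol]]) (auto simp: norm_mult)
    moreover have "(\<lambda>n. 1 - inverse (real (n + 2))) \<longlonglongrightarrow> 1"
      using radius_sequence(3) by (auto simp: filterlim_at)
    then have "(\<lambda>n. of_real r * (of_real (1 - inverse (real (n + 2))) * cis \<theta>)) \<longlonglongrightarrow> of_real r * (of_real 1 * cis \<theta>)"
      by (intro tendsto_mult tendsto_const tendsto_of_real)
    ultimately have "(\<lambda>n. f (of_real r * (of_real (1 - inverse (real (n + 2))) * cis \<theta>))) \<longlonglongrightarrow> f (of_real r * (of_real 1 * cis \<theta>))"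
      by (rule isCont_tendsto_compose)
    from tendsto_diff[OF this elim] show ?case by simp
  qed
qed

lemma Lp_norm_boundary_translate:
  assumes f: "f \<in> hardy_space p" and p: "1 \<le> p"
  shows "Lp_norm p (\<lambda>\<theta>. translate t (boundary_fun f) \<theta> - boundary_fun f \<theta>)
    = Lp_norm p (\<lambda>\<theta>. radial_sequence_limit f (\<theta> + t) - radial_sequence_limit f \<theta>)"
proof (rule Lp_norm_cong_AE)
  have [measurable]: "radial_sequence_limit f \<in> borel_measurable borel"
    using f by (intro measurable_radial_sequence_limit) (simp add: hardy_space_def)
  show "(\<lambda>\<theta>. radial_sequence_limit f (\<theta> + t) - radial_sequence_limit f \<theta>) \<in> borel_measurable borel"
    by measurable
  show "AE \<theta> in circ. translate t (boundary_fun f) \<theta> - boundary_fun f \<theta>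
      = radial_sequence_limit f (\<theta> + t) - radial_sequence_limit f \<theta>"
    using hardy_space_boundary_values(4)[OF f p, of t] hardy_space_boundary_values(4)[OF f p, of 0]
    by eventually_elim (simp add: translate_def)
qed

lemma Lp_le_boundary_translate_diff:
  assumes f: "f \<in> hardy_space p" and p: "1 \<le> p"
  shows "Lp_le p (\<lambda>\<theta>. radial_sequence_limit f (\<theta> + t) - radial_sequence_limit f \<theta>)
    (Lp_norm p (\<lambda>\<theta>. translate t (boundary_fun f) \<theta> - boundary_fun f \<theta>))"
proof -
  note b = hardy_space_boundary_values(1,2)[OF f p]
  have "Lp_le p (\<lambda>\<theta>. radial_sequence_limit f (\<theta> + t) - radial_sequence_limit f \<theta>) (hardy_norm p f + hardy_norm p f)"
    by (intro Lp_le_diff Lp_le_translate b p)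
  then show ?thesis
    unfolding Lp_norm_boundary_translate[OF f p] by (rule Lp_le_Lp_norm[OF _ p])
qed

text \<open>Let \<open>r = 1 - \<bar>t\<bar>\<close>. The increment of the boundary function differs from the increment of \<open>f\<close> on the circle of radius
  \<open>r\<close> by two translates of \<open>f\<^sub>r - f*\<close>, and the arc of length \<open>r * \<bar>t\<bar>\<close> contributes a
  multiple of \<open>\<bar>t\<bar> * (\<omega> \<bar>t\<bar> / \<bar>t\<bar>)\<close>.\<close>

lemma derivative_growth_imp_mean_lipschitz:
  assumes dini: "dini_weight \<omega>" and p: "1 \<le> p" and f: "f \<in> hardy_space p"
    and K: "0 \<le> K" "0 < t0" "t0 < 1"
    and growth: "\<And>t. 0 < t \<Longrightarrow> t < t0 \<Longrightarrow> Lp_le p (on_circle (deriv f) (1 - t)) (K * (\<omega> t / t))"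
  shows "f \<in> mean_lipschitz_space p \<omega>"
proof -
  have hol: "f holomorphic_on ball 0 1" using f by (simp add: hardy_space_def)
  define b where "b = radial_sequence_limit f"
  obtain K' where K': "0 < K'" "\<And>t s. 0 < t \<Longrightarrow> t < t0 \<Longrightarrow> 0 \<le> s \<Longrightarrow> s < 1 \<Longrightarrow>
      Lp_le p (\<lambda>\<theta>. f (of_real (1 - t) * (of_real s * cis \<theta>)) - f (of_real s * cis \<theta>)) (K' * \<omega> t)"
    using derivative_growth_imp_dilation_bound[OF dini p hol K(1,3) growth] by blast
  have main: "Lp_norm p (\<lambda>\<theta>. translate t (boundary_fun f) \<theta> - boundary_fun f \<theta>) \<le> (K + 2 * K') * \<omega> \<bar>t\<bar>"
    if t: "t \<noteq> 0" "\<bar>t\<bar> < t0" for t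
  proof -
    define r where "r = 1 - \<bar>t\<bar>"
    have r: "0 \<le> r" "r < 1" using t K by (auto simp: r_def)
    have near: "Lp_le p (\<lambda>\<theta>. f (of_real r * cis \<theta>) - b \<theta>) (K' * \<omega> \<bar>t\<bar>)"
      unfolding b_def r_def using t K by (intro Lp_le_dilation_boundary f p K') auto
    have near_t: "Lp_le p (\<lambda>\<theta>. f (of_real r * cis (\<theta> + t)) - b (\<theta> + t)) (K' * \<omega> \<bar>t\<bar>)"
      by (rule Lp_le_translate[OF near])
         (simp add: b_def hardy_space_boundary_values(1)[OF f p] cis_mult[symmetric])
    have rot: "Lp_le p (\<lambda>\<theta>. f (of_real r * cis (\<theta> + t)) - f (of_real r * cis \<theta>)) (\<bar>t\<bar> * (K * (\<omega> \<bar>t\<bar> / \<bar>t\<bar>)))"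
      using growth[of "\<bar>t\<bar>"] t by (intro Lp_le_rotation_diff hol p r) (auto simp: r_def)
    have "Lp_le p (\<lambda>\<theta>. (f (of_real r * cis (\<theta> + t)) - f (of_real r * cis \<theta>) + (f (of_real r * cis \<theta>) - b \<theta>))
        - (f (of_real r * cis (\<theta> + t)) - b (\<theta> + t))) (\<bar>t\<bar> * (K * (\<omega> \<bar>t\<bar> / \<bar>t\<bar>)) + K' * \<omega> \<bar>t\<bar> + K' * \<omega> \<bar>t\<bar>)"
      by (intro Lp_le_diff Lp_le_add rot near near_t p)
    then have "Lp_le p (\<lambda>\<theta>. b (\<theta> + t) - b \<theta>) ((K + 2 * K') * \<omega> \<bar>t\<bar>)"
      using t by (simp add: algebra_simps)
    then show ?thesis
      unfolding Lp_norm_boundary_translate[OF f p] b_def by (rule Lp_norm_le[OF _ p])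
  qed
  have "(\<lambda>t. Lp_norm p (\<lambda>\<theta>. translate t (boundary_fun f) \<theta> - boundary_fun f \<theta>)) \<in> O[at 0](\<lambda>t. \<omega> \<bar>t\<bar>)"
  proof (rule bigoI)
    have "norm (Lp_norm p (\<lambda>\<theta>. translate t (boundary_fun f) \<theta> - boundary_fun f \<theta>)) \<le> (K + 2 * K') * norm (\<omega> \<bar>t\<bar>)"
      if t: "t \<noteq> 0" "\<bar>t\<bar> < t0" for t
    proof -
      have "0 \<le> Lp_norm p (\<lambda>\<theta>. translate t (boundary_fun f) \<theta> - boundary_fun f \<theta>)" by (simp add: Lp_norm_def)
      moreover have "0 \<le> \<omega> \<bar>t\<bar>" using dini t K weightD(2)[of \<omega> "\<bar>t\<bar>"] by (simp add: dini_weight_def)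
      ultimately show ?thesis using main[OF t] by simp
    qed
    then show "\<forall>\<^sub>F t in at 0. norm (Lp_norm p (\<lambda>\<theta>. translate t (boundary_fun f) \<theta> - boundary_fun f \<theta>)) \<le> (K + 2 * K') * norm (\<omega> \<bar>t\<bar>)"
      unfolding eventually_at using K by (intro exI[of _ t0]) (auto simp: dist_real_def)
  qed
  then show ?thesis using f by (simp add: mean_lipschitz_space_def)
qed

text \<open>Besides the integral condition, this records a consequence of it for \<open>\<delta> \<le> \<eta>\<close>: as \<open>\<omega> t / t\<^sup>2 \<ge> \<omega> \<eta>\<close> for \<open>\<eta> < t < 1\<close>, a fixed
  value of \<open>\<omega>\<close> is bounded by a multiple of \<open>\<omega> \<delta> / \<delta>\<close>. It absorbs all terms that come from angles away from \<open>0\<close>.\<close>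

lemma admissible_integral_bound:
  assumes adm: "admissible_weight \<omega>"
  obtains C where "0 \<le> C"
    "\<And>\<delta>. 0 < \<delta> \<Longrightarrow> \<delta> < 1 \<Longrightarrow> (\<integral>\<^sup>+t. ennreal (indicator {\<delta><..<1} t * (\<omega> t / t\<^sup>2)) \<partial>lborel) \<le> ennreal (C * (\<omega> \<delta> / \<delta>))"
    "\<And>\<delta> \<eta>. 0 < \<delta> \<Longrightarrow> \<delta> \<le> \<eta> \<Longrightarrow> \<eta> < 1 \<Longrightarrow> \<omega> \<eta> * (1 - \<eta>) \<le> C * (\<omega> \<delta> / \<delta>)"
    "\<And>\<delta>. 0 < \<delta> \<Longrightarrow> \<delta> < 1 \<Longrightarrow> (\<lambda>t. indicator {\<delta><..<1} t * (\<omega> t / t\<^sup>2)) \<in> borel_measurable borel"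
proof -
  from adm obtain C0 where w: "weight \<omega>" and int: "set_integrable lborel {0<..<1} (\<lambda>t. \<omega> t / t)"
    and C0: "\<And>t. t \<in> {0<..<1} \<Longrightarrow> (LBINT s:{t<..<1}. \<omega> s / s\<^sup>2) \<le> C0 * (\<omega> t / t)"
    unfolding admissible_weight_def dini_weight_def by blast
  note w0 = weightD(2)[OF w]
  have meas: "(\<lambda>t. indicator {\<delta><..<1} t * (\<omega> t / t\<^sup>2)) \<in> borel_measurable borel" if "0 < \<delta>" for \<delta>
  proof -
    have "continuous_on {\<delta><..<1} \<omega>"
      using w that by (auto simp: weight_def intro: continuous_on_subset)
    then have "continuous_on {\<delta><..<1} (\<lambda>t. \<omega> t / t\<^sup>2)"
      using that by (intro continuous_intros) auto
    from borel_measurable_continuous_on_indicator[OF _ this] show ?thesis by simp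
  qed
  have bound: "(\<integral>\<^sup>+t. ennreal (indicator {\<delta><..<1} t * (\<omega> t / t\<^sup>2)) \<partial>lborel) \<le> ennreal (\<bar>C0\<bar> * (\<omega> \<delta> / \<delta>))"
    if \<delta>: "0 < \<delta>" "\<delta> < 1" for \<delta>
  proof -
    have nonneg: "0 \<le> indicator {\<delta><..<1} t * (\<omega> t / t\<^sup>2)" for t
      using \<delta> w0[of t] by (auto split: split_indicator)
    have "integrable lborel (\<lambda>t. (1 / \<delta>) * (indicator {0<..<1} t *\<^sub>R (\<omega> t / t)))"
      using int unfolding set_integrable_def by (rule integrable_mult_right)
    then have I: "integrable lborel (\<lambda>t. indicator {\<delta><..<1} t * (\<omega> t / t\<^sup>2))"
    proof (rule Bochner_Integration.integrable_bound)
      show "AE t in lborel. norm (indicator {\<delta><..<1} t * (\<omega> t / t\<^sup>2)) \<le> norm ((1 / \<delta>) * (indicator {0<..<1} t *\<^sub>R (\<omega> t / t)))"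
      proof (rule AE_I2)
        fix t
        show "norm (indicator {\<delta><..<1} t * (\<omega> t / t\<^sup>2)) \<le> norm ((1 / \<delta>) * (indicator {0<..<1} t *\<^sub>R (\<omega> t / t)))"
        proof (cases "t \<in> {\<delta><..<1}")
          case True
          then have "\<omega> t / t * (1 / t) \<le> \<omega> t / t * (1 / \<delta>)"
            using \<delta> w0[of t] by (intro mult_left_mono divide_left_mono) auto
          then show ?thesis using True \<delta> w0[of t] by (simp add: power2_eq_square mult.commute)
        qed simp
      qed
    qed (use meas[OF \<delta>(1)] in simp)
    have "(\<integral>\<^sup>+t. ennreal (indicator {\<delta><..<1} t * (\<omega> t / t\<^sup>2)) \<partial>lborel) = ennreal (LBINT t:{\<delta><..<1}. \<omega> t / t\<^sup>2)"
      using nn_integral_eq_integral[OF I] nonneg by (simp add: set_lebesgue_integral_def)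
    also have "(LBINT t:{\<delta><..<1}. \<omega> t / t\<^sup>2) \<le> \<bar>C0\<bar> * (\<omega> \<delta> / \<delta>)"
      using C0[of \<delta>] \<delta> w0[of \<delta>] by (intro order_trans[OF C0] mult_right_mono) auto
    finally show ?thesis by (simp add: ennreal_leI)
  qed
  show thesis
  proof (rule that[OF _ bound _ meas])
    show "0 \<le> \<bar>C0\<bar>" by simp
    fix \<delta> \<eta> :: real assume d: "0 < \<delta>" "\<delta> \<le> \<eta>" "\<eta> < 1"
    have "ennreal (\<omega> \<eta> * (1 - \<eta>)) = (\<integral>\<^sup>+t. ennreal (indicator {\<eta><..<1} t * \<omega> \<eta>) \<partial>lborel)"
      using d w0[of \<eta>] by (subst nn_integral_const_interval) auto
    also have "\<dots> \<le> (\<integral>\<^sup>+t. ennreal (indicator {\<delta><..<1} t * (\<omega> t / t\<^sup>2)) \<partial>lborel)"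
    proof (intro nn_integral_mono ennreal_leI)
      fix t
      show "indicator {\<eta><..<1} t * \<omega> \<eta> \<le> indicator {\<delta><..<1} t * (\<omega> t / t\<^sup>2)"
      proof (cases "t \<in> {\<eta><..<1}")
        case True
        then have "\<omega> \<eta> \<le> \<omega> t" "0 \<le> \<omega> t" "0 < t\<^sup>2" "t\<^sup>2 \<le> 1"
          using d weightD[OF w] by (auto simp: power_le_one_iff)
        moreover from this have "\<omega> t / 1 \<le> \<omega> t / t\<^sup>2" by (intro divide_left_mono) auto
        ultimately have "\<omega> \<eta> \<le> \<omega> t / t\<^sup>2" by simp
        then show ?thesis using True d by simp
      qed (use d w0[of t] in \<open>auto split: split_indicator\<close>)
    qed
    also have "\<dots> \<le> ennreal (\<bar>C0\<bar> * (\<omega> \<delta> / \<delta>))" using d by (intro bound) auto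
    finally show "\<omega> \<eta> * (1 - \<eta>) \<le> \<bar>C0\<bar> * (\<omega> \<delta> / \<delta>)"
      using d w0[of \<delta>] by (subst (asm) ennreal_le_iff) auto
  qed
qed

lemma sin_ge_half:
  assumes "0 \<le> x" "x \<le> pi / 2"
  shows "x / 2 \<le> sin (x::real)"
proof (cases "x \<le> pi / 3")
  case True
  have "\<exists>y. ((\<lambda>x. sin x - x / 2) has_real_derivative y) (at z) \<and> 0 \<le> y" if "0 \<le> z" "z \<le> x" for z
  proof (intro exI conjI)
    show "((\<lambda>x. sin x - x / 2) has_real_derivative cos z - 1 / 2) (at z)"
      by (auto intro!: derivative_eq_intros)
    have "cos (pi / 3) \<le> cos z" using that True by (intro cos_monotone_0_pi_le) auto
    then show "0 \<le> cos z - 1 / 2" by (simp add: cos_60)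
  qed
  from DERIV_nonneg_imp_nondecreasing[OF assms(1) this] show ?thesis by simp
next
  case False
  have "sqrt 3 / 2 \<le> sin x"
    using sin_monotone_2pi_le[of "pi / 3" x] False assms by (simp add: sin_60)
  moreover have "x / 2 \<le> pi / 4" using assms by simp
  moreover have "1.7 \<le> sqrt 3" by (rule real_le_rsqrt) (simp add: power2_eq_square)
  moreover have "pi \<le> 3.2" using pi_approx by simp
  ultimately show ?thesis by linarith
qed

lemma norm_derivative_kernel_le:
  assumes r: "1 / 2 \<le> r" "r < 1" and t: "\<bar>t\<bar> \<le> pi"
  shows "norm (cis t / (cis t - of_real r)\<^sup>2) \<le> 1 / (1 - r)\<^sup>2"
    and "t \<noteq> 0 \<Longrightarrow> norm (cis t / (cis t - of_real r)\<^sup>2) \<le> 8 / t\<^sup>2"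
proof -
  have eq: "norm (cis t / (cis t - of_real r)\<^sup>2) = 1 / ((1 - r)\<^sup>2 + 2 * r * (1 - cos t))"
    by (simp add: norm_divide norm_power norm_cis_minus_real)
  have c: "0 \<le> 2 * r * (1 - cos t)" using r by simp
  have pos: "0 < (1 - r)\<^sup>2" using r by simp
  show "norm (cis t / (cis t - of_real r)\<^sup>2) \<le> 1 / (1 - r)\<^sup>2"
    unfolding eq using c pos by (intro divide_left_mono) (auto intro!: mult_pos_pos add_pos_nonneg)
  have "\<bar>t\<bar> / 2 / 2 \<le> sin (\<bar>t\<bar> / 2)" using t by (intro sin_ge_half) auto
  then have "(\<bar>t\<bar> / 2 / 2)\<^sup>2 \<le> (sin (\<bar>t\<bar> / 2))\<^sup>2" by (intro power_mono) auto
  also have "(sin (\<bar>t\<bar> / 2))\<^sup>2 = (1 - cos t) / 2"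
    using cos_double_sin[of "\<bar>t\<bar> / 2"] by simp
  finally have "t\<^sup>2 / 8 \<le> 1 - cos t" by (simp add: power_divide)
  then have "1 * (t\<^sup>2 / 8) \<le> 2 * r * (1 - cos t)" using r by (intro mult_mono) auto
  then have le: "t\<^sup>2 / 8 \<le> (1 - r)\<^sup>2 + 2 * r * (1 - cos t)" using pos by linarith
  assume "t \<noteq> 0"
  then have "1 / ((1 - r)\<^sup>2 + 2 * r * (1 - cos t)) \<le> 1 / (t\<^sup>2 / 8)"
    using le pos c by (intro divide_left_mono) (auto intro!: mult_pos_pos add_pos_nonneg)
  then show "norm (cis t / (cis t - of_real r)\<^sup>2) \<le> 8 / t\<^sup>2" unfolding eq by simp
qed

text \<open>The integral of the kernel vanishes, because it represents the derivative of a constant. This is why the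
  increment of \<open>b\<close> may replace its value. The formula itself passes to the boundary by convergence in \<open>L\<^sup>1\<close>, since the kernel is
  bounded for fixed \<open>r\<close>.\<close>

lemma derivative_from_boundary_values:
  assumes f: "f \<in> hardy_space p" and p: "1 \<le> p" and r: "0 \<le> r" "r < 1"
  defines "b \<equiv> radial_sequence_limit f"
  shows "cis \<theta> * deriv f (of_real r * cis \<theta>)
    = (LINT t|circ. (cis t / (cis t - of_real r)\<^sup>2) * (b (\<theta> + t) - b \<theta>))"
proof -
  have hol: "f holomorphic_on ball 0 1" using f by (simp add: hardy_space_def)
  have f': "deriv f holomorphic_on ball 0 1" by (intro holomorphic_deriv hol) auto
  define \<kappa> where "\<kappa> t = cis t / (cis t - of_real r)\<^sup>2" for t
  define M where "M = 2 / (1 - r) / (1 - r\<^sup>2)"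
  have r2: "0 < 1 - r\<^sup>2" using r by (simp add: power_less_one_iff)
  have \<kappa>_le: "norm (\<kappa> t) \<le> M" for t
    unfolding \<kappa>_def M_def norm_derivative_kernel[OF r] using r2 by (intro divide_right_mono Poisson_kernel_le r) auto
  have M0: "0 < M" using r r2 by (simp add: M_def)
  have [measurable]: "\<kappa> \<in> borel_measurable borel" unfolding \<kappa>_def by measurable
  note bv = hardy_space_boundary_values[OF f p, folded b_def]
  have b_L1: "Lp_le 1 b (hardy_norm p f)" by (rule Lp_le_imp_L1[OF bv(2) p])
  have int: "integrable circ (\<lambda>t. \<kappa> t * g t)"
    and norm_int: "norm (LINT t|circ. \<kappa> t * g t) \<le> M * A" if g: "Lp_le 1 g A" for g A
  proof -
    note [measurable] = Lp_leD(1)[OF g]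
    have "(\<integral>\<^sup>+t. norm (\<kappa> t * g t) \<partial>circ) \<le> (\<integral>\<^sup>+t. ennreal M * norm (g t) \<partial>circ)"
      using \<kappa>_le M0 by (intro nn_integral_mono) (auto simp: norm_mult intro!: ennreal_leI mult_right_mono simp flip: ennreal_mult)
    also have "\<dots> = ennreal M * (\<integral>\<^sup>+t. norm (g t) \<partial>circ)" by (intro nn_integral_cmult) auto
    also have "\<dots> \<le> ennreal M * ennreal A" using Lp_leD[OF g] by (intro mult_left_mono) auto
    also have "\<dots> = ennreal (M * A)" using M0 Lp_leD(2)[OF g] by (simp flip: ennreal_mult)
    finally have *: "(\<integral>\<^sup>+t. norm (\<kappa> t * g t) \<partial>circ) \<le> ennreal (M * A)" .
    show int: "integrable circ (\<lambda>t. \<kappa> t * g t)"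
      by (intro integrableI_bounded) (use * in \<open>auto intro: le_less_trans\<close>)
    have "ennreal (norm (LINT t|circ. \<kappa> t * g t)) \<le> ennreal (M * A)"
      by (rule order_trans[OF integral_norm_bound_ennreal[OF int] *])
    then show "norm (LINT t|circ. \<kappa> t * g t) \<le> M * A"
      using M0 Lp_leD(2)[OF g] by (subst (asm) ennreal_le_iff) auto
  qed
  have b_shift: "Lp_le 1 (\<lambda>t. b (\<theta> + t)) (hardy_norm p f)"
    using Lp_le_translate[OF b_L1 bv(1), of \<theta>] unfolding add.commute[of _ \<theta>] .
  have const: "Lp_le 1 (\<lambda>_. c) (norm c)" for c by (intro Lp_le_bounded) auto
  have formula: "(LINT t|circ. \<kappa> t * f (of_real s * cis (\<theta> + t))) = cis \<theta> * (of_real s * deriv f (of_real (s * r) * cis \<theta>))"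
    if s: "0 \<le> s" "s < 1" for s
  proof -
    have "(f has_field_derivative deriv f (of_real (s * r) * cis \<theta>)) (at (of_real s * (of_real r * cis \<theta>)))"
    proof -
      have "s * r < 1" "0 \<le> s * r" using s r mult_left_le_one_le[of r s] by auto
      then show ?thesis
        using holomorphic_derivI[OF hol, of "of_real (s * r) * cis \<theta>"] by (simp add: norm_mult mult.assoc)
    qed
    moreover have "((\<lambda>u. of_real s * u) has_field_derivative of_real s) (at (of_real r * cis \<theta>))"
      by (auto intro!: derivative_eq_intros)
    ultimately have "((\<lambda>z. f (of_real s * z)) has_field_derivative deriv f (of_real (s * r) * cis \<theta>) * of_real s) (at (of_real r * cis \<theta>))"
      by (rule DERIV_chain2)
    then show ?thesis
      unfolding \<kappa>_def derivative_kernel_formula[OF scaled_disc[OF hol s] r]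
      by (simp add: DERIV_imp_deriv mult.commute)
  qed
  have lim1: "((\<lambda>s. cis \<theta> * (of_real s * deriv f (of_real (s * r) * cis \<theta>))) \<longlongrightarrow> (LINT t|circ. \<kappa> t * b (\<theta> + t))) (at_left 1)"
  proof (rule tendstoI)
    fix e :: real assume e: "0 < e"
    obtain R where R: "0 \<le> R" "R < 1" "\<And>s. R \<le> s \<Longrightarrow> s < 1 \<Longrightarrow> Lp_le 1 (\<lambda>\<theta>. f (of_real s * cis \<theta>) - b \<theta>) (e / (2 * M))"
      using bv(5)[of "e / (2 * M)"] e M0 by auto
    have "dist (cis \<theta> * (of_real s * deriv f (of_real (s * r) * cis \<theta>))) (LINT t|circ. \<kappa> t * b (\<theta> + t)) < e"
      if s: "R < s" "s < 1" for s
    proof -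
      have s0: "0 \<le> s" using s R by simp
      have D: "Lp_le 1 (\<lambda>t. f (of_real s * cis (\<theta> + t)) - b (\<theta> + t)) (e / (2 * M))"
      proof -
        have "Lp_le 1 (\<lambda>\<theta>. f (of_real s * cis \<theta>) - b \<theta>) (e / (2 * M))" using s by (intro R(3)) auto
        then have "Lp_le 1 (\<lambda>t. f (of_real s * cis (t + \<theta>)) - b (t + \<theta>)) (e / (2 * M))"
          by (rule Lp_le_translate) (simp add: bv(1) cis_mult[symmetric])
        then show ?thesis unfolding add.commute[of _ \<theta>] .
      qed
      have fs: "Lp_le 1 (\<lambda>t. f (of_real s * cis (\<theta> + t))) (e / (2 * M) + hardy_norm p f)"
        using Lp_le_add[OF D b_shift] by simp
      have "(LINT t|circ. \<kappa> t * f (of_real s * cis (\<theta> + t))) - (LINT t|circ. \<kappa> t * b (\<theta> + t))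
          = (LINT t|circ. \<kappa> t * (f (of_real s * cis (\<theta> + t)) - b (\<theta> + t)))"
        using Bochner_Integration.integral_diff[OF int[OF fs] int[OF b_shift]] by (simp add: right_diff_distrib)
      also have "norm \<dots> \<le> M * (e / (2 * M))" by (rule norm_int[OF D])
      also have "\<dots> < e" using M0 e by simp
      finally show ?thesis by (simp add: dist_norm formula[OF s0 s(2)])
    qed
    then show "\<forall>\<^sub>F s in at_left 1. dist (cis \<theta> * (of_real s * deriv f (of_real (s * r) * cis \<theta>))) (LINT t|circ. \<kappa> t * b (\<theta> + t)) < e"
      unfolding eventually_at_left_field using R by (intro exI[of _ R]) auto
  qed
  have lim2: "((\<lambda>s. cis \<theta> * (of_real s * deriv f (of_real (s * r) * cis \<theta>))) \<longlongrightarrow> cis \<theta> * (of_real 1 * deriv f (of_real (1 * r) * cis \<theta>))) (at_left 1)"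
  proof -
    have "isCont (deriv f) (of_real (1 * r) * cis \<theta>)"
      using r by (intro continuous_on_interior[OF holomorphic_on_imp_continuous_on[OF f']]) (auto simp: norm_mult)
    then show ?thesis by (intro tendsto_intros isCont_tendsto_compose[of _ "deriv f"])
  qed
  have 1: "cis \<theta> * deriv f (of_real r * cis \<theta>) = (LINT t|circ. \<kappa> t * b (\<theta> + t))"
    using tendsto_unique[OF _ lim2 lim1] by simp
  have "(LINT t|circ. \<kappa> t * 1) = 0"
    using derivative_kernel_formula[of "\<lambda>_. 1" r 0] r by (simp add: \<kappa>_def)
  then have 2: "(LINT t|circ. \<kappa> t * b \<theta>) = 0" by simp
  have "(LINT t|circ. \<kappa> t * (b (\<theta> + t) - b \<theta>)) = (LINT t|circ. \<kappa> t * b (\<theta> + t)) - (LINT t|circ. \<kappa> t * b \<theta>)"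
    using Bochner_Integration.integral_diff[OF int[OF b_shift] int[OF const]] by (simp add: right_diff_distrib)
  then show ?thesis using 1 2 by (simp add: \<kappa>_def)
qed

lemma Lp_le_iterated_translate:
  assumes b: "\<And>\<theta>. b (\<theta> + 2 * pi) = b \<theta>" and p: "1 \<le> p"
    and s: "Lp_le p (\<lambda>\<theta>. b (\<theta> + s) - b \<theta>) B"
  shows "Lp_le p (\<lambda>\<theta>. b (\<theta> + real m * s) - b \<theta>) (real m * B)"
proof (induction m)
  case 0
  show ?case using p by (auto intro!: Lp_le_bounded)
next
  case (Suc m)
  have "b (\<theta> + 2 * pi + c) = b (\<theta> + c)" for \<theta> c
    using b[of "\<theta> + c"] by (simp add: algebra_simps)
  then have "Lp_le p (\<lambda>\<theta>. b (\<theta> + real m * s + s) - b (\<theta> + real m * s)) B"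
    by (intro Lp_le_translate[OF s]) (simp add: b)
  from Lp_le_add[OF this Suc.IH p] show ?case
    by (simp add: algebra_simps)
qed

lemma nn_integral_circ_le_lborel:
  assumes [measurable]: "G \<in> borel_measurable borel"
  shows "(\<integral>\<^sup>+t. G t \<partial>circ) \<le> (\<integral>\<^sup>+t. G t \<partial>lborel)"
proof -
  have "ennreal (indicator {-pi..pi} t / (2 * pi)) * G t \<le> 1 * G t" for t
  proof (rule mult_right_mono)
    have "indicator {-pi..pi} t / (2 * pi) \<le> 1"
      using pi_gt3 by (auto simp: field_simps split: split_indicator)
    then show "ennreal (indicator {-pi..pi} t / (2 * pi)) \<le> 1" by simp
  qed simp
  then show ?thesis by (subst nn_integral_circ) (auto intro!: nn_integral_mono)
qed

text \<open>Minkowski's inequality is applied to the representation of \<open>f'\<close> by increments of the boundary function with \<open>r = 1 - \<delta>\<close>.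
  The angles \<open>\<bar>t\<bar> \<le> \<delta>\<close>, where the kernel is at most \<open>1 / \<delta>\<^sup>2\<close>, contribute a multiple of \<open>\<omega> \<delta> / \<delta>\<close> by monotonicity;
  the angles \<open>\<delta> < \<bar>t\<bar> < \<eta>1\<close>, where it is at most \<open>8 / t\<^sup>2\<close>, do so by the admissibility condition. For larger angles the
  hypothesis says nothing directly, but an increment by \<open>t\<close> is a sum of \<open>n\<close> increments by \<open>t / n\<close>, which is small, and the
  resulting constant is again at most a multiple of \<open>\<omega> \<delta> / \<delta>\<close>.\<close>

lemma mean_lipschitz_imp_derivative_growth:
  assumes adm: "admissible_weight \<omega>" and p: "1 \<le> p" and f: "f \<in> mean_lipschitz_space p \<omega>"
  obtains K t0 where "0 < K" "0 < t0" "t0 < 1"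
    "\<And>t. 0 < t \<Longrightarrow> t < t0 \<Longrightarrow> Lp_le p (on_circle (deriv f) (1 - t)) (K * (\<omega> t / t))"
proof -
  have w: "weight \<omega>" using adm by (simp add: admissible_weight_def dini_weight_def)
  have fH: "f \<in> hardy_space p" using f by (simp add: mean_lipschitz_space_def)
  have hol: "f holomorphic_on ball 0 1" using fH by (simp add: hardy_space_def)
  have f': "deriv f holomorphic_on ball 0 1" by (intro holomorphic_deriv hol) auto
  define b where "b = radial_sequence_limit f"
  note b_per = hardy_space_boundary_values(1)[OF fH p, folded b_def]
  have [measurable]: "b \<in> borel_measurable borel" unfolding b_def by (rule measurable_radial_sequence_limit[OF hol])
  obtain C where C: "0 \<le> C"
    "\<And>\<delta>. 0 < \<delta> \<Longrightarrow> \<delta> < 1 \<Longrightarrow> (\<integral>\<^sup>+t. ennreal (indicator {\<delta><..<1} t * (\<omega> t / t\<^sup>2)) \<partial>lborel) \<le> ennreal (C * (\<omega> \<delta> / \<delta>))"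
    "\<And>\<delta> \<eta>. 0 < \<delta> \<Longrightarrow> \<delta> \<le> \<eta> \<Longrightarrow> \<eta> < 1 \<Longrightarrow> \<omega> \<eta> * (1 - \<eta>) \<le> C * (\<omega> \<delta> / \<delta>)"
    "\<And>\<delta>. 0 < \<delta> \<Longrightarrow> \<delta> < 1 \<Longrightarrow> (\<lambda>t. indicator {\<delta><..<1} t * (\<omega> t / t\<^sup>2)) \<in> borel_measurable borel"
    by (rule admissible_integral_bound[OF adm]) (rule that)
  have "(\<lambda>t. Lp_norm p (\<lambda>\<theta>. translate t (boundary_fun f) \<theta> - boundary_fun f \<theta>)) \<in> O[at 0](\<lambda>t. \<omega> \<bar>t\<bar>)"
    using f by (simp add: mean_lipschitz_space_def)
  then obtain K0 where K0: "0 < K0" and "\<forall>\<^sub>F t in at 0. norm (Lp_norm p (\<lambda>\<theta>. translate t (boundary_fun f) \<theta> - boundary_fun f \<theta>))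
      \<le> K0 * norm (\<omega> \<bar>t\<bar>)"
    by (rule landau_o.bigE)
  then obtain \<eta>0 where \<eta>0: "0 < \<eta>0" "\<And>t. t \<noteq> 0 \<Longrightarrow> dist t 0 < \<eta>0 \<Longrightarrow>
      norm (Lp_norm p (\<lambda>\<theta>. translate t (boundary_fun f) \<theta> - boundary_fun f \<theta>)) \<le> K0 * norm (\<omega> \<bar>t\<bar>)"
    unfolding eventually_at by blast
  define \<eta> where "\<eta> = min \<eta>0 (1 / 2)"
  have \<eta>: "0 < \<eta>" "\<eta> \<le> \<eta>0" "\<eta> \<le> 1 / 2" using \<eta>0 by (auto simp: \<eta>_def)
  have small: "Lp_le p (\<lambda>\<theta>. b (\<theta> + t) - b \<theta>) (K0 * \<omega> \<bar>t\<bar>)" if t: "\<bar>t\<bar> < \<eta>" for t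
  proof (cases "t = 0")
    case True
    then show ?thesis using p K0 weightD(2)[OF w, of 0] by (auto intro!: Lp_le_bounded)
  next
    case False
    have "Lp_norm p (\<lambda>\<theta>. translate t (boundary_fun f) \<theta> - boundary_fun f \<theta>) \<le> K0 * \<omega> \<bar>t\<bar>"
      using \<eta>0(2)[OF False] t \<eta> weightD(2)[OF w, of "\<bar>t\<bar>"] by auto
    then show ?thesis
      unfolding b_def by (rule Lp_le_mono[OF Lp_le_boundary_translate_diff[OF fH p] _ p])
  qed
  obtain n where n: "pi / \<eta> < real n" using reals_Archimedean2 by blast
  have n0: "0 < real n" using n \<eta> by (meson divide_pos_pos less_trans pi_gt_zero)
  define \<eta>1 where "\<eta>1 = pi / real n"
  have \<eta>1: "0 < \<eta>1" "\<eta>1 < \<eta>" "\<eta>1 < 1 / 2"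
  proof -
    show "0 < \<eta>1" using n0 by (simp add: \<eta>1_def)
    show "\<eta>1 < \<eta>" using n n0 \<eta> by (simp add: \<eta>1_def field_simps)
    then show "\<eta>1 < 1 / 2" using \<eta> by simp
  qed
  \<comment> \<open>\<open>\<omega>\<close> is only known to be measurable on \<open>{0..<1}\<close>\<close>
  define \<omega>' where "\<omega>' t = indicator {0..<1} t *\<^sub>R \<omega> t" for t
  have [measurable]: "\<omega>' \<in> borel_measurable borel"
    unfolding \<omega>'_def using w by (intro borel_measurable_continuous_on_indicator) (auto simp: weight_def)
  define w0 where "w0 t = (if \<bar>t\<bar> < \<eta>1 then K0 * \<omega>' \<bar>t\<bar> else real n * (K0 * \<omega> \<eta>1))" for t
  have [measurable]: "w0 \<in> borel_measurable borel" unfolding w0_def by measurable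
  have \<omega>\<eta>1: "0 \<le> \<omega> \<eta>1" using weightD(2)[OF w, of \<eta>1] \<eta>1 by simp
  have w0_nonneg: "0 \<le> w0 t" for t
    using K0 \<omega>\<eta>1 weightD(2)[OF w, of "\<bar>t\<bar>"] by (auto simp: w0_def \<omega>'_def split: split_indicator)
  have all: "Lp_le p (\<lambda>\<theta>. b (\<theta> + t) - b \<theta>) (w0 t)" if t: "\<bar>t\<bar> \<le> pi" for t
  proof (cases "\<bar>t\<bar> < \<eta>1")
    case True
    then show ?thesis using small[of t] \<eta>1 by (simp add: w0_def \<omega>'_def)
  next
    case False
    define s where "s = t / real n"
    have s: "\<bar>s\<bar> \<le> \<eta>1" using t n0 by (simp add: s_def \<eta>1_def divide_right_mono)
    then have "K0 * \<omega> \<bar>s\<bar> \<le> K0 * \<omega> \<eta>1"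
      using \<eta>1 K0 by (intro mult_left_mono weightD(1)[OF w]) auto
    then have "Lp_le p (\<lambda>\<theta>. b (\<theta> + s) - b \<theta>) (K0 * \<omega> \<eta>1)"
      using s \<eta>1 by (intro Lp_le_mono[OF small _ p]) auto
    from Lp_le_iterated_translate[OF b_per p this, of n] show ?thesis
      using False n0 by (simp add: s_def w0_def)
  qed
  define K1 where "K1 = 2 * K0 + 16 * K0 * C + 16 * real n * K0 * C / \<eta>1\<^sup>2"
  have K1: "0 < K1" using K0 C n0 \<eta>1 by (auto simp: K1_def intro!: add_pos_nonneg)
  have main: "Lp_le p (on_circle (deriv f) (1 - \<delta>)) (K1 * (\<omega> \<delta> / \<delta>))"
    if \<delta>: "0 < \<delta>" "\<delta> < \<eta>1" for \<delta>
  proof -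
    define r where "r = 1 - \<delta>"
    have r: "1 / 2 \<le> r" "0 \<le> r" "r < 1" using \<delta> \<eta>1 by (auto simp: r_def)
    have r2: "0 < 1 - r\<^sup>2" using r by (simp add: power_less_one_iff)
    define X where "X = \<omega> \<delta> / \<delta>"
    have \<omega>\<delta>: "0 \<le> \<omega> \<delta>" using weightD(2)[OF w, of \<delta>] \<delta> \<eta>1 by simp
    have X: "0 \<le> X" using \<omega>\<delta> \<delta> by (simp add: X_def)
    define \<kappa> where "\<kappa> t = cis t / (cis t - of_real r)\<^sup>2" for t
    have [measurable]: "\<kappa> \<in> borel_measurable borel" unfolding \<kappa>_def by measurable
    have \<kappa>_eq: "norm (\<kappa> t) = Poisson_kernel r t / (1 - r\<^sup>2)" for t
      unfolding \<kappa>_def by (rule norm_derivative_kernel[OF r(2,3)])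
    \<comment> \<open>majorants of the kernel times \<open>w0\<close> on the three ranges of \<open>\<bar>t\<bar>\<close>: \<open>g1\<close> near \<open>0\<close>, \<open>g2\<close> in the middle, the constant \<open>G3\<close> beyond \<open>\<eta>1\<close>\<close>
    define g1 where "g1 t = K0 * \<omega> \<delta> / \<delta>\<^sup>2 * indicator {-\<delta>..\<delta>} t" for t :: real
    define g2 where "g2 t = indicator {\<delta><..<1} t * (\<omega> t / t\<^sup>2)" for t
    have [measurable]: "g2 \<in> borel_measurable borel" "g1 \<in> borel_measurable borel"
      unfolding g1_def g2_def using C(4)[of \<delta>] \<delta> \<eta>1 by auto
    define G3 where "G3 = 8 * real n * K0 * \<omega> \<eta>1 / \<eta>1\<^sup>2"
    have g_nonneg: "0 \<le> g1 t" "0 \<le> g2 t" "0 \<le> G3" for t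
      using K0 \<omega>\<delta> \<delta> \<omega>\<eta>1 weightD(2)[OF w, of t] by (auto simp: g1_def g2_def G3_def split: split_indicator)
    have pointwise: "norm (\<kappa> t) * w0 t \<le> g1 t + 8 * K0 * g2 t + 8 * K0 * g2 (- t) + G3" if t: "\<bar>t\<bar> \<le> pi" for t
    proof (cases "\<bar>t\<bar> \<le> \<delta>")
      case True
      have "norm (\<kappa> t) * w0 t \<le> 1 / \<delta>\<^sup>2 * (K0 * \<omega> \<delta>)"
      proof (rule mult_mono)
        show "norm (\<kappa> t) \<le> 1 / \<delta>\<^sup>2"
          using norm_derivative_kernel_le(1)[OF r(1,3) t] by (simp add: \<kappa>_def r_def)
        show "w0 t \<le> K0 * \<omega> \<delta>"
          using True \<delta> \<eta>1 K0 weightD(1)[OF w, of "\<bar>t\<bar>" \<delta>] by (auto simp: w0_def \<omega>'_def)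
      qed (use w0_nonneg in auto)
      also have "\<dots> = g1 t"
      proof -
        have "t \<in> {-\<delta>..\<delta>}" using True by auto
        then show ?thesis by (simp add: g1_def)
      qed
      finally show ?thesis using g_nonneg(2)[of t] g_nonneg(2)[of "-t"] g_nonneg(3) K0
        by (simp add: add_increasing2)
    next
      case False
      then have t0: "t \<noteq> 0" using \<delta> by auto
      have \<kappa>t: "norm (\<kappa> t) \<le> 8 / t\<^sup>2"
        using norm_derivative_kernel_le(2)[OF r(1,3) t t0] by (simp add: \<kappa>_def)
      show ?thesis
      proof (cases "\<bar>t\<bar> < \<eta>1")
        case True
        have "norm (\<kappa> t) * w0 t \<le> 8 / t\<^sup>2 * (K0 * \<omega> \<bar>t\<bar>)"
          using True \<eta>1 w0_nonneg[of t] by (intro mult_mono \<kappa>t) (auto simp: w0_def \<omega>'_def)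
        also have "\<dots> = 8 * K0 * g2 \<bar>t\<bar>" using False True \<eta>1 by (simp add: g2_def)
        also have "\<dots> \<le> 8 * K0 * g2 t + 8 * K0 * g2 (- t)"
          using g_nonneg(2)[of t] g_nonneg(2)[of "-t"] K0 by (cases "0 \<le> t") auto
        finally show ?thesis using g_nonneg(1)[of t] g_nonneg(3) by simp
      next
        case f2: False
        have "\<eta>1\<^sup>2 \<le> \<bar>t\<bar>\<^sup>2" using f2 \<eta>1 by (intro power_mono) auto
        then have "\<eta>1\<^sup>2 \<le> t\<^sup>2" by simp
        then have "8 / t\<^sup>2 \<le> 8 / \<eta>1\<^sup>2" using \<eta>1 t0 by (intro divide_left_mono) auto
        then have "norm (\<kappa> t) * w0 t \<le> 8 / \<eta>1\<^sup>2 * (real n * (K0 * \<omega> \<eta>1))"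
          using f2 w0_nonneg[of t] \<kappa>t by (intro mult_mono) (auto simp: w0_def)
        also have "\<dots> = G3" by (simp add: G3_def)
        finally show ?thesis
          using g_nonneg(1)[of t] g_nonneg(2)[of t] g_nonneg(2)[of "-t"] K0 by (simp add: add_increasing)
      qed
    qed
    have I1: "(\<integral>\<^sup>+t. ennreal (g1 t) \<partial>circ) \<le> ennreal (2 * K0 * X)"
    proof -
      have "(\<integral>\<^sup>+t. ennreal (g1 t) \<partial>circ) \<le> (\<integral>\<^sup>+t. ennreal (g1 t) \<partial>lborel)"
        by (intro nn_integral_circ_le_lborel) auto
      also have "\<dots> = (\<integral>\<^sup>+t. ennreal (K0 * \<omega> \<delta> / \<delta>\<^sup>2) * indicator {-\<delta>..\<delta>} t \<partial>lborel)"
        by (intro nn_integral_cong) (auto simp: g1_def split: split_indicator)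
      also have "\<dots> = ennreal (K0 * \<omega> \<delta> / \<delta>\<^sup>2) * ennreal (2 * \<delta>)"
        using \<delta> by (subst nn_integral_cmult) auto
      also have "\<dots> = ennreal (K0 * \<omega> \<delta> / \<delta>\<^sup>2 * (2 * \<delta>))"
        using K0 \<omega>\<delta> \<delta> by (simp flip: ennreal_mult)
      also have "K0 * \<omega> \<delta> / \<delta>\<^sup>2 * (2 * \<delta>) = 2 * K0 * X"
        using \<delta> by (simp add: X_def power2_eq_square)
      finally show ?thesis .
    qed
    have I2: "(\<integral>\<^sup>+t. ennreal (g2 t) \<partial>circ) \<le> ennreal (C * X)"
    proof -
      have "(\<integral>\<^sup>+t. ennreal (g2 t) \<partial>circ) \<le> (\<integral>\<^sup>+t. ennreal (g2 t) \<partial>lborel)"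
        by (intro nn_integral_circ_le_lborel) auto
      also have "\<dots> \<le> ennreal (C * X)" using C(2)[of \<delta>] \<delta> \<eta>1 by (simp add: g2_def X_def)
      finally show ?thesis .
    qed
    have "(\<integral>\<^sup>+t. ennreal (g2 (- t)) \<partial>circ) \<le> (\<integral>\<^sup>+t. ennreal (g2 (- t)) \<partial>lborel)"
      by (intro nn_integral_circ_le_lborel) auto
    also have "\<dots> = (\<integral>\<^sup>+t. ennreal (g2 t) \<partial>lborel)"
      using nn_integral_real_affine[of "\<lambda>t. ennreal (g2 t)" "-1" 0] by simp
    also have "\<dots> \<le> ennreal (C * X)" using C(2)[of \<delta>] \<delta> \<eta>1 by (simp add: g2_def X_def)
    finally have I2': "(\<integral>\<^sup>+t. ennreal (g2 (- t)) \<partial>circ) \<le> ennreal (C * X)" .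
    have G3_le: "G3 \<le> 16 * real n * K0 * C / \<eta>1\<^sup>2 * X"
    proof -
      have "\<omega> \<eta>1 * (1 / 2) \<le> \<omega> \<eta>1 * (1 - \<eta>1)" using \<omega>\<eta>1 \<eta>1 by (intro mult_left_mono) auto
      also have "\<dots> \<le> C * X" unfolding X_def using \<delta> \<eta>1 by (intro C(3)) auto
      finally have "16 * real n * K0 / \<eta>1\<^sup>2 * (\<omega> \<eta>1 * (1 / 2)) \<le> 16 * real n * K0 / \<eta>1\<^sup>2 * (C * X)"
        using K0 n0 by (intro mult_left_mono) auto
      then show ?thesis by (simp add: G3_def mult_ac)
    qed
    have "Lp_le p (\<lambda>\<theta>. cis \<theta> * deriv f (of_real r * cis \<theta>)) (K1 * X)"
    proof (rule Lp_le_epsilon[where c = "1 / (1 - r\<^sup>2)"])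
      fix e :: real assume e: "0 < e"
      have \<kappa>_pos: "0 < norm (\<kappa> t)" for t
        unfolding \<kappa>_eq using Poisson_kernel_pos[OF r(2,3)] r2 by simp
      have "Lp_le p (\<lambda>\<theta>. LINT t:{-pi..pi}|circ. \<kappa> t * (b (\<theta> + t) - b \<theta>)) (K1 * X + e * (1 / (1 - r\<^sup>2)))"
      proof (rule Lp_le_set_integral[OF p, where w = "\<lambda>t. norm (\<kappa> t) * (w0 t + e)"])
        show "sigma_finite_measure circ" by unfold_locales
        show "0 < norm (\<kappa> t) * (w0 t + e)" for t
          using \<kappa>_pos[of t] w0_nonneg[of t] e by (intro mult_pos_pos) auto
        show "0 < K1 * X + e * (1 / (1 - r\<^sup>2))" using K1 X e r2 by (intro add_nonneg_pos) auto
        show "Lp_le p (\<lambda>\<theta>. \<kappa> t * (b (\<theta> + t) - b \<theta>)) (norm (\<kappa> t) * (w0 t + e))" if "t \<in> {-pi..pi}" for t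
          using that e by (intro Lp_le_cmult[OF Lp_le_mono[OF all _ p] p]) auto
        have "(\<integral>\<^sup>+t. ennreal (indicator {-pi..pi} t * (norm (\<kappa> t) * (w0 t + e))) \<partial>circ)
            \<le> (\<integral>\<^sup>+t. (ennreal (g1 t) + ennreal (8 * K0) * ennreal (g2 t) + ennreal (8 * K0) * ennreal (g2 (- t)) + ennreal G3)
                + ennreal (e / (1 - r\<^sup>2)) * ennreal (Poisson_kernel r t) \<partial>circ)"
        proof (intro nn_integral_mono)
          fix t
          have P: "0 \<le> Poisson_kernel r t" using Poisson_kernel_pos[OF r(2,3), of t] by simp
          have "indicator {-pi..pi} t * (norm (\<kappa> t) * (w0 t + e))
              \<le> (g1 t + 8 * K0 * g2 t + 8 * K0 * g2 (- t) + G3) + e / (1 - r\<^sup>2) * Poisson_kernel r t"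
          proof (cases "t \<in> {-pi..pi}")
            case True
            then have "\<bar>t\<bar> \<le> pi" by auto
            moreover have "norm (\<kappa> t) * (w0 t + e) = norm (\<kappa> t) * w0 t + e / (1 - r\<^sup>2) * Poisson_kernel r t"
              by (simp add: distrib_left \<kappa>_eq)
            ultimately show ?thesis using pointwise[of t] True by simp
          next
            case False
            then show ?thesis
              using g_nonneg(1)[of t] g_nonneg(2)[of t] g_nonneg(2)[of "- t"] g_nonneg(3) K0 e r2 P by simp
          qed
          then have "ennreal (indicator {-pi..pi} t * (norm (\<kappa> t) * (w0 t + e)))
            \<le> ennreal ((g1 t + 8 * K0 * g2 t + 8 * K0 * g2 (- t) + G3) + e / (1 - r\<^sup>2) * Poisson_kernel r t)"
            by (rule ennreal_leI)
          also have "\<dots> = (ennreal (g1 t) + ennreal (8 * K0) * ennreal (g2 t) + ennreal (8 * K0) * ennreal (g2 (- t)) + ennreal G3)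
                + ennreal (e / (1 - r\<^sup>2)) * ennreal (Poisson_kernel r t)"
            using g_nonneg(1)[of t] g_nonneg(2)[of t] g_nonneg(2)[of "- t"] g_nonneg(3) K0 e r2 P
            by (simp flip: ennreal_mult ennreal_plus)
          finally show "ennreal (indicator {-pi..pi} t * (norm (\<kappa> t) * (w0 t + e)))
            \<le> (ennreal (g1 t) + ennreal (8 * K0) * ennreal (g2 t) + ennreal (8 * K0) * ennreal (g2 (- t)) + ennreal G3)
                + ennreal (e / (1 - r\<^sup>2)) * ennreal (Poisson_kernel r t)" .
        qed
        also have "\<dots> = (\<integral>\<^sup>+t. ennreal (g1 t) \<partial>circ) + ennreal (8 * K0) * (\<integral>\<^sup>+t. ennreal (g2 t) \<partial>circ)
            + ennreal (8 * K0) * (\<integral>\<^sup>+t. ennreal (g2 (- t)) \<partial>circ) + ennreal G3 + ennreal (e / (1 - r\<^sup>2)) * 1"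
          by (simp add: nn_integral_add nn_integral_cmult emeasure_circ_UNIV nn_integral_Poisson_kernel[OF r(2,3)])
        also have "\<dots> \<le> ennreal (2 * K0 * X) + ennreal (8 * K0) * ennreal (C * X) + ennreal (8 * K0) * ennreal (C * X)
            + ennreal (16 * real n * K0 * C / \<eta>1\<^sup>2 * X) + ennreal (e / (1 - r\<^sup>2)) * 1"
          by (intro add_mono mult_left_mono I1 I2 I2' ennreal_leI G3_le order_refl) auto
        also have "\<dots> = ennreal (2 * K0 * X + 8 * K0 * (C * X) + 8 * K0 * (C * X)
            + 16 * real n * K0 * C / \<eta>1\<^sup>2 * X + e / (1 - r\<^sup>2))"
          using K0 C X e r2 by (simp flip: ennreal_mult ennreal_plus)
        also have "2 * K0 * X + 8 * K0 * (C * X) + 8 * K0 * (C * X) + 16 * real n * K0 * C / \<eta>1\<^sup>2 * X + e / (1 - r\<^sup>2)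
            = K1 * X + e * (1 / (1 - r\<^sup>2))"
          by (simp add: K1_def algebra_simps)
        finally show "(\<integral>\<^sup>+t. ennreal (indicator {-pi..pi} t * (norm (\<kappa> t) * (w0 t + e))) \<partial>circ) \<le> ennreal (K1 * X + e * (1 / (1 - r\<^sup>2)))" .
      qed auto
      moreover have "(LINT t:{-pi..pi}|circ. \<kappa> t * (b (\<theta> + t) - b \<theta>)) = cis \<theta> * deriv f (of_real r * cis \<theta>)" for \<theta>
      proof -
        have "(LINT t:{-pi..pi}|circ. \<kappa> t * (b (\<theta> + t) - b \<theta>)) = (LINT t|circ. \<kappa> t * (b (\<theta> + t) - b \<theta>))"
          unfolding set_lebesgue_integral_def
          by (intro Bochner_Integration.integral_cong_AE) (auto simp: AE_circ_iff)
        then show ?thesis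
          using derivative_from_boundary_values[OF fH p r(2,3), of \<theta>] by (simp add: \<kappa>_def b_def)
      qed
      ultimately show "Lp_le p (\<lambda>\<theta>. cis \<theta> * deriv f (of_real r * cis \<theta>)) (K1 * X + e * (1 / (1 - r\<^sup>2)))" by simp
    qed fact
    then have "Lp_le p (on_circle (deriv f) r) (K1 * X)"
      by (rule Lp_le_AE_norm_mono) (use p measurable_holomorphic_circle[OF f' r(2,3)] in \<open>auto simp: norm_mult\<close>)
    then show ?thesis by (simp add: r_def X_def)
  qed
  show thesis by (rule that[OF K1 \<eta>1(1) _ main]) (use \<eta>1 in auto)
qed

theorem theorem3p1:
  fixes p :: real and \<omega> :: "real \<Rightarrow> real" and f :: "complex \<Rightarrow> complex"
  assumes "1 \<le> p" and "f \<in> hardy_space p"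
  shows "(dini_weight \<omega> \<and> (\<exists>C>0. \<forall>t\<in>{0<..<1}. \<omega> t / t \<ge> C) \<longrightarrow>
      ((\<lambda>r. integral_mean p r (deriv f)) \<in> O[at_left 1](\<lambda>r. \<omega> (1 - r) / (1 - r)) \<longleftrightarrow>
       (\<lambda>r. hardy_norm p (\<lambda>z. dilation r f z - f z)) \<in> O[at_left 1](\<lambda>r. \<omega> (1 - r)))) \<and>
    (admissible_weight \<omega> \<longrightarrow>
      ((\<lambda>r. integral_mean p r (deriv f)) \<in> O[at_left 1](\<lambda>r. \<omega> (1 - r) / (1 - r)) \<longleftrightarrow>
       (\<lambda>r. hardy_norm p (\<lambda>z. dilation r f z - f z)) \<in> O[at_left 1](\<lambda>r. \<omega> (1 - r))) \<and>
      (f \<in> mean_lipschitz_space p \<omega> \<longleftrightarrow>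
       (\<lambda>r. integral_mean p r (deriv f)) \<in> O[at_left 1](\<lambda>r. \<omega> (1 - r) / (1 - r))))"
proof -
  note p = assms(1) and f = assms(2)
  have hol: "f holomorphic_on ball 0 1" using f by (simp add: hardy_space_def)
  have f': "deriv f holomorphic_on ball 0 1" by (intro holomorphic_deriv hol) auto
  have growth_iff: "(\<lambda>r. integral_mean p r (deriv f)) \<in> O[at_left 1](\<lambda>r. \<omega> (1 - r) / (1 - r)) \<longleftrightarrow>
      (\<exists>K>0. \<exists>t0. 0 < t0 \<and> t0 < 1 \<and> (\<forall>t. 0 < t \<and> t < t0 \<longrightarrow>
        Lp_le p (on_circle (deriv f) (1 - t)) (K * (\<omega> t / t))))" if w: "weight \<omega>"
  proof -
    have "(\<lambda>r. integral_mean p r (deriv f)) \<in> O[at_left 1](\<lambda>r. \<omega> (1 - r) / (1 - r)) \<longleftrightarrow>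
      (\<exists>K>0. \<exists>t0. 0 < t0 \<and> t0 < 1 \<and> (\<forall>t. 0 < t \<and> t < t0 \<longrightarrow> integral_mean p (1 - t) (deriv f) \<le> K * (\<omega> t / t)))"
      by (rule bigo_at_left_1_iff[where \<nu> = "\<lambda>t. \<omega> t / t"])
         (use weightD(2)[OF w] in \<open>auto simp: integral_mean_nonneg\<close>)
    also have "\<dots> \<longleftrightarrow> (\<exists>K>0. \<exists>t0. 0 < t0 \<and> t0 < 1 \<and> (\<forall>t. 0 < t \<and> t < t0 \<longrightarrow>
        Lp_le p (on_circle (deriv f) (1 - t)) (K * (\<omega> t / t))))"
      by (intro arg_cong[where f = Ex] ext conj_cong refl all_cong imp_cong integral_mean_le_iff f' p) auto
    finally show ?thesis .
  qed
  have dilation_iff: "(\<lambda>r. hardy_norm p (\<lambda>z. dilation r f z - f z)) \<in> O[at_left 1](\<lambda>r. \<omega> (1 - r)) \<longleftrightarrow>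
      (\<exists>K>0. \<exists>t0. 0 < t0 \<and> t0 < 1 \<and> (\<forall>t. 0 < t \<and> t < t0 \<longrightarrow>
        hardy_norm p (\<lambda>z. dilation (1 - t) f z - f z) \<le> K * \<omega> t))" if w: "weight \<omega>"
    using weightD(2)[OF w] by (intro bigo_at_left_1_iff hardy_norm_nonneg dilation_diff_hardy_space f p) auto
  have bc: "(\<lambda>r. integral_mean p r (deriv f)) \<in> O[at_left 1](\<lambda>r. \<omega> (1 - r) / (1 - r)) \<longleftrightarrow>
       (\<lambda>r. hardy_norm p (\<lambda>z. dilation r f z - f z)) \<in> O[at_left 1](\<lambda>r. \<omega> (1 - r))" (is "?b \<longleftrightarrow> ?c")
    if dini: "dini_weight \<omega>"
  proof
    have w: "weight \<omega>" using dini by (simp add: dini_weight_def)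
    {
      assume ?b
      then obtain K t0 where K: "0 < K" "0 < t0" "t0 < 1" "\<And>t. 0 < t \<Longrightarrow> t < t0 \<Longrightarrow>
          Lp_le p (on_circle (deriv f) (1 - t)) (K * (\<omega> t / t))"
        unfolding growth_iff[OF w] by blast
      obtain K' where K': "0 < K'" "\<And>t s. 0 < t \<Longrightarrow> t < t0 \<Longrightarrow> 0 \<le> s \<Longrightarrow> s < 1 \<Longrightarrow>
          Lp_le p (\<lambda>\<theta>. f (of_real (1 - t) * (of_real s * cis \<theta>)) - f (of_real s * cis \<theta>)) (K' * \<omega> t)"
        using derivative_growth_imp_dilation_bound[OF dini p hol less_imp_le[OF K(1)] K(3,4)] by blast
      have "hardy_norm p (\<lambda>z. dilation (1 - t) f z - f z) \<le> K' * \<omega> t" if t: "0 < t" "t < t0" for t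
      proof (rule hardy_spaceI(2)[OF _ _ p])
        have "(\<lambda>z. dilation (1 - t) f z - f z) \<in> hardy_space p"
          using t K by (intro dilation_diff_hardy_space f p) auto
        then show "(\<lambda>z. dilation (1 - t) f z - f z) holomorphic_on ball 0 1" by (simp add: hardy_space_def)
        show "Lp_le p (\<lambda>\<theta>. dilation (1 - t) f (of_real s * cis \<theta>) - f (of_real s * cis \<theta>)) (K' * \<omega> t)"
          if "0 \<le> s" "s < 1" for s
          using K'(2)[OF t that] by (simp add: dilation_def)
      qed
      then show ?c unfolding dilation_iff[OF w] using K'(1) K(2,3) by blast
    next
      assume ?c
      then obtain K t0 where K: "0 < K" "0 < t0" "t0 < 1" "\<And>t. 0 < t \<Longrightarrow> t < t0 \<Longrightarrow>
          hardy_norm p (\<lambda>z. dilation (1 - t) f z - f z) \<le> K * \<omega> t"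
        unfolding dilation_iff[OF w] by blast
      have dil: "Lp_le p (\<lambda>\<theta>. f (of_real (1 - t) * (of_real s * cis \<theta>)) - f (of_real s * cis \<theta>)) (K * \<omega> t)"
        if t: "0 < t" "t < min t0 (1 / 2)" and s: "0 \<le> s" "s < 1" for t s
      proof -
        have "(\<lambda>z. dilation (1 - t) f z - f z) \<in> hardy_space p"
          using t K by (intro dilation_diff_hardy_space f p) auto
        from hardy_space_bounded_means[OF this s p]
        have "Lp_le p (\<lambda>\<theta>. dilation (1 - t) f (of_real s * cis \<theta>) - f (of_real s * cis \<theta>)) (K * \<omega> t)"
          by (rule Lp_le_mono) (use K(4)[of t] t p in auto)
        then show ?thesis by (simp add: dilation_def)
      qed
      have "Lp_le p (on_circle (deriv f) (1 - t)) (64 * K * (\<omega> t / t))"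
        if "0 < t" "t < min t0 (1 / 2)" for t
        using dilation_bound_imp_derivative_growth[OF w p f _ _ dil that] K by simp
      moreover have "0 < 64 * K" "0 < min t0 (1 / 2)" "min t0 (1 / 2) < 1" using K by auto
      ultimately show ?b unfolding growth_iff[OF w] by blast
    }
  qed
  have ab: "f \<in> mean_lipschitz_space p \<omega> \<longleftrightarrow>
       (\<lambda>r. integral_mean p r (deriv f)) \<in> O[at_left 1](\<lambda>r. \<omega> (1 - r) / (1 - r))" if adm: "admissible_weight \<omega>"
  proof -
    have dini: "dini_weight \<omega>" and w: "weight \<omega>"
      using adm by (auto simp: admissible_weight_def dini_weight_def)
    show ?thesis unfolding growth_iff[OF w]
    proof
      assume "f \<in> mean_lipschitz_space p \<omega>"
      then show "\<exists>K>0. \<exists>t0. 0 < t0 \<and> t0 < 1 \<and> (\<forall>t. 0 < t \<and> t < t0 \<longrightarrow>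
          Lp_le p (on_circle (deriv f) (1 - t)) (K * (\<omega> t / t)))"
        using mean_lipschitz_imp_derivative_growth[OF adm p] by metis
    next
      assume "\<exists>K>0. \<exists>t0. 0 < t0 \<and> t0 < 1 \<and> (\<forall>t. 0 < t \<and> t < t0 \<longrightarrow>
          Lp_le p (on_circle (deriv f) (1 - t)) (K * (\<omega> t / t)))"
      then obtain K t0 where "0 < K" "0 < t0" "t0 < 1" "\<And>t. 0 < t \<Longrightarrow> t < t0 \<Longrightarrow>
          Lp_le p (on_circle (deriv f) (1 - t)) (K * (\<omega> t / t))"
        by blast
      then show "f \<in> mean_lipschitz_space p \<omega>"
        by (intro derivative_growth_imp_mean_lipschitz[OF dini p f, of K t0]) auto
    qed
  qed
  have "dini_weight \<omega>" if "admissible_weight \<omega>" using that by (simp add: admissible_weight_def)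
  then show ?thesis using bc ab by blast
qed

end
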